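(* Let $\omega\subset\mathbb{R}^2$ be a bounded domain with $C^2$-boundary containing the origin, and let $\beta\in\mathbb{R}$. Set $$C_\omega=\sup_{x_t=(x_1,x_2)\in\omega}(x_1^2+x_2^2),\qquad \epsilon_\omega(\beta)=\frac{\beta^2C_\omega}{1+\beta^2C_\omega}.$$ Then $$E_1(0,\beta)+(1-\epsilon_\omega(\beta))\,p^2\le E_1(p,\beta)\le E_1(0,\beta)+p^2,\qquad p\in\mathbb{R},$$ where $E_1(p,\beta)$ is the lowest eigenvalue of the operator $h_\beta(p)$ defined in the context.
   Context: A domain is a connected open set. Write $x_t=(x_1,x_2)$, $\nabla_t=(\partial_1,\partial_2)^T$, $\Delta_t=\partial_1^2+\partial_2^2$, $\partial_\varphi=x_1\partial_2-x_2\partial_1$. For $p,\beta\in\mathbb{R}$, $h_\beta(p)=-\Delta_t-(\beta\partial_\varphi+ip)^2$ is the self-adjoint operator in $L^2(\omega)$ generated by the closed quadratic form $$q_{p,\beta}[u]=\int_\omega\left(|\nabla_t u|^2+|i\beta\partial_\varphi u-pu|^2\right)dx_t,\qquad u\in H^1_0(\omega).$$ Its spectrum is purely discrete, and $E_1(p,\beta)$ denotes its lowest eigenvalue. *)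

theory Defs
  imports "HOL-Analysis.Analysis"
begin

section \<open>Differentiability classes and boundary regularity\<close>

text \<open>Directional derivative; along basis vectors these are the partial derivatives.\<close>

definition dir_deriv ::
  "'a::euclidean_space \<Rightarrow> ('a \<Rightarrow> 'b::real_normed_vector) \<Rightarrow> 'a \<Rightarrow> 'b" where
  "dir_deriv b f x = frechet_derivative f (at x) b"

text \<open>\<open>Ck k f\<close>: the function \<open>f\<close> is of class \<open>C\<^sup>k\<close> on the whole space.\<close>

fun Ck :: "nat \<Rightarrow> ('a::euclidean_space \<Rightarrow> 'b::real_normed_vector) \<Rightarrow> bool" where
  "Ck 0 f \<longleftrightarrow> continuous_on UNIV f"
| "Ck (Suc k) f \<longleftrightarrow> (\<forall>x. f differentiable (at x)) \<and> (\<forall>b\<in>Basis. Ck k (dir_deriv b f))"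

definition smooth :: "('a::euclidean_space \<Rightarrow> 'b::real_normed_vector) \<Rightarrow> bool" where
  "smooth f \<longleftrightarrow> (\<forall>k. Ck k f)"

text \<open>A planar set has \<open>C\<^sup>k\<close>-boundary if near each boundary point, in suitable orthogonal
  coordinates \<open>T\<close>, it is the strict epigraph of a \<open>C\<^sup>k\<close> function of one variable.\<close>

definition Ck_boundary :: "nat \<Rightarrow> (real \<times> real) set \<Rightarrow> bool" where
  "Ck_boundary k \<omega> \<longleftrightarrow>
    (\<forall>z\<in>frontier \<omega>. \<exists>r>0. \<exists>T \<gamma>. orthogonal_transformation (T :: real \<times> real \<Rightarrow> real \<times> real) \<and>
       Ck k (\<gamma> :: real \<Rightarrow> real) \<and>
       \<omega> \<inter> ball z r = {x \<in> ball z r. \<gamma> (fst (T x)) < snd (T x)})"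


section \<open>Square-integrable functions and Sobolev spaces\<close>

text \<open>Elements of \<open>L\<^sup>2\<close> are represented by functions; equality in \<open>L\<^sup>2\<close> is equality
  almost everywhere. For \<open>L\<^sup>2(\<omega>)\<close> the measure is Lebesgue measure on \<open>\<omega>\<close>, so values
  outside \<open>\<omega>\<close> are irrelevant.\<close>

definition L2 :: "'a measure \<Rightarrow> ('a \<Rightarrow> complex) set" where
  "L2 M = {f \<in> borel_measurable M. integrable M (\<lambda>x. (norm (f x))\<^sup>2)}"

definition L2_inner :: "'a measure \<Rightarrow> ('a \<Rightarrow> complex) \<Rightarrow> ('a \<Rightarrow> complex) \<Rightarrow> complex" where
  "L2_inner M f g = (\<integral>x. f x * cnj (g x) \<partial>M)"

definition test_functions :: "'a::euclidean_space set \<Rightarrow> ('a \<Rightarrow> complex) set" where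
  "test_functions \<omega> =
    {\<phi>. smooth \<phi> \<and> compact (closure {x. \<phi> x \<noteq> 0}) \<and> closure {x. \<phi> x \<noteq> 0} \<subseteq> \<omega>}"

text \<open>\<open>g\<close> is a weak derivative in direction \<open>b\<close> of \<open>u\<close> on \<open>\<omega>\<close>, for \<open>u, g \<in> L\<^sup>2(\<omega>)\<close>.\<close>

definition is_weak_deriv ::
  "'a::euclidean_space set \<Rightarrow> 'a \<Rightarrow> ('a \<Rightarrow> complex) \<Rightarrow> ('a \<Rightarrow> complex) \<Rightarrow> bool" where
  "is_weak_deriv \<omega> b u g \<longleftrightarrow> u \<in> L2 (lebesgue_on \<omega>) \<and> g \<in> L2 (lebesgue_on \<omega>) \<and>
    (\<forall>\<phi>\<in>test_functions \<omega>.
       (\<integral>x. u x * dir_deriv b \<phi> x \<partial>lebesgue_on \<omega>) = - (\<integral>x. g x * \<phi> x \<partial>lebesgue_on \<omega>))"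

text \<open>A representative of the weak derivative, which is unique almost everywhere in \<open>\<omega>\<close>
  when it exists.\<close>

definition weak_deriv ::
  "'a::euclidean_space set \<Rightarrow> 'a \<Rightarrow> ('a \<Rightarrow> complex) \<Rightarrow> 'a \<Rightarrow> complex" where
  "weak_deriv \<omega> b u = (SOME g. is_weak_deriv \<omega> b u g)"

definition H1 :: "'a::euclidean_space set \<Rightarrow> ('a \<Rightarrow> complex) set" where
  "H1 \<omega> = {u \<in> L2 (lebesgue_on \<omega>). \<forall>b\<in>Basis. \<exists>g. is_weak_deriv \<omega> b u g}"

definition H1_norm :: "'a::euclidean_space set \<Rightarrow> ('a \<Rightarrow> complex) \<Rightarrow> real" where
  "H1_norm \<omega> u = sqrt ((\<integral>x. (norm (u x))\<^sup>2 \<partial>lebesgue_on \<omega>) +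
     (\<Sum>b\<in>Basis. \<integral>x. (norm (weak_deriv \<omega> b u x))\<^sup>2 \<partial>lebesgue_on \<omega>))"

text \<open>\<open>H\<^sup>1\<^sub>0(\<omega>)\<close>: the closure of the test functions in \<open>H\<^sup>1(\<omega>)\<close>.\<close>

definition H10 :: "'a::euclidean_space set \<Rightarrow> ('a \<Rightarrow> complex) set" where
  "H10 \<omega> = {u \<in> H1 \<omega>. \<exists>\<phi>. (\<forall>n. \<phi> n \<in> test_functions \<omega>) \<and>
     (\<lambda>n. H1_norm \<omega> (\<lambda>x. u x - \<phi> n x)) \<longlonglongrightarrow> 0}"


section \<open>The operator generated by a quadratic form\<close>

text \<open>The sesquilinear form of a quadratic form, linear in the first and antilinear in the
  second argument, matching \<open>L2_inner\<close>.\<close>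

definition polarization ::
  "(('a \<Rightarrow> complex) \<Rightarrow> real) \<Rightarrow> ('a \<Rightarrow> complex) \<Rightarrow> ('a \<Rightarrow> complex) \<Rightarrow> complex" where
  "polarization q u v =
    (\<Sum>k<4. \<i> ^ k * complex_of_real (q (\<lambda>x. u x + \<i> ^ k * v x))) / 4"

text \<open>The operator in \<open>L\<^sup>2(M)\<close> generated by the form \<open>q\<close> with form domain \<open>D\<close> (first
  representation theorem), as a graph: \<open>u\<close> lies in the operator domain and is mapped to \<open>f\<close>
  iff \<open>q(u,v) = \<langle>f,v\<rangle>\<close> for all \<open>v \<in> D\<close>. For dense \<open>D\<close> this determines \<open>f\<close> almost everywhere.\<close>

definition form_operator ::
  "'a measure \<Rightarrow> ('a \<Rightarrow> complex) set \<Rightarrow> (('a \<Rightarrow> complex) \<Rightarrow> real) \<Rightarrow>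
    (('a \<Rightarrow> complex) \<times> ('a \<Rightarrow> complex)) set" where
  "form_operator M D q =
    {(u, f). u \<in> D \<and> f \<in> L2 M \<and> (\<forall>v\<in>D. polarization q u v = L2_inner M f v)}"

text \<open>Real eigenvalues suffice, since the operators considered are self-adjoint.\<close>

definition is_eigenvalue ::
  "'a measure \<Rightarrow> (('a \<Rightarrow> complex) \<times> ('a \<Rightarrow> complex)) set \<Rightarrow> real \<Rightarrow> bool" where
  "is_eigenvalue M A \<mu> \<longleftrightarrow>
    (\<exists>u. (u, \<lambda>x. complex_of_real \<mu> * u x) \<in> A \<and> \<not> (AE x in M. u x = 0))"

text \<open>Meaningful only if a smallest eigenvalue exists, as for operators that are bounded
  below with purely discrete spectrum.\<close>

definition lowest_eigenvalue ::
  "'a measure \<Rightarrow> (('a \<Rightarrow> complex) \<times> ('a \<Rightarrow> complex)) set \<Rightarrow> real" where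
  "lowest_eigenvalue M A = (LEAST \<mu>. is_eigenvalue M A \<mu>)"


section \<open>The fiber operators of the twisted waveguide\<close>

abbreviation weak_d1 :: "(real \<times> real) set \<Rightarrow> (real \<times> real \<Rightarrow> complex) \<Rightarrow> real \<times> real \<Rightarrow> complex" where
  "weak_d1 \<omega> \<equiv> weak_deriv \<omega> (1, 0)"

abbreviation weak_d2 :: "(real \<times> real) set \<Rightarrow> (real \<times> real \<Rightarrow> complex) \<Rightarrow> real \<times> real \<Rightarrow> complex" where
  "weak_d2 \<omega> \<equiv> weak_deriv \<omega> (0, 1)"

definition angular_deriv ::
  "(real \<times> real) set \<Rightarrow> (real \<times> real \<Rightarrow> complex) \<Rightarrow> real \<times> real \<Rightarrow> complex" where
  "angular_deriv \<omega> u x =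
    complex_of_real (fst x) * weak_d2 \<omega> u x - complex_of_real (snd x) * weak_d1 \<omega> u x"

definition q_form :: "(real \<times> real) set \<Rightarrow> real \<Rightarrow> real \<Rightarrow> (real \<times> real \<Rightarrow> complex) \<Rightarrow> real" where
  "q_form \<omega> p \<beta> u =
    (\<integral>x. (norm (weak_d1 \<omega> u x))\<^sup>2 + (norm (weak_d2 \<omega> u x))\<^sup>2 +
         (norm (\<i> * complex_of_real \<beta> * angular_deriv \<omega> u x - complex_of_real p * u x))\<^sup>2
     \<partial>lebesgue_on \<omega>)"

definition h_op :: "(real \<times> real) set \<Rightarrow> real \<Rightarrow> real \<Rightarrow>
    ((real \<times> real \<Rightarrow> complex) \<times> (real \<times> real \<Rightarrow> complex)) set" where
  "h_op \<omega> p \<beta> = form_operator (lebesgue_on \<omega>) (H10 \<omega>) (q_form \<omega> p \<beta>)"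

definition E1 :: "(real \<times> real) set \<Rightarrow> real \<Rightarrow> real \<Rightarrow> real" where
  "E1 \<omega> p \<beta> = lowest_eigenvalue (lebesgue_on \<omega>) (h_op \<omega> p \<beta>)"

definition C_const :: "(real \<times> real) set \<Rightarrow> real" where
  "C_const \<omega> = (SUP x\<in>\<omega>. (fst x)\<^sup>2 + (snd x)\<^sup>2)"

definition eps_const :: "(real \<times> real) set \<Rightarrow> real \<Rightarrow> real" where
  "eps_const \<omega> \<beta> = \<beta>\<^sup>2 * C_const \<omega> / (1 + \<beta>\<^sup>2 * C_const \<omega>)"

end

theory Submission
  imports Defs "HOL-Complex_Analysis.Great_Picard"
begin

text \<open>
  The lowest eigenvalue is the infimum of the Rayleigh quotient over test functions
  (\<open>E1_eq_ground_energy\<close>), so both inequalities reduce to pointwise estimates for smooth,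
  compactly supported functions.

  The upper bound compares \<open>\<phi>\<close> with its complex conjugate. Conjugation changes the sign of the
  term of the form that is linear in \<open>p\<close>, so the values of the form for momentum \<open>p\<close> at \<open>\<phi>\<close> and
  at its conjugate add up to twice the value for momentum \<open>0\<close> plus \<open>2 p\<^sup>2 \<parallel>\<phi>\<parallel>\<^sup>2\<close>, and both are
  bounded below by \<open>E\<^sub>1(p)\<close> when \<open>\<phi>\<close> is normalized (\<open>ground_energy_upper\<close>).

  The lower bound is a diamagnetic argument. Split the gradient of \<open>\<phi> = \<bar>\<phi>\<bar> e\<^sup>i\<^sup>\<theta>\<close> into the
  derivative of the modulus and the current \<open>J = \<bar>\<phi>\<bar> \<nabla>\<theta>\<close>. The modulus part reproduces the form
  for momentum \<open>0\<close> at \<open>\<bar>\<phi>\<bar>\<close>. The rest is \<open>\<bar>J\<bar>\<^sup>2 + (\<beta> K + p \<bar>\<phi>\<bar>)\<^sup>2\<close>, where the angular component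
  \<open>K = x\<^sub>1 J\<^sub>2 - x\<^sub>2 J\<^sub>1\<close> satisfies \<open>K\<^sup>2 \<le> C\<^sub>\<omega> \<bar>J\<bar>\<^sup>2\<close>, and minimizing over \<open>J\<close> leaves at least \<open>p\<^sup>2 \<bar>\<phi>\<bar>\<^sup>2 / (1 + \<beta>\<^sup>2 C\<^sub>\<omega>)\<close>, which is
  \<open>(1 - \<epsilon>\<^sub>\<omega>(\<beta>)) p\<^sup>2 \<bar>\<phi>\<bar>\<^sup>2\<close>. The modulus is not smooth at zeros of \<open>\<phi>\<close>, so it is replaced by the
  test function \<open>sqrt (\<bar>\<phi>\<bar>\<^sup>2 + \<delta>\<^sup>2) - \<delta>\<close>, and \<open>\<delta>\<close> tends to \<open>0\<close>
  (\<open>soft_abs_form_density\<close>, \<open>ground_energy_lower\<close>).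

  Most of the text proves that the infimum is an eigenvalue at all. A minimizing sequence has an
  \<open>L\<^sup>2\<close>-convergent subsequence by Rellich's theorem (\<open>Rellich_test_functions\<close>), which follows from
  a Poincare inequality on a grid of small squares. By the parallelogram law the gradients of
  the subsequence are Cauchy too, and completeness of \<open>L\<^sup>2\<close> gives a minimizer in the form domain
  (\<open>ground_state_exists\<close>). Nonnegativity of the form minus the infimum times the squared norm
  then yields the eigenvalue equation. Weak derivatives are arbitrary representatives, so their
  uniqueness almost everywhere is needed throughout; it rests on the fundamental lemma
  (\<open>AE_zero_of_test_functions\<close>).
\<close>

section \<open>Calculus of functions of class C^k\<close>

lemma dir_deriv_eqI: "(f has_derivative f') (at x) \<Longrightarrow> dir_deriv b f x = f' b"
  using frechet_derivative_at[of f f' x] by (simp add: dir_deriv_def)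

lemma Ck_Suc_has_derivative:
  "Ck (Suc k) f \<Longrightarrow> (f has_derivative (\<lambda>h. dir_deriv h f x)) (at x)"
  using frechet_derivative_works[of f "at x"] by (simp add: dir_deriv_def)

text \<open>Derivatives are best supplied as a whole: one formula for the total derivative then yields all
  the partial derivatives on which the recursion descends.\<close>

lemma Ck_SucI:
  assumes "\<And>x. (f has_derivative D x) (at x)" "\<And>b. b \<in> Basis \<Longrightarrow> Ck k (\<lambda>x. D x b)"
  shows "Ck (Suc k) f"
proof -
  have "dir_deriv b f = (\<lambda>x. D x b)" for b
    using dir_deriv_eqI[OF assms(1)] by auto
  then show ?thesis using assms by (auto simp: differentiable_def)
qed

lemma Ck_continuous: "Ck k f \<Longrightarrow> continuous_on UNIV f"
  by (cases k) (auto intro: differentiable_imp_continuous_on simp: differentiable_on_def differentiable_at_withinI)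

lemma Ck_Suc_imp: "Ck (Suc k) f \<Longrightarrow> Ck k f"
proof (induction k arbitrary: f)
  case 0
  then show ?case using Ck_continuous[of "Suc 0" f] by simp
next
  case (Suc k)
  then show ?case by auto
qed

lemma Ck_dir_deriv: "Ck (Suc k) f \<Longrightarrow> b \<in> Basis \<Longrightarrow> Ck k (dir_deriv b f)"
  by simp

lemma Ck_const: "Ck k (\<lambda>x. c)"
proof (induction k arbitrary: c)
  case (Suc k)
  show ?case by (rule Ck_SucI[where D = "\<lambda>_ _. 0"]) (auto intro: Suc.IH)
qed simp

lemma Ck_bounded_linear:
  assumes "bounded_linear L" "Ck k f"
  shows "Ck k (\<lambda>x. L (f x))"
  using assms(2)
proof (induction k arbitrary: f)
  case 0
  then show ?case using bounded_linear.continuous_on[OF assms(1)] by simp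
next
  case (Suc k)
  show ?case
    by (rule Ck_SucI[OF bounded_linear.has_derivative[OF assms(1) Ck_Suc_has_derivative[OF Suc.prems]]])
      (intro Suc.IH Ck_dir_deriv[OF Suc.prems])
qed

lemma Ck_add:
  assumes "Ck k f" "Ck k g"
  shows "Ck k (\<lambda>x. f x + g x)"
  using assms
proof (induction k arbitrary: f g)
  case 0
  then show ?case by (simp add: continuous_on_add)
next
  case (Suc k)
  show ?case
    by (rule Ck_SucI[OF has_derivative_add[OF Suc.prems[THEN Ck_Suc_has_derivative]]])
      (intro Suc.IH Suc.prems[THEN Ck_dir_deriv])
qed

lemma Ck_bilinear:
  assumes "bounded_bilinear P" "Ck k f" "Ck k g"
  shows "Ck k (\<lambda>x. P (f x) (g x))"
  using assms(2,3)
proof (induction k arbitrary: f g)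
  case 0
  then show ?case using bounded_bilinear.continuous_on[OF assms(1)] by simp
next
  case (Suc k)
  show ?case
    by (rule Ck_SucI[OF bounded_bilinear.FDERIV[OF assms(1) Suc.prems[THEN Ck_Suc_has_derivative]]])
      (intro Ck_add Suc.IH Suc.prems[THEN Ck_dir_deriv] Suc.prems[THEN Ck_Suc_imp])
qed

lemmas Ck_mult = Ck_bilinear[OF bounded_bilinear_mult]

lemma Ck_compose_real:
  fixes \<psi> :: "real \<Rightarrow> real" and f :: "'a::euclidean_space \<Rightarrow> real"
  assumes "Ck k \<psi>" "Ck k f"
  shows "Ck k (\<lambda>x. \<psi> (f x))"
  using assms
proof (induction k arbitrary: \<psi>)
  case 0
  then show ?case using continuous_on_compose2[of UNIV \<psi> UNIV f] by simp
next
  case (Suc k)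
  have psi: "(\<psi> has_derivative (\<lambda>h. dir_deriv 1 \<psi> y * h)) (at y)" for y
  proof -
    have D: "(\<psi> has_derivative (\<lambda>h. dir_deriv h \<psi> y)) (at y)"
      using Suc.prems Ck_Suc_has_derivative by blast
    have "dir_deriv h \<psi> y = dir_deriv 1 \<psi> y * h" for h
      using linear_scale[OF has_derivative_linear[OF D], of h 1] by (simp add: mult.commute)
    then have "(\<lambda>h. dir_deriv h \<psi> y) = (\<lambda>h. dir_deriv 1 \<psi> y * h)" by (rule ext)
    with D show ?thesis by (rule subst[rotated])
  qed
  show ?case
  proof (rule Ck_SucI[OF has_derivative_compose[OF Ck_Suc_has_derivative[OF Suc.prems(2)] psi]])
    fix b :: 'a assume "b \<in> Basis"
    then show "Ck k (\<lambda>x. dir_deriv 1 \<psi> (f x) * dir_deriv b f x)"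
      using Suc.IH[of "dir_deriv 1 \<psi>"] Suc.prems Ck_Suc_imp[of k f] by (intro Ck_mult) auto
  qed
qed

text \<open>The exponent is arbitrary in the induction because differentiation lowers it by one.\<close>

lemma Ck_powr:
  fixes f :: "'a::euclidean_space \<Rightarrow> real"
  assumes "\<And>x. f x > 0" "Ck k f"
  shows "Ck k (\<lambda>x. f x powr a)"
  using assms(2)
proof (induction k arbitrary: a)
  case 0
  then show ?case using assms(1) by (auto intro!: continuous_on_powr simp: less_imp_neq[symmetric])
next
  case (Suc k)
  have p: "((\<lambda>y. y powr a) has_derivative (\<lambda>h. a * y powr (a - 1) * h)) (at y)" if "y > 0" for y :: real
    using has_real_derivative_powr[OF that, of a] by (simp add: has_field_derivative_def)
  show ?case
    by (rule Ck_SucI[OF has_derivative_compose[OF Ck_Suc_has_derivative[OF Suc.prems] p[OF assms(1)]]])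
      (intro Ck_mult Ck_const Suc.IH Suc.prems[THEN Ck_dir_deriv] Suc.prems[THEN Ck_Suc_imp])
qed

text \<open>The powers of \<open>1/t\<close> make the family closed, up to linear combinations, under
  differentiation; \<open>flat_exp 0\<close> is the classical smooth function that vanishes exactly for
  \<open>t \<le> 0\<close>.\<close>

definition flat_exp :: "nat \<Rightarrow> real \<Rightarrow> real" where
  "flat_exp j t = (if t > 0 then exp (- inverse t) * inverse t ^ j else 0)"

lemma flat_exp_tendsto_0: "(flat_exp j \<longlongrightarrow> 0) (at 0)"
proof -
  have 1: "((\<lambda>t. flat_exp j t) \<longlongrightarrow> 0) (at_left 0)"
    by (rule tendsto_eventually) (auto simp: flat_exp_def eventually_at_left_field intro!: exI[of _ "-1"])
  have "((\<lambda>x::real. x ^ j / exp x) \<longlongrightarrow> 0) at_top" by (rule tendsto_power_div_exp_0)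
  then have "((\<lambda>t. inverse t ^ j / exp (inverse t :: real)) \<longlongrightarrow> 0) (at_right 0)"
    by (rule filterlim_compose[OF _ filterlim_inverse_at_top_right])
  moreover have "\<forall>\<^sub>F t in at_right 0. inverse t ^ j / exp (inverse t) = flat_exp j t"
    by (auto simp: eventually_at_right_field flat_exp_def exp_minus divide_inverse mult.commute intro!: exI[of _ 1])
  ultimately have 2: "(flat_exp j \<longlongrightarrow> 0) (at_right 0)"
    by (rule Lim_transform_eventually)
  from 1 2 show ?thesis by (simp add: filterlim_split_at)
qed

text \<open>At the origin the difference quotient of \<open>flat_exp j\<close> is \<open>flat_exp (Suc j)\<close>, which tends to \<open>0\<close>.\<close>

lemma flat_exp_deriv:
  "(flat_exp j has_real_derivative (flat_exp (j + 2) t - real j * flat_exp (j + 1) t)) (at t)"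
proof (cases t "0::real" rule: linorder_cases)
  case less
  have "((\<lambda>_. 0) has_real_derivative (flat_exp (j + 2) t - real j * flat_exp (j + 1) t)) (at t)"
    using less by (simp add: flat_exp_def)
  then show ?thesis
    by (rule has_field_derivative_transform_within_open[where S = "{..<0}"]) (use less in \<open>simp_all add: flat_exp_def\<close>)
next
  case greater
  have "((\<lambda>t. exp (- inverse t) * inverse t ^ j) has_real_derivative
      exp (- inverse t) * (inverse t * inverse t) * inverse t ^ j
      + real j * inverse t ^ (j - 1) * (- (inverse t * inverse t)) * exp (- inverse t)) (at t)"
    using greater by (auto intro!: derivative_eq_intros)
  moreover have "exp (- inverse t) * (inverse t * inverse t) * inverse t ^ j
      + real j * inverse t ^ (j - 1) * (- (inverse t * inverse t)) * exp (- inverse t)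
      = flat_exp (j + 2) t - real j * flat_exp (j + 1) t"
    using greater by (cases j) (simp_all add: flat_exp_def mult_ac)
  ultimately have "((\<lambda>t. exp (- inverse t) * inverse t ^ j) has_real_derivative
      (flat_exp (j + 2) t - real j * flat_exp (j + 1) t)) (at t)"
    by (simp only:)
  then show ?thesis
    by (rule has_field_derivative_transform_within_open[where S = "{0<..}"]) (use greater in \<open>simp_all add: flat_exp_def\<close>)
next
  case equal
  have "((\<lambda>h. flat_exp j h / h) \<longlongrightarrow> 0) (at 0)"
  proof (rule Lim_transform_eventually[OF flat_exp_tendsto_0[of "Suc j"]])
    show "\<forall>\<^sub>F x in at 0. flat_exp (Suc j) x = flat_exp j x / x"
      by (auto simp: flat_exp_def divide_inverse intro!: always_eventually)
  qed
  then show ?thesis using equal by (simp add: DERIV_def flat_exp_def)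
qed

lemma Ck_flat_exp: "Ck k (flat_exp j)"
proof (induction k arbitrary: j)
  case 0
  then show ?case using DERIV_isCont[OF flat_exp_deriv] by (simp add: continuous_at_imp_continuous_on)
next
  case (Suc k)
  have D: "(flat_exp j has_derivative (\<lambda>h. (flat_exp (j + 2) t + (- real j) * flat_exp (j + 1) t) * h)) (at t)" for t
    using flat_exp_deriv[of j t] by (simp add: has_field_derivative_def)
  show ?case
    by (rule Ck_SucI[OF D]) (intro Ck_add Ck_mult Ck_const Suc.IH)
qed

section \<open>Test functions\<close>

text \<open>It suffices to exhibit a compact set off which the function vanishes, instead of handling the
  closure of the support.\<close>

lemma test_functionsI:
  assumes "smooth \<phi>" "compact K" "K \<subseteq> \<omega>" "\<And>x. x \<notin> K \<Longrightarrow> \<phi> x = 0"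
  shows "\<phi> \<in> test_functions \<omega>"
proof -
  have "closure {x. \<phi> x \<noteq> 0} \<subseteq> K"
    using assms(2,4) by (intro closure_minimal) (auto intro: compact_imp_closed)
  with assms show ?thesis
    unfolding test_functions_def using compact_closure closed_closure compact_Int_closed[of K "closure {x. \<phi> x \<noteq> 0}"]
    by (auto simp: Int_absorb1)
qed

lemma test_functionsD:
  assumes "\<phi> \<in> test_functions \<omega>"
  shows "smooth \<phi>" "Ck k \<phi>" "\<exists>K. compact K \<and> K \<subseteq> \<omega> \<and> (\<forall>x. x \<notin> K \<longrightarrow> \<phi> x = 0)"
  using assms closure_subset[of "{x. \<phi> x \<noteq> 0}"] unfolding test_functions_def smooth_def
  by (auto intro!: exI[of _ "closure {x. \<phi> x \<noteq> 0}"])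

lemma test_function_has_derivative:
  "\<phi> \<in> test_functions \<omega> \<Longrightarrow> (\<phi> has_derivative (\<lambda>h. dir_deriv h \<phi> x)) (at x)"
  using test_functionsD(2)[of \<phi> \<omega> "Suc 0"] Ck_Suc_has_derivative by blast

lemma test_function_continuous: "\<phi> \<in> test_functions \<omega> \<Longrightarrow> continuous_on UNIV \<phi>"
  using test_functionsD(2)[of \<phi> \<omega> 0] by simp

lemma test_function_outside: "\<phi> \<in> test_functions \<omega> \<Longrightarrow> x \<notin> \<omega> \<Longrightarrow> \<phi> x = 0"
  using test_functionsD(3)[of \<phi> \<omega>] by blast

lemma test_functions_dir_deriv:
  assumes \<phi>: "\<phi> \<in> test_functions \<omega>" and b: "b \<in> Basis"
  shows "dir_deriv b \<phi> \<in> test_functions \<omega>"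
proof -
  obtain K where K: "compact K" "K \<subseteq> \<omega>" "\<And>x. x \<notin> K \<Longrightarrow> \<phi> x = 0"
    using test_functionsD(3)[OF \<phi>] by blast
  have "dir_deriv b \<phi> x = 0" if "x \<notin> K" for x
  proof -
    have "(\<phi> has_derivative (\<lambda>_. 0)) (at x)"
      by (rule has_derivative_transform_within_open[of "\<lambda>_. 0" _ _ UNIV "- K"])
        (use K that compact_imp_closed[of K] in auto)
    then show ?thesis by (rule dir_deriv_eqI)
  qed
  moreover have "smooth (dir_deriv b \<phi>)"
    using test_functionsD(2)[OF \<phi>] Ck_dir_deriv[OF _ b] unfolding smooth_def by blast
  ultimately show ?thesis using K by (intro test_functionsI[of _ K]) auto
qed

lemma test_functions_lincomb:
  assumes "\<phi> \<in> test_functions \<omega>" "\<psi> \<in> test_functions \<omega>"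
  shows "(\<lambda>x. \<phi> x + c * \<psi> x) \<in> test_functions \<omega>"
proof -
  obtain K where K: "compact K" "K \<subseteq> \<omega>" "\<And>x. x \<notin> K \<Longrightarrow> \<phi> x = 0"
    using test_functionsD(3)[OF assms(1)] by blast
  obtain L where L: "compact L" "L \<subseteq> \<omega>" "\<And>x. x \<notin> L \<Longrightarrow> \<psi> x = 0"
    using test_functionsD(3)[OF assms(2)] by blast
  show ?thesis
    using K L assms[THEN test_functionsD(2)]
    by (intro test_functionsI[of _ "K \<union> L"]) (auto simp: smooth_def compact_Un intro!: Ck_add Ck_mult Ck_const)
qed

lemma test_functions_mult:
  assumes "\<phi> \<in> test_functions \<omega>" "\<psi> \<in> test_functions \<omega>"
  shows "(\<lambda>x. \<phi> x * \<psi> x) \<in> test_functions \<omega>"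
proof -
  obtain K where K: "compact K" "K \<subseteq> \<omega>" "\<And>x. x \<notin> K \<Longrightarrow> \<phi> x = 0"
    using test_functionsD(3)[OF assms(1)] by blast
  show ?thesis
    using K assms[THEN test_functionsD(2)]
    by (intro test_functionsI[of _ K]) (auto simp: smooth_def intro!: Ck_mult)
qed

lemma test_functions_cnj:
  assumes "\<phi> \<in> test_functions \<omega>"
  shows "(\<lambda>x. cnj (\<phi> x)) \<in> test_functions \<omega>"
proof -
  obtain K where K: "compact K" "K \<subseteq> \<omega>" "\<And>x. x \<notin> K \<Longrightarrow> \<phi> x = 0"
    using test_functionsD(3)[OF assms(1)] by blast
  show ?thesis
    using K test_functionsD(2)[OF assms]
    by (intro test_functionsI[of _ K]) (auto simp: smooth_def intro!: Ck_bounded_linear[OF bounded_linear_cnj])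
qed

lemma dir_deriv_lincomb:
  assumes "\<phi> \<in> test_functions \<omega>" "\<psi> \<in> test_functions \<omega>"
  shows "dir_deriv b (\<lambda>x. \<phi> x + c * \<psi> x) x = dir_deriv b \<phi> x + c * dir_deriv b \<psi> x"
  by (intro dir_deriv_eqI has_derivative_add has_derivative_mult_right
      assms[THEN test_function_has_derivative])

lemma dir_deriv_mult:
  assumes "\<phi> \<in> test_functions \<omega>" "\<psi> \<in> test_functions \<omega>"
  shows "dir_deriv b (\<lambda>x. \<phi> x * \<psi> x) x = \<phi> x * dir_deriv b \<psi> x + dir_deriv b \<phi> x * \<psi> x"
  by (intro dir_deriv_eqI has_derivative_mult assms[THEN test_function_has_derivative])

lemma dir_deriv_cnj:
  assumes "\<phi> \<in> test_functions \<omega>"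
  shows "dir_deriv b (\<lambda>x. cnj (\<phi> x)) x = cnj (dir_deriv b \<phi> x)"
  by (intro dir_deriv_eqI bounded_linear.has_derivative[OF bounded_linear_cnj]
      test_function_has_derivative[OF assms])

text \<open>A smooth substitute for the modulus. Subtracting \<open>\<delta>\<close> makes it vanish at \<open>0\<close>, so that composing
  it with a test function preserves the support.\<close>

definition soft_abs :: "real \<Rightarrow> complex \<Rightarrow> real" where
  "soft_abs \<delta> z = sqrt ((norm z)\<^sup>2 + \<delta>\<^sup>2) - \<delta>"

lemma soft_abs_test_function:
  assumes \<phi>: "\<phi> \<in> test_functions \<omega>" and \<delta>: "\<delta> > 0"
  shows "(\<lambda>x. complex_of_real (soft_abs \<delta> (\<phi> x))) \<in> test_functions \<omega>"
    and "dir_deriv b (\<lambda>x. complex_of_real (soft_abs \<delta> (\<phi> x))) x =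
      complex_of_real (Re (cnj (\<phi> x) * dir_deriv b \<phi> x) / sqrt ((norm (\<phi> x))\<^sup>2 + \<delta>\<^sup>2))"
proof -
  obtain K where K: "compact K" "K \<subseteq> \<omega>" "\<And>x. x \<notin> K \<Longrightarrow> \<phi> x = 0"
    using test_functionsD(3)[OF \<phi>] by blast
  define s where "s x = \<phi> x \<bullet> \<phi> x + \<delta>\<^sup>2" for x
  have s: "s x > 0" for x using \<delta> by (simp add: s_def add_nonneg_pos)
  \<comment> \<open>A real power with positive base, so that closure of C^k under powers applies.\<close>
  have eq: "(\<lambda>x. complex_of_real (soft_abs \<delta> (\<phi> x))) = (\<lambda>x. complex_of_real (s x powr (1/2)) + - complex_of_real \<delta>)"
    using s by (simp add: soft_abs_def powr_half_sqrt less_imp_le) (simp add: s_def power2_norm_eq_inner)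
  have "Ck k (\<lambda>x. complex_of_real (s x powr (1/2)) + - complex_of_real \<delta>)" for k
    by (intro Ck_add Ck_const Ck_bounded_linear[OF bounded_linear_of_real] Ck_powr s)
      (unfold s_def, intro Ck_add Ck_const Ck_bilinear[OF bounded_bilinear_inner] test_functionsD(2)[OF \<phi>])
  then have "smooth (\<lambda>x. complex_of_real (soft_abs \<delta> (\<phi> x)))"
    unfolding eq smooth_def by blast
  moreover have "soft_abs \<delta> 0 = 0" using \<delta> by (simp add: soft_abs_def)
  ultimately show "(\<lambda>x. complex_of_real (soft_abs \<delta> (\<phi> x))) \<in> test_functions \<omega>"
    using K by (intro test_functionsI[of _ K]) auto
  have d: "((\<lambda>x. (\<phi> x \<bullet> \<phi> x + \<delta>\<^sup>2)) has_derivative (\<lambda>h. 2 * (\<phi> x \<bullet> dir_deriv h \<phi> x))) (at x)"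
  proof -
    note has_derivative_add[OF has_derivative_inner[OF test_function_has_derivative[OF \<phi>] test_function_has_derivative[OF \<phi>]]
        has_derivative_const[of "\<delta>\<^sup>2"]]
    then show ?thesis by (simp add: inner_commute)
  qed
  have "((\<lambda>x. complex_of_real (sqrt (\<phi> x \<bullet> \<phi> x + \<delta>\<^sup>2) - \<delta>)) has_derivative
    (\<lambda>h. complex_of_real ((\<phi> x \<bullet> dir_deriv h \<phi> x) / sqrt (\<phi> x \<bullet> \<phi> x + \<delta>\<^sup>2)))) (at x)"
    using s[of x] unfolding s_def
    by (intro has_derivative_of_real has_derivative_eq_rhs[OF has_derivative_diff[OF has_derivative_real_sqrt[OF _ d] has_derivative_const]])
      (auto simp: field_simps)
  from dir_deriv_eqI[OF this, of b]
  show "dir_deriv b (\<lambda>x. complex_of_real (soft_abs \<delta> (\<phi> x))) x =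
      complex_of_real (Re (cnj (\<phi> x) * dir_deriv b \<phi> x) / sqrt ((norm (\<phi> x))\<^sup>2 + \<delta>\<^sup>2))"
    by (simp add: soft_abs_def power2_norm_eq_inner) (simp add: inner_complex_def)
qed

section \<open>Integration by parts and smooth bumps\<close>

lemma integrable_continuous_lebesgue_on:
  fixes f :: "'a::euclidean_space \<Rightarrow> 'b::euclidean_space"
  assumes "continuous_on UNIV f" "bounded \<omega>" "open \<omega>"
  shows "integrable (lebesgue_on \<omega>) f"
proof -
  obtain a b where ab: "\<omega> \<subseteq> cbox a b" using bounded_subset_cbox_symmetric[OF assms(2)] by blast
  have "f absolutely_integrable_on cbox a b"
    using assms(1) by (intro absolutely_integrable_continuous) (rule continuous_on_subset, auto)
  then have "f absolutely_integrable_on \<omega>"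
    by (rule set_integrable_subset) (use ab assms(3) in auto)
  then show ?thesis using assms(3) by (simp add: integrable_restrict_space set_integrable_def borel_open)
qed

text \<open>Passage to gauge integrals over a box, where Fubini and the fundamental theorem of calculus
  for continuous integrands are at hand.\<close>

lemma integral_lebesgue_on_eq_cbox:
  fixes f :: "'a::euclidean_space \<Rightarrow> 'b::euclidean_space"
  assumes "continuous_on UNIV f" "open \<omega>" "\<omega> \<subseteq> cbox a b" "\<And>x. x \<notin> \<omega> \<Longrightarrow> f x = 0"
  shows "integral\<^sup>L (lebesgue_on \<omega>) f = integral (cbox a b) f"
proof -
  have "bounded \<omega>" using assms(3) bounded_cbox bounded_subset by blast
  then have "integral\<^sup>L (lebesgue_on \<omega>) f = integral \<omega> f"
    using integrable_continuous_lebesgue_on[OF assms(1)] assms(2) by (intro lebesgue_integral_eq_integral) auto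
  also have "\<dots> = integral (cbox a b) (\<lambda>x. if x \<in> \<omega> then f x else 0)"
    unfolding integral_def integrable_on_def has_integral_restrict[OF assms(3)] ..
  also have "(\<lambda>x. if x \<in> \<omega> then f x else 0) = f" using assms(4) by auto
  finally show ?thesis .
qed

lemma Basis_plane: "(Basis :: (real \<times> real) set) = {(1, 0), (0, 1)}"
  by (auto simp: Basis_prod_def)

lemma mem_box_plane: "(x, y) \<in> box (a, b) (c, d) \<longleftrightarrow> a < x \<and> x < c \<and> b < y \<and> y < (d::real)"
  for a b c d x y :: real
  by (auto simp: mem_box Basis_plane)

lemma Ck1_partial_derivatives:
  fixes f :: "real \<times> real \<Rightarrow> 'b::real_normed_vector"
  assumes "Ck (Suc 0) f"
  shows "((\<lambda>s. f (s, y)) has_vector_derivative dir_deriv (1, 0) f (x, y)) (at x within S)"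
    and "((\<lambda>t. f (x, t)) has_vector_derivative dir_deriv (0, 1) f (x, y)) (at y within S)"
    and "continuous_on UNIV (dir_deriv (1, 0) f)" "continuous_on UNIV (dir_deriv (0, 1) f)"
proof -
  have D: "(f has_derivative (\<lambda>h. dir_deriv h f (x, y))) (at (x, y))" by (rule Ck_Suc_has_derivative[OF assms])
  note scaleR = linear_scale[OF has_derivative_linear[OF D]]
  have 1: "((\<lambda>s. f (s, y)) has_derivative (\<lambda>h. dir_deriv (h, 0) f (x, y))) (at x within S)"
    by (rule has_derivative_compose[of "\<lambda>s. (s, y)", OF _ D]) (auto intro!: derivative_eq_intros)
  have 3: "dir_deriv (h, 0) f (x, y) = h *\<^sub>R dir_deriv (1, 0) f (x, y)" for h
    using scaleR[of h "(1, 0)"] by simp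
  show "((\<lambda>s. f (s, y)) has_vector_derivative dir_deriv (1, 0) f (x, y)) (at x within S)"
    unfolding has_vector_derivative_def by (rule has_derivative_eq_rhs[OF 1]) (rule ext, rule 3)
  have 2: "((\<lambda>t. f (x, t)) has_derivative (\<lambda>h. dir_deriv (0, h) f (x, y))) (at y within S)"
    by (rule has_derivative_compose[of "\<lambda>t. (x, t)", OF _ D]) (auto intro!: derivative_eq_intros)
  have 4: "dir_deriv (0, h) f (x, y) = h *\<^sub>R dir_deriv (0, 1) f (x, y)" for h
    using scaleR[of h "(0, 1)"] by simp
  show "((\<lambda>t. f (x, t)) has_vector_derivative dir_deriv (0, 1) f (x, y)) (at y within S)"
    unfolding has_vector_derivative_def by (rule has_derivative_eq_rhs[OF 2]) (rule ext, rule 4)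
  show "continuous_on UNIV (dir_deriv (1, 0) f)" "continuous_on UNIV (dir_deriv (0, 1) f)"
    using assms by (simp_all add: Basis_plane)
qed

lemma integral_plane_iterated:
  fixes f :: "real \<times> real \<Rightarrow> 'b::euclidean_space"
  assumes "continuous_on UNIV f"
  shows "integral (cbox (a, c) (b, d)) f = integral (cbox a b) (\<lambda>x. integral (cbox c d) (\<lambda>y. f (x, y)))"
    and "integral (cbox (a, c) (b, d)) f = integral (cbox c d) (\<lambda>y. integral (cbox a b) (\<lambda>x. f (x, y)))"
proof -
  have c: "continuous_on (cbox (a, c) (b, d)) f" using assms continuous_on_subset by blast
  show 1: "integral (cbox (a, c) (b, d)) f = integral (cbox a b) (\<lambda>x. integral (cbox c d) (\<lambda>y. f (x, y)))"
    by (rule integral_prod_continuous[OF c])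
  then show "integral (cbox (a, c) (b, d)) f = integral (cbox c d) (\<lambda>y. integral (cbox a b) (\<lambda>x. f (x, y)))"
    using integral_swap_continuous[of a c b d "\<lambda>x y. f (x, y)"] c by simp
qed

text \<open>Integrate first in the direction of differentiation: by the fundamental theorem of calculus
  the inner integral is a difference of boundary values, which vanish.\<close>

lemma integral_dir_deriv_test_function:
  fixes \<omega> :: "(real \<times> real) set"
  assumes \<phi>: "\<phi> \<in> test_functions \<omega>" and \<omega>: "open \<omega>" "bounded \<omega>" and b: "b \<in> Basis"
  shows "integral\<^sup>L (lebesgue_on \<omega>) (dir_deriv b \<phi>) = 0"
proof -
  obtain e :: "real \<times> real" where e: "\<omega> \<subseteq> box (- e) e"
    using bounded_subset_box_symmetric[OF \<omega>(2)] by blast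
  obtain r s where rs: "e = (r, s)" by force
  have C: "Ck (Suc 0) \<phi>" by (rule test_functionsD(2)[OF \<phi>])
  note D = Ck1_partial_derivatives[OF C]
  have out: "\<phi> (x, y) = 0" if "\<bar>x\<bar> \<ge> r \<or> \<bar>y\<bar> \<ge> s" for x y
    using test_function_outside[OF \<phi>, of "(x, y)"] e that rs by (fastforce simp: mem_box_plane)
  have eq: "integral\<^sup>L (lebesgue_on \<omega>) (dir_deriv b \<phi>) = integral (cbox (-r, -s) (r, s)) (dir_deriv b \<phi>)"
  proof (rule integral_lebesgue_on_eq_cbox)
    show "continuous_on UNIV (dir_deriv b \<phi>)"
      using test_functions_dir_deriv[OF \<phi> b] test_function_continuous by blast
    show "\<omega> \<subseteq> cbox (- r, - s) (r, s)" using e box_subset_cbox[of "-e" e] by (auto simp: rs)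
    show "dir_deriv b \<phi> x = 0" if "x \<notin> \<omega>" for x
      using test_functions_dir_deriv[OF \<phi> b] test_function_outside that by blast
  qed (rule \<omega>)
  have Z1: "integral (cbox (-r) r) (\<lambda>x. dir_deriv (1, 0) \<phi> (x, y)) = 0" for y
  proof (cases "0 \<le> r")
    case True
    have "((\<lambda>x. dir_deriv (1, 0) \<phi> (x, y)) has_integral (\<phi> (r, y) - \<phi> (-r, y))) {-r..r}"
      by (rule fundamental_theorem_of_calculus[OF _ D(1)]) (use True in auto)
    then show ?thesis using True out[of r y] out[of "-r" y] by (simp add: integral_unique)
  qed auto
  have Z2: "integral (cbox (-s) s) (\<lambda>y. dir_deriv (0, 1) \<phi> (x, y)) = 0" for x
  proof (cases "0 \<le> s")
    case True
    have "((\<lambda>y. dir_deriv (0, 1) \<phi> (x, y)) has_integral (\<phi> (x, s) - \<phi> (x, -s))) {-s..s}"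
      by (rule fundamental_theorem_of_calculus[OF _ D(2)]) (use True in auto)
    then show ?thesis using True out[of x s] out[of x "-s"] by (simp add: integral_unique)
  qed auto
  from b consider "b = (1, 0)" | "b = (0, 1)" by (auto simp: Basis_plane)
  then show ?thesis
  proof cases
    case 1
    then show ?thesis unfolding eq using integral_plane_iterated(2)[OF D(3), of "-r" "-s" r s] Z1 by simp
  next
    case 2
    then show ?thesis unfolding eq using integral_plane_iterated(1)[OF D(4), of "-r" "-s" r s] Z2 by simp
  qed
qed

lemma test_function_integrable:
  "\<phi> \<in> test_functions \<omega> \<Longrightarrow> open \<omega> \<Longrightarrow> bounded \<omega> \<Longrightarrow> integrable (lebesgue_on \<omega>) \<phi>"
  by (rule integrable_continuous_lebesgue_on[OF test_function_continuous])

lemma integration_by_parts_test_functions: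
  fixes \<omega> :: "(real \<times> real) set"
  assumes \<phi>: "\<phi> \<in> test_functions \<omega>" and \<psi>: "\<psi> \<in> test_functions \<omega>"
    and \<omega>: "open \<omega>" "bounded \<omega>" and b: "b \<in> Basis"
  shows "(\<integral>x. \<phi> x * dir_deriv b \<psi> x \<partial>lebesgue_on \<omega>) = - (\<integral>x. dir_deriv b \<phi> x * \<psi> x \<partial>lebesgue_on \<omega>)"
proof -
  have "0 = (\<integral>x. \<phi> x * dir_deriv b \<psi> x + dir_deriv b \<phi> x * \<psi> x \<partial>lebesgue_on \<omega>)"
    using integral_dir_deriv_test_function[OF test_functions_mult[OF \<phi> \<psi>] \<omega> b]
    by (simp add: dir_deriv_mult[OF \<phi> \<psi>, symmetric])
  also have "\<dots> = (\<integral>x. \<phi> x * dir_deriv b \<psi> x \<partial>lebesgue_on \<omega>) + (\<integral>x. dir_deriv b \<phi> x * \<psi> x \<partial>lebesgue_on \<omega>)"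
    by (intro Bochner_Integration.integral_add test_function_integrable[OF _ \<omega>]
        test_functions_mult \<phi> \<psi> test_functions_dir_deriv b)
  finally show ?thesis by (simp add: eq_neg_iff_add_eq_0)
qed

text \<open>Smooth, supported in \<open>cbox a b\<close>, and increasingly steep at its boundary as \<open>n\<close> grows:
  pointwise these bumps tend to the indicator of the open box.\<close>

definition box_bump :: "nat \<Rightarrow> real \<times> real \<Rightarrow> real \<times> real \<Rightarrow> real \<times> real \<Rightarrow> real" where
  "box_bump n a b x =
     flat_exp 0 (real (Suc n) * (fst x - fst a)) * flat_exp 0 (real (Suc n) * (fst b - fst x)) *
     (flat_exp 0 (real (Suc n) * (snd x - snd a)) * flat_exp 0 (real (Suc n) * (snd b - snd x)))"

lemma box_bump_test_function:
  assumes "cbox a b \<subseteq> \<omega>"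
  shows "(\<lambda>x. complex_of_real (box_bump n a b x)) \<in> test_functions \<omega>"
proof (rule test_functionsI)
  have "Ck k (\<lambda>x::real \<times> real. flat_exp 0 (real (Suc n) * (fst x - c)))"
       "Ck k (\<lambda>x::real \<times> real. flat_exp 0 (real (Suc n) * (c - fst x)))"
       "Ck k (\<lambda>x::real \<times> real. flat_exp 0 (real (Suc n) * (snd x - c)))"
       "Ck k (\<lambda>x::real \<times> real. flat_exp 0 (real (Suc n) * (c - snd x)))" for k c
  proof -
    have i: "Ck k (\<lambda>x::real \<times> real. x)" for k
    proof (cases k)
      case (Suc j)
      show ?thesis unfolding Suc by (rule Ck_SucI[where D = "\<lambda>_ h. h"]) (auto intro: Ck_const)
    qed simp
    have f: "Ck k (\<lambda>x::real \<times> real. fst x)" and s: "Ck k (\<lambda>x::real \<times> real. snd x)"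
      by (intro Ck_bounded_linear[OF _ i] bounded_linear_fst bounded_linear_snd)+
    have e: "c - fst x = c + (-1) * fst x" "c - snd x = c + (-1) * snd x" 
      "fst x - c = fst x + - c"  "snd x - c = snd x + - c" for x :: "real \<times> real"
      by auto
    show "Ck k (\<lambda>x::real \<times> real. flat_exp 0 (real (Suc n) * (fst x - c)))"
       "Ck k (\<lambda>x::real \<times> real. flat_exp 0 (real (Suc n) * (c - fst x)))"
       "Ck k (\<lambda>x::real \<times> real. flat_exp 0 (real (Suc n) * (snd x - c)))"
       "Ck k (\<lambda>x::real \<times> real. flat_exp 0 (real (Suc n) * (c - snd x)))"
      unfolding e by (rule Ck_compose_real[OF Ck_flat_exp], intro Ck_mult Ck_add Ck_const f s)+
  qed
  then show "smooth (\<lambda>x. complex_of_real (box_bump n a b x))"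
    unfolding smooth_def box_bump_def
    by (intro allI Ck_bounded_linear[OF bounded_linear_of_real] Ck_mult)
  show "complex_of_real (box_bump n a b x) = 0" if "x \<notin> cbox a b" for x
  proof -
    have "fst x < fst a \<or> fst b < fst x \<or> snd x < snd a \<or> snd b < snd x"
      using that by (cases x; cases a; cases b) (auto simp: cbox_Pair_eq)
    then show ?thesis by (auto simp: box_bump_def flat_exp_def zero_less_mult_iff)
  qed
qed (use assms in auto)

lemma box_bump_bounds: "0 \<le> box_bump n a b x" "box_bump n a b x \<le> 1"
proof -
  have "0 \<le> flat_exp 0 t" "flat_exp 0 t \<le> 1" for t by (auto simp: flat_exp_def)
  then show "0 \<le> box_bump n a b x" "box_bump n a b x \<le> 1"
    unfolding box_bump_def by (auto intro!: mult_nonneg_nonneg mult_le_one)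
qed

lemma box_bump_tendsto: "(\<lambda>n. box_bump n a b x) \<longlonglongrightarrow> indicator (box a b) x"
proof -
  have fl: "(\<lambda>n. flat_exp 0 (real (Suc n) * t)) \<longlonglongrightarrow> (if t > 0 then 1 else 0)" for t
  proof (cases "t > 0")
    case True
    have "(\<lambda>n. (- 1 / t) * inverse (real (Suc n))) \<longlonglongrightarrow> (- 1 / t) * 0"
      by (intro tendsto_mult LIMSEQ_inverse_real_of_nat tendsto_const)
    then have "(\<lambda>n. exp ((- 1 / t) * inverse (real (Suc n)))) \<longlonglongrightarrow> exp 0"
      by (intro tendsto_exp) simp
    moreover have "exp ((- 1 / t) * inverse (real (Suc n))) = flat_exp 0 (real (Suc n) * t)" for n
      using True by (simp add: flat_exp_def zero_less_mult_iff divide_simps)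
    ultimately show ?thesis using True by simp
  next
    case False
    then have "flat_exp 0 (real (Suc n) * t) = 0" for n
      by (auto simp: flat_exp_def zero_less_mult_iff)
    then show ?thesis using False by simp
  qed
  have "indicator (box a b) x =
    (if fst x - fst a > 0 then 1 else 0) * (if fst b - fst x > 0 then 1 else 0) *
    ((if snd x - snd a > 0 then 1 else 0) * (if snd b - snd x > 0 then 1 else (0::real)))"
    by (cases x; cases a; cases b) (auto simp: mem_box_plane indicator_def)
  then show ?thesis unfolding box_bump_def by (simp only:) (intro tendsto_mult fl)
qed

section \<open>Square-integrable functions\<close>

definition L2_sq :: "'a measure \<Rightarrow> ('a \<Rightarrow> complex) \<Rightarrow> real" where
  "L2_sq M f = (\<integral>x. (norm (f x))\<^sup>2 \<partial>M)"

lemma L2D: "f \<in> L2 M \<Longrightarrow> f \<in> borel_measurable M" "f \<in> L2 M \<Longrightarrow> integrable M (\<lambda>x. (norm (f x))\<^sup>2)"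
  by (auto simp: L2_def)

lemma L2_sq_nonneg: "0 \<le> L2_sq M f"
  by (simp add: L2_sq_def)

lemma L2_sq_cong_AE:
  assumes "f \<in> L2 M" "g \<in> L2 M" "AE x in M. f x = g x"
  shows "L2_sq M f = L2_sq M g"
proof -
  note [measurable] = assms(1,2)[THEN L2D(1)]
  show ?thesis unfolding L2_sq_def by (rule integral_cong_AE) (use assms(3) in auto)
qed

lemma L2_bound:
  assumes "f \<in> borel_measurable M" "integrable M g" "\<And>x. x \<in> space M \<Longrightarrow> (norm (f x))\<^sup>2 \<le> g x"
  shows "f \<in> L2 M" "L2_sq M f \<le> integral\<^sup>L M g"
proof -
  note [measurable] = assms(1)
  show "f \<in> L2 M" unfolding L2_def
    using assms by (auto intro!: Bochner_Integration.integrable_bound[OF assms(2)] AE_I2 order_trans[OF _ abs_ge_self])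
  then show "L2_sq M f \<le> integral\<^sup>L M g"
    unfolding L2_sq_def using assms by (intro integral_mono L2D)
qed

lemma norm_add_sq_le: "(norm (a + b :: 'a::real_normed_vector))\<^sup>2 \<le> 2 * (norm a)\<^sup>2 + 2 * (norm b)\<^sup>2"
proof -
  have "(norm (a + b))\<^sup>2 \<le> (norm a + norm b)\<^sup>2" by (intro power_mono norm_triangle_ineq) simp
  also have "\<dots> \<le> 2 * (norm a)\<^sup>2 + 2 * (norm b)\<^sup>2"
    using sum_squares_bound[of "norm a" "norm b"] by (simp add: power2_sum)
  finally show ?thesis .
qed

lemma L2_add:
  assumes "f \<in> L2 M" "g \<in> L2 M"
  shows "(\<lambda>x. f x + g x) \<in> L2 M" "L2_sq M (\<lambda>x. f x + g x) \<le> 2 * L2_sq M f + 2 * L2_sq M g"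
proof -
  note [measurable] = assms[THEN L2D(1)]
  have *: "integrable M (\<lambda>x. 2 * (norm (f x))\<^sup>2 + 2 * (norm (g x))\<^sup>2)"
    using assms L2D by (intro Bochner_Integration.integrable_add integrable_mult_right) auto
  have m: "(\<lambda>x. f x + g x) \<in> borel_measurable M" by measurable
  show "(\<lambda>x. f x + g x) \<in> L2 M" by (rule L2_bound(1)[OF m *]) (rule norm_add_sq_le)
  have "L2_sq M (\<lambda>x. f x + g x) \<le> (\<integral>x. 2 * (norm (f x))\<^sup>2 + 2 * (norm (g x))\<^sup>2 \<partial>M)"
    by (rule L2_bound(2)[OF m *]) (rule norm_add_sq_le)
  also have "\<dots> = 2 * L2_sq M f + 2 * L2_sq M g"
    using assms[THEN L2D(2)] by (simp add: L2_sq_def)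
  finally show "L2_sq M (\<lambda>x. f x + g x) \<le> 2 * L2_sq M f + 2 * L2_sq M g" .
qed

lemma L2_bounded_mult:
  assumes "f \<in> L2 M" "w \<in> borel_measurable M" "\<And>x. x \<in> space M \<Longrightarrow> norm (w x) \<le> K"
  shows "(\<lambda>x. w x * f x) \<in> L2 M" "L2_sq M (\<lambda>x. w x * f x) \<le> K\<^sup>2 * L2_sq M f"
proof -
  note [measurable] = assms(2) L2D(1)[OF assms(1)]
  have *: "integrable M (\<lambda>x. K\<^sup>2 * (norm (f x))\<^sup>2)" using L2D(2)[OF assms(1)] by simp
  have m: "(\<lambda>x. w x * f x) \<in> borel_measurable M" by measurable
  have le: "(norm (w x * f x))\<^sup>2 \<le> K\<^sup>2 * (norm (f x))\<^sup>2" if "x \<in> space M" for x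
    using assms(3)[OF that] by (simp add: norm_mult power_mult_distrib mult_right_mono power_mono)
  show "(\<lambda>x. w x * f x) \<in> L2 M" by (rule L2_bound(1)[OF m *]) (rule le)
  have "L2_sq M (\<lambda>x. w x * f x) \<le> (\<integral>x. K\<^sup>2 * (norm (f x))\<^sup>2 \<partial>M)"
    by (rule L2_bound(2)[OF m *]) (rule le)
  then show "L2_sq M (\<lambda>x. w x * f x) \<le> K\<^sup>2 * L2_sq M f" by (simp add: L2_sq_def)
qed

lemma L2_cmult: "f \<in> L2 M \<Longrightarrow> (\<lambda>x. c * f x) \<in> L2 M"
  by (rule L2_bounded_mult[of _ _ _ "norm c"]) auto

lemma L2_lincomb: "f \<in> L2 M \<Longrightarrow> g \<in> L2 M \<Longrightarrow> (\<lambda>x. f x + c * g x) \<in> L2 M"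
  by (intro L2_add L2_cmult)

lemma L2_diff: "f \<in> L2 M \<Longrightarrow> g \<in> L2 M \<Longrightarrow> (\<lambda>x. f x - g x) \<in> L2 M"
  using L2_lincomb[of f M g "-1"] by simp

lemma L2_cnj: "f \<in> L2 M \<Longrightarrow> (\<lambda>x. cnj (f x)) \<in> L2 M"
  unfolding L2_def
  using measurable_compose[of f M borel cnj borel] borel_measurable_continuous_onI[OF continuous_on_cnj[OF continuous_on_id]]
  by simp

lemma L2_sq_minus_commute: "L2_sq M (\<lambda>x. f x - g x) = L2_sq M (\<lambda>x. g x - f x)"
  by (simp add: L2_sq_def norm_minus_commute)

lemma L2_mult_integrable:
  assumes "f \<in> L2 M" "g \<in> L2 M"
  shows "integrable M (\<lambda>x. f x * g x)"
proof -
  note [measurable] = assms[THEN L2D(1)]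
  have "integrable M (\<lambda>x. (norm (f x))\<^sup>2 + (norm (g x))\<^sup>2)"
    using assms L2D by (intro Bochner_Integration.integrable_add) auto
  then show ?thesis
  proof (rule Bochner_Integration.integrable_bound)
  have "norm (a * b) \<le> (norm a)\<^sup>2 + (norm b)\<^sup>2" for a b :: complex
  proof -
    have "2 * norm a * norm b \<le> (norm a)\<^sup>2 + (norm b)\<^sup>2" by (rule sum_squares_bound)
    moreover have "0 \<le> norm a * norm b" by simp
    ultimately show ?thesis unfolding norm_mult by linarith
  qed
    then show "AE x in M. norm (f x * g x) \<le> norm ((norm (f x))\<^sup>2 + (norm (g x))\<^sup>2)"
      by (intro AE_I2) (simp only: real_norm_def order_trans[OF _ abs_ge_self])
  qed measurable
qed

lemma norm_sq_lincomb:
  "(norm (a + c * b :: complex))\<^sup>2 = (norm a)\<^sup>2 + 2 * Re (cnj c * (a * cnj b)) + (norm c)\<^sup>2 * (norm b)\<^sup>2"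
  unfolding cmod_power2 by (simp add: algebra_simps power2_eq_square)

text \<open>All Hilbert-space arguments below (Cauchy--Schwarz, the parallelogram law, polarization, the
  variational equation) are consequences of this expansion for complex \<open>c\<close>.\<close>

lemma L2_sq_lincomb:
  assumes "f \<in> L2 M" "g \<in> L2 M"
  shows "L2_sq M (\<lambda>x. f x + c * g x) =
    L2_sq M f + 2 * Re (cnj c * L2_inner M f g) + (norm c)\<^sup>2 * L2_sq M g"
proof -
  have i: "integrable M (\<lambda>x. cnj c * (f x * cnj (g x)))"
    by (intro integrable_mult_right L2_mult_integrable assms L2_cnj)
  define R where "R x = Re (cnj c * (f x * cnj (g x)))" for x
  have R: "integrable M R" unfolding R_def using integrable_Re[OF i] .
  have "L2_sq M (\<lambda>x. f x + c * g x) =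
      (\<integral>x. (norm (f x))\<^sup>2 + 2 * R x + (norm c)\<^sup>2 * (norm (g x))\<^sup>2 \<partial>M)"
    unfolding L2_sq_def norm_sq_lincomb R_def ..
  also have "\<dots> = (\<integral>x. (norm (f x))\<^sup>2 \<partial>M) + 2 * integral\<^sup>L M R
      + (norm c)\<^sup>2 * (\<integral>x. (norm (g x))\<^sup>2 \<partial>M)"
    using R assms[THEN L2D(2)] by simp
  also have "integral\<^sup>L M R = Re (\<integral>x. cnj c * (f x * cnj (g x)) \<partial>M)"
    unfolding R_def by (rule integral_Re[OF i])
  also have "(\<integral>x. cnj c * (f x * cnj (g x)) \<partial>M) = cnj c * L2_inner M f g"
    by (simp add: L2_inner_def)
  finally show ?thesis by (simp only: L2_sq_def)
qed

lemma L2_sq_cmult: "L2_sq M (\<lambda>x. c * f x) = (norm c)\<^sup>2 * L2_sq M f"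
  by (simp add: L2_sq_def norm_mult power_mult_distrib)

lemma L2_inner_self: "L2_inner M f f = complex_of_real (L2_sq M f)"
  unfolding L2_inner_def L2_sq_def
  by (simp add: complex_norm_square[symmetric] flip: of_real_power integral_of_real)

text \<open>The discriminant inequality for a nonnegative quadratic function of a complex variable. It
  gives Cauchy--Schwarz, and for \<open>A = 0\<close> it forces \<open>B = 0\<close>, which is the Euler--Lagrange equation of a
  minimizer.\<close>

lemma nonneg_quadratic_bound:
  assumes "\<And>c::complex. 0 \<le> A + 2 * Re (cnj c * B) + (norm c)\<^sup>2 * D"
  shows "(norm B)\<^sup>2 \<le> A * D"
proof -
  \<comment> \<open>Specialize to \<open>c = - t B\<close>, the direction of steepest descent.\<close>
  have t: "0 \<le> A - 2 * t * (norm B)\<^sup>2 + t\<^sup>2 * (norm B)\<^sup>2 * D" for t :: real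
  proof -
    have "cnj (- of_real t * B) * B = - of_real (t * (norm B)\<^sup>2)"
      using complex_norm_square[of B] by (simp add: mult.commute[of B])
    then have "Re (cnj (- of_real t * B) * B) = - (t * (norm B)\<^sup>2)" by (simp only: Re_complex_of_real uminus_complex.sel)
    moreover have "(norm (- of_real t * B))\<^sup>2 = t\<^sup>2 * (norm B)\<^sup>2"
      by (simp add: norm_mult power_mult_distrib)
    ultimately show ?thesis using assms[of "- of_real t * B"] by (simp only:)
  qed
  have A: "0 \<le> A" using assms[of 0] by simp
  consider "D > 0" | "D = 0" | "D < 0" by linarith
  then show ?thesis
  proof cases
    case 1
    with t[of "1 / D"] show ?thesis by (simp add: field_simps power2_eq_square)
  next
    case 2
    show ?thesis
    proof (rule ccontr)
      assume "\<not> ?thesis"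
      then have "(norm B)\<^sup>2 > 0" using 2 by simp
      moreover from this have "0 \<le> A - 2 * (A + 1)" using t[of "(A + 1) / (norm B)\<^sup>2"] 2 by simp
      ultimately show False using A by simp
    qed
  next
    case 3
    \<comment> \<open>This case is impossible: at \<open>c = s\<close> and \<open>c = - s\<close> the linear terms cancel in the sum, which is negative.\<close>
    define s where "s = sqrt ((A + 1) / - D)"
    have "s\<^sup>2 = (A + 1) / - D" using 3 A by (simp add: s_def divide_nonneg_neg)
    then have sD: "s\<^sup>2 * D = - (A + 1)" using 3 by (simp add: field_simps)
    have "0 \<le> A + 2 * Re (cnj (of_real s) * B) + s\<^sup>2 * D" using assms[of "of_real s"] by simp
    moreover have "0 \<le> A + 2 * Re (cnj (of_real (-s)) * B) + s\<^sup>2 * D" using assms[of "of_real (-s)"] by simp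
    ultimately have False using sD by simp
    then show ?thesis ..
  qed
qed

lemma L2_Cauchy_Schwarz:
  assumes "f \<in> L2 M" "g \<in> L2 M"
  shows "(norm (L2_inner M f g))\<^sup>2 \<le> L2_sq M f * L2_sq M g"
  by (rule nonneg_quadratic_bound) (metis L2_sq_lincomb[OF assms] L2_sq_nonneg)

lemma tendsto_zero_of_sq_le:
  fixes z :: "nat \<Rightarrow> 'a::real_normed_vector"
  assumes "\<And>n. (norm (z n))\<^sup>2 \<le> b n" "b \<longlonglongrightarrow> 0"
  shows "z \<longlonglongrightarrow> 0"
proof -
  have "(\<lambda>n. (norm (z n))\<^sup>2) \<longlonglongrightarrow> 0"
    by (rule tendsto_sandwich[OF _ _ tendsto_const assms(2)]) (use assms(1) in auto)
  then have "(\<lambda>n. sqrt ((norm (z n))\<^sup>2)) \<longlonglongrightarrow> sqrt 0" by (rule tendsto_real_sqrt)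
  then show ?thesis by (simp add: tendsto_norm_zero_iff)
qed

lemma L2_inner_tendsto:
  assumes "\<And>n. f n \<in> L2 M" "g \<in> L2 M" "h \<in> L2 M" "(\<lambda>n. L2_sq M (\<lambda>x. f n x - g x)) \<longlonglongrightarrow> 0"
  shows "(\<lambda>n. L2_inner M (f n) h) \<longlonglongrightarrow> L2_inner M g h"
proof -
  have "(\<lambda>n. L2_inner M (\<lambda>x. f n x - g x) h) \<longlonglongrightarrow> 0"
  proof (rule tendsto_zero_of_sq_le)
    show "(norm (L2_inner M (\<lambda>x. f n x - g x) h))\<^sup>2 \<le> L2_sq M (\<lambda>x. f n x - g x) * L2_sq M h" for n
      by (intro L2_Cauchy_Schwarz L2_diff assms)
    show "(\<lambda>n. L2_sq M (\<lambda>x. f n x - g x) * L2_sq M h) \<longlonglongrightarrow> 0"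
      using tendsto_mult_right[OF assms(4), of "L2_sq M h"] by simp
  qed
  moreover have "L2_inner M (\<lambda>x. f n x - g x) h = L2_inner M (f n) h - L2_inner M g h" for n
    unfolding L2_inner_def left_diff_distrib
    by (intro Bochner_Integration.integral_diff L2_mult_integrable assms L2_cnj)
  ultimately show ?thesis by (simp add: LIM_zero_iff)
qed

lemma L2_sq_tendsto:
  assumes "\<And>n. f n \<in> L2 M" "g \<in> L2 M" "(\<lambda>n. L2_sq M (\<lambda>x. f n x - g x)) \<longlonglongrightarrow> 0"
  shows "(\<lambda>n. L2_sq M (f n)) \<longlonglongrightarrow> L2_sq M g"
proof -
  have "L2_sq M (\<lambda>x. f n x - g x) = L2_sq M (f n) - 2 * Re (L2_inner M (f n) g) + L2_sq M g" for n
    using L2_sq_lincomb[OF assms(1)[of n] assms(2), of "-1"] by simp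
  then have eq: "L2_sq M (f n) = L2_sq M (\<lambda>x. f n x - g x) + 2 * Re (L2_inner M (f n) g) - L2_sq M g" for n
    by simp
  have "(\<lambda>n. L2_sq M (\<lambda>x. f n x - g x) + 2 * Re (L2_inner M (f n) g) - L2_sq M g)
      \<longlonglongrightarrow> 0 + 2 * L2_sq M g - L2_sq M g"
    by (intro tendsto_intros assms(3)) (use tendsto_Re[OF L2_inner_tendsto[OF assms(1,2,2,3)]] L2_inner_self[of M g] in simp)
  then show ?thesis unfolding eq[abs_def] by simp
qed

text \<open>Phrased with a product filter, so that double sequences can be estimated by the usual limit
  rules.\<close>

definition L2_Cauchy :: "'a measure \<Rightarrow> (nat \<Rightarrow> 'a \<Rightarrow> complex) \<Rightarrow> bool" where
  "L2_Cauchy M f \<longleftrightarrow> ((\<lambda>(m, n). L2_sq M (\<lambda>x. f m x - f n x)) \<longlongrightarrow> 0) (sequentially \<times>\<^sub>F sequentially)"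

lemma L2_CauchyD:
  assumes "L2_Cauchy M f" "e > 0"
  shows "\<exists>N. \<forall>m\<ge>N. \<forall>n\<ge>N. L2_sq M (\<lambda>x. f m x - f n x) < e"
proof -
  have "\<forall>\<^sub>F z in sequentially \<times>\<^sub>F sequentially. (\<lambda>(m, n). L2_sq M (\<lambda>x. f m x - f n x)) z < e"
    using order_tendstoD(2)[OF assms(1)[unfolded L2_Cauchy_def] assms(2)] .
  then show ?thesis unfolding eventually_prod_sequentially by (auto simp: split_def)
qed

text \<open>The Riesz--Fischer theorem. On a finite measure space, \<open>L\<^sup>2\<close> bounds control \<open>L\<^sup>1\<close> norms, so the
  increments of a rapidly Cauchy subsequence are summable almost everywhere and the subsequence
  converges pointwise. Fatou's lemma turns the pointwise limit into an \<open>L\<^sup>2\<close> limit.\<close>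

lemma (in finite_measure) L2_complete:
  assumes f: "\<And>n. f n \<in> L2 M" and cauchy: "L2_Cauchy M f"
  shows "\<exists>g\<in>L2 M. (\<lambda>n. L2_sq M (\<lambda>x. f n x - g x)) \<longlonglongrightarrow> 0"
proof -
  have "\<exists>N. \<forall>m\<ge>N. \<forall>n\<ge>N. L2_sq M (\<lambda>x. f m x - f n x) < (1/4)^k" for k :: nat
    by (rule L2_CauchyD[OF cauchy]) simp
  then obtain N where N: "\<And>k m n. N k \<le> m \<Longrightarrow> N k \<le> n \<Longrightarrow> L2_sq M (\<lambda>x. f m x - f n x) < (1/4)^k"
    by metis
  \<comment> \<open>Partial sums, so that \<open>r k\<close> is monotone, exceeds every \<open>N j\<close> with \<open>j \<le> k\<close>, and tends to infinity.\<close>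
  define r where "r k = (\<Sum>i\<le>k. Suc (N i))" for k
  have r: "N j \<le> r k" if "j \<le> k" for j k
  proof -
    have "Suc (N j) \<le> r k" unfolding r_def using that by (intro member_le_sum) auto
    then show ?thesis by simp
  qed
  have r_ge: "k \<le> r k" for k
  proof -
    have "(\<Sum>i\<le>k. 1) \<le> r k" unfolding r_def by (intro sum_mono) simp
    then show ?thesis by simp
  qed
  note [measurable] = L2D(1)[OF f]
  define d where "d k x = f (r (Suc k)) x - f (r k) x" for k x
  have [measurable]: "d k \<in> borel_measurable M" for k unfolding d_def by measurable
  have dL2: "d k \<in> L2 M" for k unfolding d_def by (intro L2_diff f)
  have dint: "integrable M (\<lambda>x. norm (d k x))" for k
    using L2_mult_integrable[OF dL2, of "\<lambda>_. 1"] by (simp add: L2_def)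
  have dn: "(\<integral>x. norm (d k x) \<partial>M) \<le> (measure M (space M) + 1) * (1/2)^k" for k
  proof -
    have "(\<integral>x. norm (d k x) \<partial>M) \<le> (\<integral>x. (1/2)^k + 2^k * (norm (d k x))\<^sup>2 \<partial>M)"
    proof (rule integral_mono[OF dint])
      show "integrable M (\<lambda>x. (1/2)^k + 2^k * (norm (d k x))\<^sup>2)"
        using L2D(2)[OF dL2] by simp
      fix x
      \<comment> \<open>The elementary bound \<open>2 s \<le> 1/a + a s\<^sup>2\<close> with \<open>a = 2^k\<close>, matched to the rate \<open>4^-k\<close> of the increments.\<close>
      define a :: real where "a = 2^k"
      have a: "a > 0" "(1/2)^k = 1 / a" by (simp_all add: a_def power_one_over)
      have "0 \<le> (1/2)^k * (1 - 2^k * norm (d k x))\<^sup>2" by simp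
      also have "\<dots> = (1/2)^k + 2^k * (norm (d k x))\<^sup>2 - 2 * norm (d k x)"
        using a(1) unfolding a(2) a_def[symmetric] by (simp add: power2_eq_square field_simps)
      finally have "2 * norm (d k x) \<le> (1/2)^k + 2^k * (norm (d k x))\<^sup>2" by simp
      moreover have "0 \<le> norm (d k x)" by simp
      ultimately show "norm (d k x) \<le> (1/2)^k + 2^k * (norm (d k x))\<^sup>2" by linarith
    qed
    also have "\<dots> = (1/2)^k * measure M (space M) + 2^k * L2_sq M (d k)"
      using L2D(2)[OF dL2] by (simp add: L2_sq_def mult.commute)
    also have "2^k * L2_sq M (d k) \<le> 2^k * (1/4)^k"
      using N[of k "r (Suc k)" "r k"] r[of k k] r[of k "Suc k"]
      by (intro mult_left_mono) (auto simp: d_def[abs_def])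
    also have "2^k * (1/4)^k = ((1/2)^k :: real)" by (simp flip: power_mult_distrib)
    finally show ?thesis by (simp add: algebra_simps)
  qed
  have "AE x in M. (\<Sum>k. ennreal (norm (d k x))) \<noteq> \<infinity>"
  proof (rule nn_integral_PInf_AE)
    have "(\<integral>\<^sup>+x. (\<Sum>k. ennreal (norm (d k x))) \<partial>M) = (\<Sum>k. \<integral>\<^sup>+x. ennreal (norm (d k x)) \<partial>M)"
      by (rule nn_integral_suminf) simp
    also have "\<dots> = (\<Sum>k. ennreal (\<integral>x. norm (d k x) \<partial>M))"
      by (simp add: nn_integral_eq_integral[OF dint])
    also have "\<dots> \<noteq> \<infinity>"
    proof -
      have "summable (\<lambda>k. (measure M (space M) + 1) * (1/2::real)^k)"
        by (intro summable_mult summable_geometric) simp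
      then have "summable (\<lambda>k. \<integral>x. norm (d k x) \<partial>M)"
        by (rule summable_comparison_test'[of _ 0]) (use dn in simp)
      then show ?thesis by (simp add: suminf_ennreal_eq[OF _ summable_sums])
    qed
    finally show "(\<integral>\<^sup>+x. (\<Sum>k. ennreal (norm (d k x))) \<partial>M) \<noteq> \<infinity>" .
  qed measurable
  then have conv: "AE x in M. convergent (\<lambda>k. f (r k) x)"
  proof eventually_elim
    case (elim x)
    then have "summable (\<lambda>k. norm (d k x))"
      by (intro summable_suminf_not_top) auto
    then have "summable (\<lambda>k. d k x)" by (rule summable_norm_cancel)
    then have "(\<lambda>n. \<Sum>k<n. d k x) \<longlonglongrightarrow> (\<Sum>k. d k x)" by (rule summable_LIMSEQ)
    then have "(\<lambda>n. f (r 0) x + (\<Sum>k<n. d k x)) \<longlonglongrightarrow> f (r 0) x + (\<Sum>k. d k x)"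
      by (intro tendsto_intros)
    moreover have "f (r 0) x + (\<Sum>k<n. d k x) = f (r n) x" for n
      unfolding d_def by (subst sum_lessThan_telescope) simp
    ultimately show ?case by (auto simp: convergent_def)
  qed
  define g where "g x = lim (\<lambda>k. f (r k) x)" for x
  have [measurable]: "g \<in> borel_measurable M" unfolding g_def by measurable
  have key: "(\<integral>\<^sup>+x. ennreal ((norm (f n x - g x))\<^sup>2) \<partial>M) \<le> ennreal e"
    if e: "e > 0" and n: "\<And>m. N0 \<le> m \<Longrightarrow> L2_sq M (\<lambda>x. f n x - f m x) < e" for n N0 e
  proof -
    have j: "L2_sq M (\<lambda>x. f n x - f (r k) x) \<le> e" if "N0 \<le> k" for k
      using n[of "r k"] r_ge[of k] that by simp
    have "(\<integral>\<^sup>+x. ennreal ((norm (f n x - g x))\<^sup>2) \<partial>M) =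
        (\<integral>\<^sup>+x. liminf (\<lambda>k. ennreal ((norm (f n x - f (r k) x))\<^sup>2)) \<partial>M)"
    proof (rule nn_integral_cong_AE)
      show "AE x in M. ennreal ((norm (f n x - g x))\<^sup>2) = liminf (\<lambda>k. ennreal ((norm (f n x - f (r k) x))\<^sup>2))"
        using conv
      proof eventually_elim
        case (elim x)
        then have "(\<lambda>k. f (r k) x) \<longlonglongrightarrow> g x" unfolding g_def by (simp add: convergent_LIMSEQ_iff)
        then have "(\<lambda>k. ennreal ((norm (f n x - f (r k) x))\<^sup>2)) \<longlonglongrightarrow> ennreal ((norm (f n x - g x))\<^sup>2)"
          by (intro tendsto_ennrealI tendsto_intros)
        from lim_imp_Liminf[OF _ this] show ?case by simp
      qed
    qed
    also have "\<dots> \<le> liminf (\<lambda>k. \<integral>\<^sup>+x. ennreal ((norm (f n x - f (r k) x))\<^sup>2) \<partial>M)"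
      by (rule nn_integral_liminf) measurable
    also have "\<dots> = liminf (\<lambda>k. ennreal (L2_sq M (\<lambda>x. f n x - f (r k) x)))"
      unfolding L2_sq_def by (subst nn_integral_eq_integral[OF L2D(2)[OF L2_diff[OF f f]]]) auto
    also have "\<dots> \<le> limsup (\<lambda>k. ennreal (L2_sq M (\<lambda>x. f n x - f (r k) x)))"
      by (rule Liminf_le_Limsup) simp
    also have "\<dots> \<le> ennreal e"
      by (rule Limsup_bounded) (use j in \<open>auto simp: eventually_sequentially intro!: exI[of _ N0] ennreal_leI\<close>)
    finally show ?thesis .
  qed
  have close: "(\<lambda>x. f n x - g x) \<in> L2 M \<and> L2_sq M (\<lambda>x. f n x - g x) \<le> e"
    if e: "e > 0" and n: "\<And>m. N0 \<le> m \<Longrightarrow> L2_sq M (\<lambda>x. f n x - f m x) < e" for n N0 e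
  proof -
    have le: "(\<integral>\<^sup>+x. ennreal ((norm (f n x - g x))\<^sup>2) \<partial>M) \<le> ennreal e"
      by (rule key[OF e n])
    have i: "integrable M (\<lambda>x. (norm (f n x - g x))\<^sup>2)"
      using le_less_trans[OF le ennreal_less_top] by (intro integrableI_bounded) auto
    then have "L2_sq M (\<lambda>x. f n x - g x) \<le> e"
      using le e by (simp add: L2_sq_def nn_integral_eq_integral)
    then show ?thesis using i by (simp add: L2_def)
  qed
  show ?thesis
  proof (rule bexI[of _ g])
    obtain N1 where "\<And>m n. N1 \<le> m \<Longrightarrow> N1 \<le> n \<Longrightarrow> L2_sq M (\<lambda>x. f m x - f n x) < 1"
      using L2_CauchyD[OF cauchy, of 1] by auto
    then have "(\<lambda>x. f N1 x - g x) \<in> L2 M" using close[of 1 N1 N1] by auto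
    from L2_diff[OF f[of N1] this] show "g \<in> L2 M" by simp
    show "(\<lambda>n. L2_sq M (\<lambda>x. f n x - g x)) \<longlonglongrightarrow> 0"
    proof (rule LIMSEQ_I)
      fix e :: real assume "e > 0"
      then obtain N2 where "\<And>m n. N2 \<le> m \<Longrightarrow> N2 \<le> n \<Longrightarrow> L2_sq M (\<lambda>x. f m x - f n x) < e / 2"
        using L2_CauchyD[OF cauchy, of "e / 2"] by auto
      then have "L2_sq M (\<lambda>x. f n x - g x) \<le> e / 2" if "N2 \<le> n" for n
        using close[of "e / 2" N2 n] that \<open>e > 0\<close> by auto
      then show "\<exists>no. \<forall>n\<ge>no. norm (L2_sq M (\<lambda>x. f n x - g x) - 0) < e"
        using \<open>e > 0\<close> by (intro exI[of _ N2]) (fastforce simp: L2_sq_nonneg)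
    qed
  qed
qed

section \<open>The fundamental lemma of the calculus of variations\<close>

text \<open>Dominated convergence along the bumps of the box.\<close>

lemma box_integral_zero_of_test_functions:
  fixes \<omega> :: "(real \<times> real) set" and f :: "real \<times> real \<Rightarrow> complex"
  assumes \<omega>: "open \<omega>" and f: "integrable (lebesgue_on \<omega>) f"
    and zero: "\<And>\<phi>. \<phi> \<in> test_functions \<omega> \<Longrightarrow> (\<integral>x. f x * \<phi> x \<partial>lebesgue_on \<omega>) = 0"
    and ab: "cbox a b \<subseteq> \<omega>"
  shows "set_lebesgue_integral (lebesgue_on \<omega>) (box a b) f = 0"
proof -
  let ?M = "lebesgue_on \<omega>"
  note [measurable] = borel_measurable_integrable[OF f]
  have [measurable]: "(\<lambda>x. complex_of_real (box_bump n a b x)) \<in> borel_measurable ?M" for n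
    using test_function_continuous[OF box_bump_test_function[OF ab, of n]] continuous_on_subset
    by (intro continuous_imp_measurable_on_sets_lebesgue) (use \<omega> in auto)
  have "(\<lambda>n. \<integral>x. f x * complex_of_real (box_bump n a b x) \<partial>?M) \<longlonglongrightarrow> (\<integral>x. f x * complex_of_real (indicator (box a b) x) \<partial>?M)"
  proof (rule integral_dominated_convergence)
    show "integrable ?M (\<lambda>x. norm (f x))" using f by simp
    show "AE x in ?M. (\<lambda>n. f x * complex_of_real (box_bump n a b x)) \<longlonglongrightarrow> f x * complex_of_real (indicator (box a b) x)"
      by (intro AE_I2 tendsto_intros tendsto_of_real box_bump_tendsto)
    show "AE x in ?M. norm (f x * complex_of_real (box_bump n a b x)) \<le> norm (f x)" for n
    proof (intro AE_I2)
      fix x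
      have "norm (complex_of_real (box_bump n a b x)) \<le> 1" using box_bump_bounds[of n a b x] by simp
      then show "norm (f x * complex_of_real (box_bump n a b x)) \<le> norm (f x)"
        unfolding norm_mult by (intro mult_left_le) auto
    qed
    show "(\<lambda>x. f x * complex_of_real (indicator (box a b) x)) \<in> borel_measurable ?M"
    proof -
      have "box a b \<inter> \<omega> \<in> sets ?M" using \<omega> by (simp add: sets_restrict_space_iff)
      then have "(indicator (box a b) :: _ \<Rightarrow> real) \<in> borel_measurable ?M"
        by (subst borel_measurable_indicator_iff) simp
      then show ?thesis by measurable
    qed
  qed measurable
  then have "(\<integral>x. f x * complex_of_real (indicator (box a b) x) \<partial>?M) = 0"
    using zero[OF box_bump_test_function[OF ab]] by (simp add: LIMSEQ_const_iff)
  then show ?thesis by (simp add: set_lebesgue_integral_def scaleR_conv_of_real mult.commute)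
qed

text \<open>The integral vanishes over every box whose closure lies in \<open>\<omega>\<close>. Boxes form a generator of the
  Borel sets that is stable under intersection, so by Dynkin's argument, applied inside a fixed
  box, the integral vanishes over all Borel subsets, and up to null sets over all Lebesgue
  subsets. Countably many such boxes cover \<open>\<omega>\<close>.\<close>

lemma AE_zero_of_test_functions:
  fixes \<omega> :: "(real \<times> real) set" and f :: "real \<times> real \<Rightarrow> complex"
  assumes \<omega>: "open \<omega>" and bd: "bounded \<omega>" and f: "integrable (lebesgue_on \<omega>) f"
    and zero: "\<And>\<phi>. \<phi> \<in> test_functions \<omega> \<Longrightarrow> (\<integral>x. f x * \<phi> x \<partial>lebesgue_on \<omega>) = 0"
  shows "AE x in lebesgue_on \<omega>. f x = 0"
proof -
  let ?M = "lebesgue_on \<omega>"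
  have "\<omega> \<in> sets lebesgue" using \<omega> by auto
  interpret finite_measure ?M using \<omega> bd by (intro finite_measure_lebesgue_on lmeasurable_open)
  have sets_M: "A \<inter> \<omega> \<in> sets ?M" if "A \<in> sets lebesgue" for A
    using that \<open>\<omega> \<in> sets lebesgue\<close> by (simp add: sets_restrict_space_iff)
  have loc: "AE x in ?M. x \<in> box a b \<longrightarrow> f x = 0" if ab: "cbox a b \<subseteq> \<omega>" for a b
  proof -
    have sub: "box a b \<subseteq> \<omega>" using ab box_subset_cbox by blast
    have B: "box a b \<in> sets ?M" using sets_M[of "box a b"] sub by (simp add: Int_absorb2)
    \<comment> \<open>Cutting off to one box makes the total integral of \<open>g\<close> zero, which the complement step of the Dynkin argument needs.\<close>
    define g where "g x = indicator (box a b) x *\<^sub>R f x" for x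
    have g: "integrable ?M g" unfolding g_def by (rule integrable_mult_indicator[OF B f])
    have g0: "integral\<^sup>L ?M g = 0"
      using box_integral_zero_of_test_functions[OF \<omega> f zero ab] by (simp add: g_def[abs_def] set_lebesgue_integral_def)
    have gi: "integrable ?M (\<lambda>x. indicator A x *\<^sub>R g x)" if "A \<in> sets ?M" for A
      by (rule integrable_mult_indicator[OF that g])
    have st: "Int_stable (range (\<lambda>(c, d). box c d :: (real \<times> real) set))" "range (\<lambda>(c, d). box c d :: (real \<times> real) set) \<subseteq> Pow UNIV"
      by (auto simp: Int_stable_def box_Int_box)
    have borel: "set_lebesgue_integral ?M (A \<inter> \<omega>) g = 0 \<and> A \<in> sets borel" if "A \<in> sets borel" for A
    proof -
      have "A \<in> sigma_sets UNIV (range (\<lambda>(c, d). box c d))"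
        using that unfolding borel_eq_box by simp
      then show ?thesis
      proof (induction rule: sigma_sets_induct_disjoint[OF st, consumes 1, case_names basic empty compl union])
        case (basic A)
        then obtain c d where A: "A = box c d" by auto
        define e e' where "e = (\<Sum>i\<in>Basis. max (c \<bullet> i) (a \<bullet> i) *\<^sub>R i)" and "e' = (\<Sum>i\<in>Basis. min (d \<bullet> i) (b \<bullet> i) *\<^sub>R i)"
        have 1: "box c d \<inter> box a b = box e e'" unfolding e_def e'_def by (rule box_Int_box)
        have 2: "cbox c d \<inter> cbox a b = cbox e e'" unfolding e_def e'_def by (rule Int_interval)
        have "set_lebesgue_integral ?M (box e e') f = 0"
          by (rule box_integral_zero_of_test_functions[OF \<omega> f zero]) (use 2 ab in auto)
        moreover have "indicator (A \<inter> \<omega>) x *\<^sub>R g x = indicator (box e e') x *\<^sub>R f x" for x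
          using sub unfolding A 1[symmetric] g_def by (auto simp: indicator_def)
        ultimately show ?case
          unfolding set_lebesgue_integral_def by (simp add: A)
      next
        case empty
        then show ?case by (simp add: set_lebesgue_integral_def)
      next
        case (compl A)
        then have A: "A \<inter> \<omega> \<in> sets ?M" by (intro sets_M) auto
        have "set_lebesgue_integral ?M ((UNIV - A) \<inter> \<omega>) g = (\<integral>x. g x - indicator (A \<inter> \<omega>) x *\<^sub>R g x \<partial>?M)"
          unfolding set_lebesgue_integral_def by (rule Bochner_Integration.integral_cong) (auto simp: indicator_def)
        also have "\<dots> = 0"
          using compl(2) g0 Bochner_Integration.integral_diff[OF g gi[OF A]] by (simp add: set_lebesgue_integral_def)
        finally show ?case using compl by auto
      next
        case (union A)
        then have A: "A i \<inter> \<omega> \<in> sets ?M" for i by (intro sets_M) auto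
        have "set_lebesgue_integral ?M (\<Union>i. A i \<inter> \<omega>) g = (\<Sum>i. set_lebesgue_integral ?M (A i \<inter> \<omega>) g)"
        proof (rule lebesgue_integral_countable_add[OF A])
          show "A i \<inter> \<omega> \<inter> (A j \<inter> \<omega>) = {}" if "i \<noteq> j" for i j
            using union(1) that by (auto simp: disjoint_family_on_def)
          show "set_integrable ?M (\<Union>i. A i \<inter> \<omega>) g"
            unfolding set_integrable_def by (intro gi sets.countable_UN) (use A in auto)
        qed
        then show ?case using union by auto
      qed
    qed
    have "AE x in ?M. g x = 0"
    proof (rule density_unique_banach[OF g])
      show "integrable ?M (\<lambda>x. 0 :: complex)" by simp
      fix A assume "A \<in> sets ?M"
      then have A: "A \<in> sets lebesgue" "A \<subseteq> \<omega>" using \<omega> by (auto simp: sets_restrict_space_iff)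
      obtain S N N' where S: "A = S \<union> N" "N \<subseteq> N'" "N' \<in> null_sets lborel" "S \<in> sets lborel"
        using sets_completionE[OF A(1)] by metis
      have "AE x in lebesgue. x \<notin> N'" using S(3) by (intro AE_not_in null_sets_completionI)
      then have nN: "AE x in ?M. x \<notin> N'" using \<omega> by (subst AE_restrict_space_iff) (auto elim: eventually_mono)
      have "set_lebesgue_integral ?M A g = set_lebesgue_integral ?M (S \<inter> \<omega>) g"
        unfolding set_lebesgue_integral_def
      proof (rule integral_cong_AE)
        show "AE x in ?M. indicator A x *\<^sub>R g x = indicator (S \<inter> \<omega>) x *\<^sub>R g x"
          using nN by eventually_elim (use S A in \<open>auto simp: indicator_def\<close>)
        show "(\<lambda>x. indicator A x *\<^sub>R g x) \<in> borel_measurable ?M"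
          using gi[OF \<open>A \<in> sets ?M\<close>] by (rule borel_measurable_integrable)
        have "S \<inter> \<omega> \<in> sets ?M" using S(4) by (intro sets_M) auto
        then show "(\<lambda>x. indicator (S \<inter> \<omega>) x *\<^sub>R g x) \<in> borel_measurable ?M"
          using gi by (intro borel_measurable_integrable)
      qed
      then show "set_lebesgue_integral ?M A g = set_lebesgue_integral ?M A (\<lambda>x. 0)"
        using borel[of S] S(4) by (simp add: set_lebesgue_integral_def)
    qed
    then show ?thesis by eventually_elim (auto simp: g_def indicator_def split: if_splits)
  qed
  define \<F> where "\<F> = {box a b | a b. cbox a b \<subseteq> \<omega>}"
  have F_E: "\<exists>a b. B = box a b \<and> cbox a b \<subseteq> \<omega>" if "B \<in> \<F>" for B
    using that unfolding \<F>_def by (rule CollectD)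
  have F_I: "box a b \<in> \<F>" if "cbox a b \<subseteq> \<omega>" for a b
    unfolding \<F>_def mem_Collect_eq by (rule exI[of _ a], rule exI[of _ b]) (intro conjI refl that)
  have cover: "\<Union>\<F> = \<omega>"
  proof (intro equalityI subsetI)
    fix x assume "x \<in> \<Union>\<F>"
    then obtain B where B: "B \<in> \<F>" "x \<in> B" by (rule UnionE)
    obtain a b where "B = box a b" "cbox a b \<subseteq> \<omega>" using F_E[OF B(1)] by (elim exE conjE)
    then show "x \<in> \<omega>" using B(2) box_subset_cbox[of a b] by (meson subsetD)
  next
    fix x assume "x \<in> \<omega>"
    then obtain a b where "cbox a b \<subseteq> \<omega>" "x \<in> box a b" using open_contains_cbox[OF \<omega>, of x] by metis
    then show "x \<in> \<Union>\<F>" using F_I by (intro UnionI)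
  qed
  have "open B" if "B \<in> \<F>" for B using F_E[OF that] open_box by metis
  from Lindelof[of \<F>, OF this] obtain \<G> where G: "\<G> \<subseteq> \<F>" "countable \<G>" "\<Union>\<G> = \<Union>\<F>"
    by blast
  have "AE x in ?M. \<forall>B\<in>\<G>. x \<in> B \<longrightarrow> f x = 0"
  proof (rule AE_ball_countable'[OF _ G(2)])
    fix B assume "B \<in> \<G>"
    then obtain a b where "B = box a b" "cbox a b \<subseteq> \<omega>" using F_E[of B] G(1) by (meson subsetD)
    then show "AE x in ?M. x \<in> B \<longrightarrow> f x = 0" using loc by simp
  qed
  moreover have "AE x in ?M. x \<in> \<omega>" by (rule AE_I2) simp
  ultimately show ?thesis by eventually_elim (use G(3) cover in auto)
qed

section \<open>Rellich compactness\<close>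

text \<open>Obtained by integrating \<open>(\<bar>f\<bar> - J/c)\<^sup>2 \<ge> 0\<close>, where \<open>J/c\<close> is the mean of \<open>\<bar>f\<bar>\<close> over the box.\<close>

lemma integral_cbox_Cauchy_Schwarz:
  fixes f :: "'a::euclidean_space \<Rightarrow> complex"
  assumes "continuous_on (cbox a b) f"
  shows "(norm (integral (cbox a b) f))\<^sup>2 \<le> measure lborel (cbox a b) * integral (cbox a b) (\<lambda>x. (norm (f x))\<^sup>2)"
proof -
  let ?c = "measure lborel (cbox a b)"
  define J where "J = integral (cbox a b) (\<lambda>x. norm (f x))"
  have i: "f integrable_on cbox a b" "(\<lambda>x. norm (f x)) integrable_on cbox a b"
    "(\<lambda>x. (norm (f x))\<^sup>2) integrable_on cbox a b"
    using assms by (auto intro!: integrable_continuous continuous_intros)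
  have le: "norm (integral (cbox a b) f) \<le> J"
    unfolding J_def by (rule integral_norm_bound_integral[OF i(1,2)]) simp
  show ?thesis
  proof (cases "?c = 0")
    case True
    then show ?thesis by (simp add: content_eq_0_interior integral_null)
  next
    case False
    then have c: "?c > 0" by (simp add: less_le)
    have "0 \<le> integral (cbox a b) (\<lambda>x. (norm (f x) - J / ?c)\<^sup>2)"
      using assms by (intro Henstock_Kurzweil_Integration.integral_nonneg integrable_continuous continuous_intros) auto
    also have "(\<lambda>x. (norm (f x) - J / ?c)\<^sup>2) = (\<lambda>x. ((norm (f x))\<^sup>2 - (2 * J / ?c) * norm (f x)) + (J / ?c)\<^sup>2)"
      by (auto simp: power2_diff)
    also have "integral (cbox a b) \<dots> = integral (cbox a b) (\<lambda>x. (norm (f x))\<^sup>2) - (2 * J / ?c) * J + ?c * (J / ?c)\<^sup>2"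
      unfolding J_def
      by (subst Henstock_Kurzweil_Integration.integral_add Henstock_Kurzweil_Integration.integral_diff
          | intro integrable_diff integrable_on_mult_right i integrable_const)+ (simp add: i)
    also have "\<dots> = integral (cbox a b) (\<lambda>x. (norm (f x))\<^sup>2) - J\<^sup>2 / ?c"
      using c by (simp add: field_simps power2_eq_square)
    finally have "J\<^sup>2 \<le> ?c * integral (cbox a b) (\<lambda>x. (norm (f x))\<^sup>2)"
      using c by (simp add: field_simps)
    moreover have "(norm (integral (cbox a b) f))\<^sup>2 \<le> J\<^sup>2"
      using le by (intro power_mono) auto
    ultimately show ?thesis by linarith
  qed
qed

lemma norm_diff_sq_le_integral_deriv:
  fixes g :: "real \<Rightarrow> complex"
  assumes g: "\<And>x. (g has_vector_derivative g' x) (at x)" and g': "continuous_on UNIV g'"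
    and x: "x \<in> {a..b}" and y: "y \<in> {a..b}"
  shows "(norm (g x - g y))\<^sup>2 \<le> (b - a) * integral {a..b} (\<lambda>t. (norm (g' t))\<^sup>2)"
proof -
  have *: "(norm (g x - g y))\<^sup>2 \<le> (b - a) * integral {a..b} (\<lambda>t. (norm (g' t))\<^sup>2)"
    if "y \<le> x" "x \<in> {a..b}" "y \<in> {a..b}" for x y
  proof -
    have c: "continuous_on S g'" for S using g' continuous_on_subset by blast
    have "(g' has_integral (g x - g y)) {y..x}"
      using that by (intro fundamental_theorem_of_calculus has_vector_derivative_at_within[OF g]) auto
    then have "(norm (g x - g y))\<^sup>2 = (norm (integral (cbox y x) g'))\<^sup>2" by (simp add: integral_unique)
    also have "\<dots> \<le> measure lborel (cbox y x) * integral (cbox y x) (\<lambda>t. (norm (g' t))\<^sup>2)"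
      by (rule integral_cbox_Cauchy_Schwarz[OF c])
    also have "\<dots> \<le> (b - a) * integral {a..b} (\<lambda>t. (norm (g' t))\<^sup>2)"
    proof (rule mult_mono)
      show "measure lborel (cbox y x) \<le> b - a" using that by auto
      show "integral (cbox y x) (\<lambda>t. (norm (g' t))\<^sup>2) \<le> integral {a..b} (\<lambda>t. (norm (g' t))\<^sup>2)"
        using that
        by (intro integral_subset_le) (auto intro!: integrable_continuous_real continuous_intros c)
      show "0 \<le> integral (cbox y x) (\<lambda>t. (norm (g' t))\<^sup>2)"
        by (intro Henstock_Kurzweil_Integration.integral_nonneg) (auto intro!: integrable_continuous_real continuous_intros c)
    qed (use that in auto)
    finally show ?thesis .
  qed
  show ?thesis
    using *[of x y] *[of y x] x y by (cases "y \<le> x") (auto simp: norm_minus_commute)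
qed

lemma content_plane: "a \<le> b \<Longrightarrow> c \<le> d \<Longrightarrow> measure lborel (cbox (a, c) (b, d :: real)) = (b - a) * (d - c :: real)"
  by (simp add: content_Pair)

text \<open>A Poincare inequality with the mean kept on the right. Two points of the square are joined by
  a horizontal and a vertical segment; the increments along the segments are bounded by the
  one-dimensional integrals \<open>G1\<close> and \<open>G2\<close> of the squared partial derivatives. As \<open>G1\<close> depends only on the
  second coordinate of the first point and \<open>G2\<close> only on the first coordinate of the second
  point, averaging over both points produces the area integrals \<open>D1\<close> and \<open>D2\<close>.\<close>

lemma Poincare_square:
  fixes f :: "real \<times> real \<Rightarrow> complex" and h a c :: real
  assumes f: "Ck (Suc 0) f" and h: "h > 0"
  defines "Q \<equiv> cbox (a, c) (a + h, c + h)"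
  shows "integral Q (\<lambda>x. (norm (f x))\<^sup>2) \<le> 2 / h\<^sup>2 * (norm (integral Q f))\<^sup>2 +
    4 * h\<^sup>2 * integral Q (\<lambda>x. (norm (dir_deriv (1, 0) f x))\<^sup>2 + (norm (dir_deriv (0, 1) f x))\<^sup>2)"
proof -
  note D = Ck1_partial_derivatives[OF f]
  note cf = Ck_continuous[OF f]
  have ion: "g integrable_on Q" if "continuous_on UNIV g" for g :: "real \<times> real \<Rightarrow> 'x::euclidean_space"
    unfolding Q_def by (rule integrable_continuous[OF continuous_on_subset[OF that]]) simp
  have cQ: "measure lborel Q = h\<^sup>2" unfolding Q_def using h by (subst content_plane) (auto simp: power2_eq_square)
  define F1 where "F1 x = (norm (dir_deriv (1, 0) f x))\<^sup>2" for x
  define F2 where "F2 x = (norm (dir_deriv (0, 1) f x))\<^sup>2" for x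
  have cF: "continuous_on UNIV F1" "continuous_on UNIV F2"
    unfolding F1_def F2_def by (auto intro!: continuous_intros D(3,4))
  define G1 where "G1 t = integral (cbox a (a + h)) (\<lambda>s. F1 (s, t))" for t
  define G2 where "G2 s = integral (cbox c (c + h)) (\<lambda>t. F2 (s, t))" for s
  have cG1: "continuous_on UNIV G1" unfolding G1_def
    by (rule integral_continuous_on_param)
      (auto intro!: continuous_on_compose2[OF cF(1)] continuous_intros simp: split_def)
  have cG2: "continuous_on UNIV G2" unfolding G2_def
    by (rule integral_continuous_on_param)
      (auto intro!: continuous_on_compose2[OF cF(2)] continuous_intros simp: split_def)
  define D1 where "D1 = integral Q F1"
  define D2 where "D2 = integral Q F2"
  have D1: "D1 = integral (cbox c (c + h)) G1" unfolding D1_def Q_def G1_def by (rule integral_plane_iterated(2)[OF cF(1)])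
  have D2: "D2 = integral (cbox a (a + h)) G2" unfolding D2_def Q_def G2_def by (rule integral_plane_iterated(1)[OF cF(2)])
  have cG1': "continuous_on UNIV (\<lambda>x. G1 (snd x))" and cG2': "continuous_on UNIV (\<lambda>x. G2 (fst x))"
    by (auto intro!: continuous_on_compose2[OF cG1] continuous_on_compose2[OF cG2] continuous_intros)
  have IG1: "integral Q (\<lambda>x. G1 (snd x)) = h * D1"
    unfolding Q_def D1 using integral_plane_iterated(1)[OF cG1', of a c "a + h" "c + h"] h by simp
  have IG2: "integral Q (\<lambda>x. G2 (fst x)) = h * D2"
    unfolding Q_def D2 using integral_plane_iterated(2)[OF cG2', of a c "a + h" "c + h"] h by simp
  \<comment> \<open>The corner of the path from \<open>x\<close> to \<open>y\<close> is \<open>(y1, x2)\<close>.\<close>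
  have pt: "(norm (f x - f y))\<^sup>2 \<le> 2 * h * G1 (snd x) + 2 * h * G2 (fst y)" if "x \<in> Q" "y \<in> Q" for x y
  proof -
    obtain x1 x2 y1 y2 where xy: "x = (x1, x2)" "y = (y1, y2)" by (metis surj_pair)
    have I: "x1 \<in> {a..a+h}" "x2 \<in> {c..c+h}" "y1 \<in> {a..a+h}" "y2 \<in> {c..c+h}"
      using that by (auto simp: xy Q_def cbox_Pair_eq)
    have "(norm (f (x1, x2) - f (y1, x2)))\<^sup>2 \<le> (a + h - a) * integral {a..a+h} (\<lambda>s. (norm (dir_deriv (1, 0) f (s, x2)))\<^sup>2)"
      by (rule norm_diff_sq_le_integral_deriv[OF D(1)])
        (use I in \<open>auto intro!: continuous_on_compose2[OF D(3)] continuous_intros\<close>)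
    moreover have "(norm (f (y1, x2) - f (y1, y2)))\<^sup>2 \<le> (c + h - c) * integral {c..c+h} (\<lambda>t. (norm (dir_deriv (0, 1) f (y1, t)))\<^sup>2)"
      by (rule norm_diff_sq_le_integral_deriv[OF D(2)])
        (use I in \<open>auto intro!: continuous_on_compose2[OF D(4)] continuous_intros\<close>)
    moreover have "(norm (f x - f y))\<^sup>2 \<le> 2 * (norm (f (x1, x2) - f (y1, x2)))\<^sup>2 + 2 * (norm (f (y1, x2) - f (y1, y2)))\<^sup>2"
      using norm_add_sq_le[of "f (x1, x2) - f (y1, x2)" "f (y1, x2) - f (y1, y2)"] by (simp add: xy)
    ultimately show ?thesis by (simp add: xy G1_def G2_def F1_def F2_def)
  qed
  define A where "A = integral Q f /\<^sub>R h\<^sup>2"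
  have mean: "(norm (f x - A))\<^sup>2 \<le> 2 * h * G1 (snd x) + 2 * D2" if x: "x \<in> Q" for x
  proof -
    have cfx: "continuous_on UNIV (\<lambda>y. f x - f y)" by (intro continuous_intros cf)
    have "integral Q (\<lambda>y. f x - f y) = h\<^sup>2 *\<^sub>R f x - integral Q f"
      using Henstock_Kurzweil_Integration.integral_diff[OF ion ion[OF cf], of "\<lambda>_. f x"] cQ by (simp add: Q_def)
    also have "\<dots> = h\<^sup>2 *\<^sub>R (f x - A)" using h by (simp add: A_def scaleR_right_diff_distrib)
    finally have "(norm (h\<^sup>2 *\<^sub>R (f x - A)))\<^sup>2 = (norm (integral Q (\<lambda>y. f x - f y)))\<^sup>2" by simp
    also have "\<dots> \<le> h\<^sup>2 * integral Q (\<lambda>y. (norm (f x - f y))\<^sup>2)"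
      using integral_cbox_Cauchy_Schwarz[OF continuous_on_subset[OF cfx subset_UNIV], of "(a, c)" "(a + h, c + h)"] cQ
      by (simp add: Q_def)
    also have "\<dots> \<le> h\<^sup>2 * integral Q (\<lambda>y. 2 * h * G1 (snd x) + 2 * h * G2 (fst y))"
      using x by (intro mult_left_mono integral_le ion pt) (auto intro!: continuous_intros cf cG2')
    also have "integral Q (\<lambda>y. 2 * h * G1 (snd x) + 2 * h * G2 (fst y)) = h\<^sup>2 * (2 * h * G1 (snd x)) + 2 * h * (h * D2)"
      using Henstock_Kurzweil_Integration.integral_add[OF ion[OF continuous_on_const] integrable_on_mult_right[OF ion[OF cG2']],
          of "2 * h * G1 (snd x)" "2 * h"] cQ IG2 by (simp add: Q_def)
    finally have "(h\<^sup>2)\<^sup>2 * (norm (f x - A))\<^sup>2 \<le> (h\<^sup>2)\<^sup>2 * (2 * h * G1 (snd x) + 2 * D2)"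
      unfolding norm_scaleR power_mult_distrib power2_abs abs_power2 by (simp add: power2_eq_square algebra_simps)
    then show ?thesis using h by simp
  qed
  have "integral Q (\<lambda>x. (norm (f x))\<^sup>2) \<le> integral Q (\<lambda>x. 2 * (2 * h * G1 (snd x) + 2 * D2) + 2 * (norm A)\<^sup>2)"
  proof (intro integral_le ion)
    fix x assume "x \<in> Q"
    from mean[OF this] norm_add_sq_le[of "f x - A" A]
    show "(norm (f x))\<^sup>2 \<le> 2 * (2 * h * G1 (snd x) + 2 * D2) + 2 * (norm A)\<^sup>2" by simp
  qed (auto intro!: continuous_intros cf cG1')
  also have "(\<lambda>x::real\<times>real. 2 * (2 * h * G1 (snd x) + 2 * D2) + 2 * (norm A)\<^sup>2) = (\<lambda>x. 4 * h * G1 (snd x) + (4 * D2 + 2 * (norm A)\<^sup>2))"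
    by (simp add: fun_eq_iff)
  also have "integral Q \<dots> = 4 * h * (h * D1) + h\<^sup>2 * (4 * D2 + 2 * (norm A)\<^sup>2)"
    using Henstock_Kurzweil_Integration.integral_add[OF integrable_on_mult_right[OF ion[OF cG1']] ion[OF continuous_on_const],
        of "4 * h" "4 * D2 + 2 * (norm A)\<^sup>2"] cQ IG1 by (simp add: Q_def)
  also have "\<dots> = 2 * h\<^sup>2 * (norm A)\<^sup>2 + 4 * h\<^sup>2 * (D1 + D2)" by (simp add: power2_eq_square algebra_simps)
  also have "2 * h\<^sup>2 * (norm A)\<^sup>2 = 2 / h\<^sup>2 * (norm (integral Q f))\<^sup>2"
    using h by (simp add: A_def power_mult_distrib field_simps power2_eq_square)
  also have "D1 + D2 = integral Q (\<lambda>x. F1 x + F2 x)"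
    unfolding D1_def D2_def by (rule Henstock_Kurzweil_Integration.integral_add[symmetric]) (intro ion cF)+
  finally show ?thesis by (simp add: F1_def F2_def)
qed

lemma integral_square_split:
  fixes F :: "real \<times> real \<Rightarrow> real"
  assumes "continuous_on UNIV F" "k > 0"
  shows "integral (cbox (a, c) (a + 2 * k, c + 2 * k)) F =
    integral (cbox (a, c) (a + k, c + k)) F + integral (cbox (a + k, c) (a + k + k, c + k)) F +
    integral (cbox (a, c + k) (a + k, c + k + k)) F + integral (cbox (a + k, c + k) (a + k + k, c + k + k)) F"
proof -
  have ion: "F integrable_on cbox p q" for p q
    by (rule integrable_continuous[OF continuous_on_subset[OF assms(1)]]) simp
  have v: "integral (cbox (x, c) (y, c + 2 * k)) F = integral (cbox (x, c) (y, c + k)) F + integral (cbox (x, c + k) (y, c + k + k)) F" for x y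
  proof -
    have "cbox (x, c) (y, c + 2 * k) \<inter> {z. z \<bullet> (0, 1) \<le> c + k} = cbox (x, c) (y, c + k)"
      "cbox (x, c) (y, c + 2 * k) \<inter> {z. c + k \<le> z \<bullet> (0, 1)} = cbox (x, c + k) (y, c + k + k)"
      using assms(2) by (auto simp: cbox_Pair_eq)
    then show ?thesis using integral_split[OF ion, of "(0, 1)" "(x, c)" "(y, c + 2 * k)" "c + k"] by (simp add: Basis_plane)
  qed
  have "cbox (a, c) (a + 2 * k, c + 2 * k) \<inter> {z. z \<bullet> (1, 0) \<le> a + k} = cbox (a, c) (a + k, c + 2 * k)"
      "cbox (a, c) (a + 2 * k, c + 2 * k) \<inter> {z. a + k \<le> z \<bullet> (1, 0)} = cbox (a + k, c) (a + k + k, c + 2 * k)"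
      using assms(2) by (auto simp: cbox_Pair_eq)
  then have "integral (cbox (a, c) (a + 2 * k, c + 2 * k)) F = integral (cbox (a, c) (a + k, c + 2 * k)) F + integral (cbox (a + k, c) (a + k + k, c + 2 * k)) F"
    using integral_split[OF ion, of "(1, 0)" "(a, c)" "(a + 2 * k, c + 2 * k)" "a + k"] by (simp add: Basis_plane)
  then show ?thesis by (simp add: v)
qed


text \<open>The squared norm over \<open>Q\<close> is controlled by finitely many averages up to a gradient term that
  is small with \<open>h\<close>. The boxes form a list, so that the controls of adjacent squares can be
  combined by concatenation without any disjointness argument.\<close>

definition mean_control :: "real \<Rightarrow> (real \<times> real) set \<Rightarrow> ((real \<times> real) \<times> (real \<times> real)) list \<Rightarrow> bool" where
  "mean_control h Q S \<longleftrightarrow> (\<forall>s\<in>set S. cbox (fst s) (snd s) \<subseteq> Q) \<and>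
    (\<forall>f :: real \<times> real \<Rightarrow> complex. Ck (Suc 0) f \<longrightarrow>
      integral Q (\<lambda>x. (norm (f x))\<^sup>2) \<le>
        2 / h\<^sup>2 * (\<Sum>s\<leftarrow>S. (norm (integral (cbox (fst s) (snd s)) f))\<^sup>2) +
        4 * h\<^sup>2 * integral Q (\<lambda>x. (norm (dir_deriv (1, 0) f x))\<^sup>2 + (norm (dir_deriv (0, 1) f x))\<^sup>2))"

text \<open>Bisect both sides \<open>n\<close> times and use the Poincare inequality on each small square.\<close>

lemma dyadic_Poincare:
  fixes a c h :: real
  assumes "h > 0"
  shows "\<exists>S. mean_control (h / 2 ^ n) (cbox (a, c) (a + h, c + h)) S"
  using assms
proof (induction n arbitrary: a c h)
  case 0
  then have "mean_control h (cbox (a, c) (a + h, c + h)) [((a, c), (a + h, c + h))]"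
    unfolding mean_control_def using Poincare_square by simp
  then show ?case by auto
next
  case (Suc n)
  define k where "k = h / 2"
  have k: "k > 0" "h = 2 * k" using Suc.prems by (auto simp: k_def)
  define Q where "Q i j = cbox (a + i * k, c + j * k) (a + i * k + k, c + j * k + k)" for i j :: real
  have "\<exists>S. mean_control (k / 2 ^ n) (Q i j) S" for i j
    unfolding Q_def by (rule Suc.IH[OF k(1)])
  then obtain T where T: "\<And>i j. mean_control (k / 2 ^ n) (Q i j) (T i j)" by metis
  define S where "S = (T 0 0 @ T 1 0) @ (T 0 1 @ T 1 1)"
  let ?Q = "cbox (a, c) (a + h, c + h)"
  have split: "integral ?Q F = integral (Q 0 0) F + integral (Q 1 0) F + integral (Q 0 1) F + integral (Q 1 1) F"
    if "continuous_on UNIV F" for F :: "real \<times> real \<Rightarrow> real"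
    unfolding k(2) using integral_square_split[OF that k(1), of a c] by (simp add: Q_def)
  have sub: "Q i j \<subseteq> ?Q" if "i \<in> {0, 1}" "j \<in> {0, 1}" for i j
    using that k by (auto simp: Q_def cbox_Pair_eq)
  have "mean_control (h / 2 ^ Suc n) ?Q S"
    unfolding mean_control_def
  proof (intro conjI allI impI)
    show "\<forall>s\<in>set S. cbox (fst s) (snd s) \<subseteq> ?Q"
    proof
      fix s assume "s \<in> set S"
      then obtain i j where "i \<in> {0, 1}" "j \<in> {0, 1}" "s \<in> set (T i j)" unfolding S_def by auto
      then show "cbox (fst s) (snd s) \<subseteq> ?Q" using T[of i j] sub[of i j] unfolding mean_control_def by blast
    qed
    fix f :: "real \<times> real \<Rightarrow> complex" assume f: "Ck (Suc 0) f"
    define E where "E = 2 / (k / 2 ^ n)\<^sup>2"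
    define G where "G = 4 * (k / 2 ^ n)\<^sup>2"
    have EG: "2 / (h / 2 ^ Suc n)\<^sup>2 = E" "4 * (h / 2 ^ Suc n)\<^sup>2 = G" by (simp_all add: E_def G_def k(2))
    define g where "g x = (norm (dir_deriv (1, 0) f x))\<^sup>2 + (norm (dir_deriv (0, 1) f x))\<^sup>2" for x
    have cg: "continuous_on UNIV g" unfolding g_def
      by (intro continuous_intros Ck1_partial_derivatives[OF f])
    have cf: "continuous_on UNIV (\<lambda>x. (norm (f x))\<^sup>2)" by (intro continuous_intros Ck_continuous[OF f])
    define W where "W U = (\<Sum>s\<leftarrow>U. (norm (integral (cbox (fst s) (snd s)) f))\<^sup>2)" for U
    have WS: "W S = W (T 0 0) + W (T 1 0) + (W (T 0 1) + W (T 1 1))"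
      by (simp add: W_def S_def)
    have "integral (Q i j) (\<lambda>x. (norm (f x))\<^sup>2) \<le> E * W (T i j) + G * integral (Q i j) g" for i j
      using T[of i j] f unfolding mean_control_def E_def G_def g_def W_def by blast
    from this[of 0 0] this[of 1 0] this[of 0 1] this[of 1 1]
    have "integral ?Q (\<lambda>x. (norm (f x))\<^sup>2) \<le> E * W S + G * integral ?Q g"
      unfolding split[OF cf] split[OF cg] WS by (simp add: algebra_simps)
    then show "integral ?Q (\<lambda>x. (norm (f x))\<^sup>2) \<le>
        2 / (h / 2 ^ Suc n)\<^sup>2 * (\<Sum>s\<leftarrow>S. (norm (integral (cbox (fst s) (snd s)) f))\<^sup>2) +
        4 * (h / 2 ^ Suc n)\<^sup>2 * integral ?Q (\<lambda>x. (norm (dir_deriv (1, 0) f x))\<^sup>2 + (norm (dir_deriv (0, 1) f x))\<^sup>2)"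
      unfolding EG W_def g_def .
  qed
  then show ?case by blast
qed

lemma L2_sq_test_function:
  assumes "\<phi> \<in> test_functions \<omega>" "open \<omega>" "\<omega> \<subseteq> cbox a b"
  shows "L2_sq (lebesgue_on \<omega>) \<phi> = integral (cbox a b) (\<lambda>x. (norm (\<phi> x))\<^sup>2)"
  unfolding L2_sq_def using assms test_function_outside[OF assms(1)]
  by (intro integral_lebesgue_on_eq_cbox continuous_intros test_function_continuous) auto

lemma test_function_L2:
  fixes \<phi> :: "real \<times> real \<Rightarrow> complex"
  assumes "\<phi> \<in> test_functions \<omega>" "open \<omega>" "bounded \<omega>"
  shows "\<phi> \<in> L2 (lebesgue_on \<omega>)"
proof -
  have c: "continuous_on UNIV \<phi>" using test_function_continuous[OF assms(1)] .
  have "integrable (lebesgue_on \<omega>) \<phi>" by (rule test_function_integrable[OF assms])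
  moreover have "integrable (lebesgue_on \<omega>) (\<lambda>x. (norm (\<phi> x))\<^sup>2)"
    by (intro integrable_continuous_lebesgue_on assms continuous_intros c)
  ultimately show ?thesis by (auto simp: L2_def)
qed

text \<open>Along a diagonal subsequence the averages over all boxes of all dyadic grids converge. For a
  given accuracy, choose the grid so fine that the gradient term is negligible; then finitely
  many averages decide how close two members of the subsequence are.\<close>

lemma Rellich_test_functions:
  fixes \<omega> :: "(real \<times> real) set"
  assumes \<omega>: "open \<omega>" "bounded \<omega>" and \<phi>: "\<And>n. \<phi> n \<in> test_functions \<omega>"
    and K: "\<And>n. L2_sq (lebesgue_on \<omega>) (\<phi> n) \<le> K"
    and K1: "\<And>n b. b \<in> Basis \<Longrightarrow> L2_sq (lebesgue_on \<omega>) (dir_deriv b (\<phi> n)) \<le> K"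
  obtains r :: "nat \<Rightarrow> nat" where "strict_mono r" "L2_Cauchy (lebesgue_on \<omega>) (\<lambda>n. \<phi> (r n))"
proof -
  let ?M = "lebesgue_on \<omega>"
  obtain R :: real where R: "R > 0" "\<And>x. x \<in> \<omega> \<Longrightarrow> norm x \<le> R"
    using \<omega>(2) unfolding bounded_pos by blast
  define h where "h = 2 * R"
  have h: "h > 0" using R by (simp add: h_def)
  let ?Q = "cbox (- R, - R) (- R + h, - R + h)"
  have sub: "\<omega> \<subseteq> ?Q"
  proof
    fix x assume "x \<in> \<omega>"
    then have "norm (fst x) \<le> R" "norm (snd x) \<le> R" using R(2)[of x] norm_fst_le[of "fst x" "snd x"] norm_snd_le[of "snd x" "fst x"] by auto
    then show "x \<in> ?Q" by (cases x) (auto simp: cbox_Pair_eq h_def)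
  qed
  have "\<exists>S. mean_control (h / 2 ^ n) ?Q S" for n :: nat
    by (rule dyadic_Poincare[OF h])
  then obtain S where S: "\<And>n. mean_control (h / 2 ^ n) ?Q (S n)" by metis
  define F where "F n s = integral (cbox (fst s) (snd s)) (\<phi> n)" for n s
  have c\<phi>: "continuous_on X (\<phi> n)" for X n
    using test_function_continuous[OF \<phi>] continuous_on_subset by blast
  have ion: "\<phi> n integrable_on cbox p q" for n p q by (intro integrable_continuous c\<phi>)
  have F: "norm (F n s) \<le> sqrt (measure lborel ?Q * K)" if mem: "s \<in> (\<Union>n. set (S n))" for n s
  proof -
    obtain k where "s \<in> set (S k)" using mem by blast
    then have s: "cbox (fst s) (snd s) \<subseteq> ?Q" using S[of k] unfolding mean_control_def by blast
    have i: "(\<lambda>x. (norm (\<phi> n x))\<^sup>2) integrable_on cbox p q" for p q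
      by (intro integrable_continuous continuous_intros c\<phi>)
    have "(norm (F n s))\<^sup>2 \<le> measure lborel (cbox (fst s) (snd s)) * integral (cbox (fst s) (snd s)) (\<lambda>x. (norm (\<phi> n x))\<^sup>2)"
      unfolding F_def by (simp add: integral_cbox_Cauchy_Schwarz c\<phi>)
    also have "\<dots> \<le> measure lborel ?Q * integral ?Q (\<lambda>x. (norm (\<phi> n x))\<^sup>2)"
      using s by (intro mult_mono integral_subset_le i content_subset Henstock_Kurzweil_Integration.integral_nonneg) auto
    also have "integral ?Q (\<lambda>x. (norm (\<phi> n x))\<^sup>2) = L2_sq ?M (\<phi> n)"
      by (rule L2_sq_test_function[OF \<phi> \<omega>(1) sub, symmetric])
    also have "measure lborel ?Q * L2_sq ?M (\<phi> n) \<le> measure lborel ?Q * K"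
      by (intro mult_left_mono K) simp
    finally show ?thesis by (rule real_le_rsqrt)
  qed
  have cnt: "countable (\<Union>n. set (S n))" by (auto intro: countable_finite)
  obtain r :: "nat \<Rightarrow> nat" where r: "strict_mono r" "\<And>s. s \<in> (\<Union>n. set (S n)) \<Longrightarrow> \<exists>l. (\<lambda>n. F (r n) s) \<longlonglongrightarrow> l"
  proof (rule function_convergent_subsequence[of _ F, OF cnt F])
    fix k :: "nat \<Rightarrow> nat"
    assume "strict_mono k" "\<And>s. s \<in> (\<Union>n. set (S n)) \<Longrightarrow> \<exists>l. (\<lambda>n. F (k n) s) \<longlonglongrightarrow> l"
    then show thesis by (rule that)
  qed
  have K0: "K \<ge> 0" using K[of 0] L2_sq_nonneg order_trans by blast
  define \<delta> where "\<delta> m n x = \<phi> (r m) x - \<phi> (r n) x" for m n x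
  have \<delta>: "\<delta> m n \<in> test_functions \<omega>" for m n
    using test_functions_lincomb[OF \<phi> \<phi>, of "r m" "-1" "r n"] by (simp add: \<delta>_def[abs_def])
  \<comment> \<open>A difference has gradient energy at most \<open>4 K\<close> in each of the two directions, hence the factor \<open>32 = 4 * 8\<close>.\<close>
  have bound: "L2_sq ?M (\<delta> m n) \<le> 2 / (h / 2 ^ k)\<^sup>2 * (\<Sum>s\<leftarrow>S k. (norm (F (r m) s - F (r n) s))\<^sup>2) + 32 * K * (h / 2 ^ k)\<^sup>2" for m n k
  proof -
    have g: "L2_sq ?M (dir_deriv b (\<delta> m n)) \<le> 4 * K" if b: "b \<in> Basis" for b
    proof -
      have "dir_deriv b (\<delta> m n) x = dir_deriv b (\<phi> (r m)) x - dir_deriv b (\<phi> (r n)) x" for x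
        using dir_deriv_lincomb[OF \<phi> \<phi>, of b "r m" "-1" "r n" x] by (simp add: \<delta>_def[abs_def])
      then have "L2_sq ?M (dir_deriv b (\<delta> m n)) = L2_sq ?M (\<lambda>x. dir_deriv b (\<phi> (r m)) x - dir_deriv b (\<phi> (r n)) x)"
        by presburger
      also have "\<dots> \<le> 2 * L2_sq ?M (\<lambda>x. dir_deriv b (\<phi> (r m)) x) + 2 * L2_sq ?M (\<lambda>x. - dir_deriv b (\<phi> (r n)) x)"
        unfolding diff_conv_add_uminus using b
        by (intro L2_add(2)) (auto intro!: test_function_L2[OF test_functions_dir_deriv] \<phi> \<omega> L2_cmult[of _ _ "-1", simplified])
      also have "\<dots> \<le> 4 * K" using K1[OF b, of "r m"] K1[OF b, of "r n"] by (simp add: L2_sq_def)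
      finally show ?thesis .
    qed
    have C: "Ck (Suc 0) (\<delta> m n)" by (rule test_functionsD(2)[OF \<delta>])
    have ig: "(\<lambda>x. (norm (dir_deriv b (\<delta> m n) x))\<^sup>2) integrable_on ?Q" if "b \<in> Basis" for b
      by (intro integrable_continuous continuous_intros continuous_on_subset[OF test_function_continuous[OF test_functions_dir_deriv[OF \<delta> that]]]) simp
    have grad: "integral ?Q (\<lambda>x. (norm (dir_deriv (1, 0) (\<delta> m n) x))\<^sup>2 + (norm (dir_deriv (0, 1) (\<delta> m n) x))\<^sup>2) \<le> 8 * K"
    proof -
      have "integral ?Q (\<lambda>x. (norm (dir_deriv (1, 0) (\<delta> m n) x))\<^sup>2 + (norm (dir_deriv (0, 1) (\<delta> m n) x))\<^sup>2) =
        L2_sq ?M (dir_deriv (1, 0) (\<delta> m n)) + L2_sq ?M (dir_deriv (0, 1) (\<delta> m n))"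
        using Henstock_Kurzweil_Integration.integral_add[OF ig ig, of "(1, 0)" "(0, 1)"]
          L2_sq_test_function[OF test_functions_dir_deriv[OF \<delta>] \<omega>(1) sub]
        by (simp add: Basis_plane)
      then show ?thesis using g[of "(1, 0)"] g[of "(0, 1)"] by (simp add: Basis_plane)
    qed
    have diff: "integral (cbox (fst s) (snd s)) (\<delta> m n) = F (r m) s - F (r n) s" for s
      unfolding F_def \<delta>_def by (simp add: Henstock_Kurzweil_Integration.integral_diff ion)
    have "L2_sq ?M (\<delta> m n) = integral ?Q (\<lambda>x. (norm (\<delta> m n x))\<^sup>2)"
      by (rule L2_sq_test_function[OF \<delta> \<omega>(1) sub])
    also have "\<dots> \<le> 2 / (h / 2 ^ k)\<^sup>2 * (\<Sum>s\<leftarrow>S k. (norm (integral (cbox (fst s) (snd s)) (\<delta> m n)))\<^sup>2) + 4 * (h / 2 ^ k)\<^sup>2 * (8 * K)"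
    proof -
      have "integral ?Q (\<lambda>x. (norm (\<delta> m n x))\<^sup>2) \<le>
        2 / (h / 2 ^ k)\<^sup>2 * (\<Sum>s\<leftarrow>S k. (norm (integral (cbox (fst s) (snd s)) (\<delta> m n)))\<^sup>2) +
        4 * (h / 2 ^ k)\<^sup>2 * integral ?Q (\<lambda>x. (norm (dir_deriv (1, 0) (\<delta> m n) x))\<^sup>2 + (norm (dir_deriv (0, 1) (\<delta> m n) x))\<^sup>2)"
        using S[of k] C unfolding mean_control_def by blast
      also have "\<dots> \<le> 2 / (h / 2 ^ k)\<^sup>2 * (\<Sum>s\<leftarrow>S k. (norm (integral (cbox (fst s) (snd s)) (\<delta> m n)))\<^sup>2) + 4 * (h / 2 ^ k)\<^sup>2 * (8 * K)"
        by (intro add_left_mono mult_left_mono grad) simp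
      finally show ?thesis .
    qed
    also have "\<dots> = 2 / (h / 2 ^ k)\<^sup>2 * (\<Sum>s\<leftarrow>S k. (norm (F (r m) s - F (r n) s))\<^sup>2) + 32 * K * (h / 2 ^ k)\<^sup>2"
      unfolding diff by simp
    finally show ?thesis .
  qed
  have "((\<lambda>(m, n). L2_sq ?M (\<delta> m n)) \<longlongrightarrow> 0) (sequentially \<times>\<^sub>F sequentially)"
  proof (rule order_tendstoI)
    fix e :: real assume "e < 0"
    then show "\<forall>\<^sub>F z in sequentially \<times>\<^sub>F sequentially. e < (\<lambda>(m, n). L2_sq ?M (\<delta> m n)) z"
      by (intro always_eventually) (auto intro: less_le_trans L2_sq_nonneg)
  next
    fix e :: real assume e: "e > 0"
    have "(\<lambda>k. 32 * K * (h * (1/2) ^ k)\<^sup>2) \<longlonglongrightarrow> 32 * K * (h * 0)\<^sup>2"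
      by (intro tendsto_intros LIMSEQ_realpow_zero) auto
    then have "\<forall>\<^sub>F k in sequentially. 32 * K * (h * (1/2) ^ k)\<^sup>2 < e"
      using e by (intro order_tendstoD(2)) simp_all
    then obtain k where "32 * K * (h * (1/2) ^ k)\<^sup>2 < e"
      unfolding eventually_sequentially by blast
    then have k: "32 * K * (h / 2 ^ k)\<^sup>2 < e" by (simp add: power_one_over)
    have lim: "((\<lambda>z. F (r (fst z)) s - F (r (snd z)) s) \<longlongrightarrow> 0) (sequentially \<times>\<^sub>F sequentially)" if s: "s \<in> set (S k)" for s
    proof -
      obtain l where l: "(\<lambda>n. F (r n) s) \<longlonglongrightarrow> l" using r(2)[of s] s by blast
      have "((\<lambda>z. F (r (fst z)) s - F (r (snd z)) s) \<longlongrightarrow> l - l) (sequentially \<times>\<^sub>F sequentially)"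
        by (intro tendsto_diff filterlim_compose[OF l] filterlim_fst filterlim_snd)
      then show ?thesis by simp
    qed
    have sl: "((\<lambda>z. \<Sum>s\<leftarrow>T. (norm (F (r (fst z)) s - F (r (snd z)) s))\<^sup>2) \<longlongrightarrow> 0) (sequentially \<times>\<^sub>F sequentially)"
      if "set T \<subseteq> set (S k)" for T
      using that
    proof (induction T)
      case (Cons s T)
      have "((\<lambda>z. (norm (F (r (fst z)) s - F (r (snd z)) s))\<^sup>2 + (\<Sum>s\<leftarrow>T. (norm (F (r (fst z)) s - F (r (snd z)) s))\<^sup>2))
         \<longlongrightarrow> (norm (0::complex))\<^sup>2 + 0) (sequentially \<times>\<^sub>F sequentially)"
        by (intro tendsto_add tendsto_power tendsto_norm lim Cons.IH) (use Cons.prems in auto)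
      then show ?case by simp
    qed simp
    have "((\<lambda>z. 2 / (h / 2 ^ k)\<^sup>2 * (\<Sum>s\<leftarrow>S k. (norm (F (r (fst z)) s - F (r (snd z)) s))\<^sup>2) + 32 * K * (h / 2 ^ k)\<^sup>2)
       \<longlongrightarrow> 2 / (h / 2 ^ k)\<^sup>2 * 0 + 32 * K * (h / 2 ^ k)\<^sup>2) (sequentially \<times>\<^sub>F sequentially)"
      by (intro tendsto_intros sl) simp
    from order_tendstoD(2)[OF this, of e] k
    have "\<forall>\<^sub>F z in sequentially \<times>\<^sub>F sequentially. 2 / (h / 2 ^ k)\<^sup>2 * (\<Sum>s\<leftarrow>S k. (norm (F (r (fst z)) s - F (r (snd z)) s))\<^sup>2) + 32 * K * (h / 2 ^ k)\<^sup>2 < e"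
      by simp
    then show "\<forall>\<^sub>F z in sequentially \<times>\<^sub>F sequentially. (\<lambda>(m, n). L2_sq ?M (\<delta> m n)) z < e"
      by eventually_elim (use bound in \<open>auto simp: split_def intro: le_less_trans\<close>)
  qed
  then have "L2_Cauchy ?M (\<lambda>n. \<phi> (r n))" unfolding L2_Cauchy_def \<delta>_def .
  with r(1) show ?thesis by (rule that)
qed

section \<open>Weak derivatives and the form domain\<close>

locale bounded_open_set =
  fixes \<omega> :: "(real \<times> real) set"
  assumes open_\<omega>: "open \<omega>" and bounded_\<omega>: "bounded \<omega>"
begin

abbreviation "M \<equiv> lebesgue_on \<omega>"

sublocale finite_measure M
  using open_\<omega> bounded_\<omega> by (intro finite_measure_lebesgue_on lmeasurable_open)

lemma test_L2: "\<phi> \<in> test_functions \<omega> \<Longrightarrow> \<phi> \<in> L2 M"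
  by (rule test_function_L2[OF _ open_\<omega> bounded_\<omega>])

lemma test_dir_deriv_L2: "\<phi> \<in> test_functions \<omega> \<Longrightarrow> b \<in> Basis \<Longrightarrow> dir_deriv b \<phi> \<in> L2 M"
  by (intro test_L2 test_functions_dir_deriv)

lemma is_weak_deriv_test:
  "\<phi> \<in> test_functions \<omega> \<Longrightarrow> b \<in> Basis \<Longrightarrow> is_weak_deriv \<omega> b \<phi> (dir_deriv b \<phi>)"
  unfolding is_weak_deriv_def
  by (intro conjI ballI test_L2 test_functions_dir_deriv integration_by_parts_test_functions open_\<omega> bounded_\<omega>)

lemma is_weak_deriv_L2: "is_weak_deriv \<omega> b u g \<Longrightarrow> u \<in> L2 M" "is_weak_deriv \<omega> b u g \<Longrightarrow> g \<in> L2 M"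
  by (auto simp: is_weak_deriv_def)

lemma is_weak_deriv_lincomb:
  assumes u: "is_weak_deriv \<omega> b u g" and v: "is_weak_deriv \<omega> b v h" and b: "b \<in> Basis"
  shows "is_weak_deriv \<omega> b (\<lambda>x. u x + c * v x) (\<lambda>x. g x + c * h x)"
  unfolding is_weak_deriv_def
proof (intro conjI ballI)
  show "(\<lambda>x. u x + c * v x) \<in> L2 M" "(\<lambda>x. g x + c * h x) \<in> L2 M"
    by (intro L2_lincomb is_weak_deriv_L2[OF u] is_weak_deriv_L2[OF v])+
  fix \<phi> assume \<phi>: "\<phi> \<in> test_functions \<omega>"
  have i: "integrable M (\<lambda>x. w x * \<phi> x)" "integrable M (\<lambda>x. w x * dir_deriv b \<phi> x)" if "w \<in> L2 M" for w
    by (intro L2_mult_integrable that test_L2 test_functions_dir_deriv \<phi> b)+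
  note L = is_weak_deriv_L2[OF u] is_weak_deriv_L2[OF v]
  have "(\<integral>x. (u x + c * v x) * dir_deriv b \<phi> x \<partial>M) = (\<integral>x. u x * dir_deriv b \<phi> x + c * (v x * dir_deriv b \<phi> x) \<partial>M)"
    by (simp add: algebra_simps)
  also have "\<dots> = (\<integral>x. u x * dir_deriv b \<phi> x \<partial>M) + c * (\<integral>x. v x * dir_deriv b \<phi> x \<partial>M)"
    using i L by simp
  also have "\<dots> = - ((\<integral>x. g x * \<phi> x \<partial>M) + c * (\<integral>x. h x * \<phi> x \<partial>M))"
    using u v \<phi> by (simp add: is_weak_deriv_def)
  also have "(\<integral>x. g x * \<phi> x \<partial>M) + c * (\<integral>x. h x * \<phi> x \<partial>M) = (\<integral>x. g x * \<phi> x + c * (h x * \<phi> x) \<partial>M)"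
    using i L by simp
  also have "\<dots> = (\<integral>x. (g x + c * h x) * \<phi> x \<partial>M)" by (simp add: algebra_simps)
  finally show "(\<integral>x. (u x + c * v x) * dir_deriv b \<phi> x \<partial>M) = - (\<integral>x. (g x + c * h x) * \<phi> x \<partial>M)" .
qed

text \<open>The difference of two weak derivatives is a weak derivative of zero and falls under the
  fundamental lemma.\<close>

lemma is_weak_deriv_unique:
  assumes g: "is_weak_deriv \<omega> b u g" and h: "is_weak_deriv \<omega> b u h" and b: "b \<in> Basis"
  shows "AE x in M. g x = h x"
proof -
  have d: "is_weak_deriv \<omega> b (\<lambda>x. u x + (-1) * u x) (\<lambda>x. g x + (-1) * h x)"
    by (rule is_weak_deriv_lincomb[OF g h b])
  have "AE x in M. g x + (-1) * h x = 0"
  proof (rule AE_zero_of_test_functions[OF open_\<omega> bounded_\<omega>])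
    have one: "(\<lambda>_. 1) \<in> L2 M" by (simp add: L2_def)
    show "integrable M (\<lambda>x. g x + (-1) * h x)"
      using L2_mult_integrable[OF is_weak_deriv_L2(2)[OF d] one] by simp
    show "(\<integral>x. (g x + (-1) * h x) * \<phi> x \<partial>M) = 0" if "\<phi> \<in> test_functions \<omega>" for \<phi>
      using d that unfolding is_weak_deriv_def by simp
  qed
  then show ?thesis by eventually_elim simp
qed

lemma weak_deriv_is_weak_deriv:
  "u \<in> H1 \<omega> \<Longrightarrow> b \<in> Basis \<Longrightarrow> is_weak_deriv \<omega> b u (weak_deriv \<omega> b u)"
proof -
  assume "u \<in> H1 \<omega>" "b \<in> Basis"
  then have "\<exists>g. is_weak_deriv \<omega> b u g" unfolding H1_def by blast
  then show ?thesis unfolding weak_deriv_def by (rule someI_ex)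
qed

lemma weak_deriv_AE_eq:
  assumes "is_weak_deriv \<omega> b u g" "b \<in> Basis"
  shows "AE x in M. weak_deriv \<omega> b u x = g x"
  by (rule is_weak_deriv_unique[OF _ assms]) (unfold weak_deriv_def, rule someI[of _ g], rule assms(1))

lemma L2_sq_weak_deriv:
  assumes "is_weak_deriv \<omega> b u g" "b \<in> Basis"
  shows "L2_sq M (weak_deriv \<omega> b u) = L2_sq M g"
proof (rule L2_sq_cong_AE[OF _ _ weak_deriv_AE_eq[OF assms]])
  show "g \<in> L2 M" by (rule is_weak_deriv_L2(2)[OF assms(1)])
  have "is_weak_deriv \<omega> b u (weak_deriv \<omega> b u)" unfolding weak_deriv_def by (rule someI[of _ g], rule assms(1))
  then show "weak_deriv \<omega> b u \<in> L2 M" by (rule is_weak_deriv_L2(2))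
qed

text \<open>The defining identity passes to the limit because both of its sides are \<open>L\<^sup>2\<close> inner products with a
  fixed function.\<close>

lemma is_weak_deriv_limit:
  assumes w: "\<And>n. is_weak_deriv \<omega> b (u n) (g n)" and b: "b \<in> Basis"
    and u': "u' \<in> L2 M" "(\<lambda>n. L2_sq M (\<lambda>x. u n x - u' x)) \<longlonglongrightarrow> 0"
    and g': "g' \<in> L2 M" "(\<lambda>n. L2_sq M (\<lambda>x. g n x - g' x)) \<longlonglongrightarrow> 0"
  shows "is_weak_deriv \<omega> b u' g'"
  unfolding is_weak_deriv_def
proof (intro conjI ballI)
  fix \<phi> assume \<phi>: "\<phi> \<in> test_functions \<omega>"
  have eq: "L2_inner M f (\<lambda>x. cnj (\<psi> x)) = (\<integral>x. f x * \<psi> x \<partial>M)" for f \<psi>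
    by (simp add: L2_inner_def)
  have "(\<lambda>n. L2_inner M (u n) (\<lambda>x. cnj (dir_deriv b \<phi> x))) \<longlonglongrightarrow> L2_inner M u' (\<lambda>x. cnj (dir_deriv b \<phi> x))"
    by (intro L2_inner_tendsto u' L2_cnj test_dir_deriv_L2 \<phi> b is_weak_deriv_L2(1)[OF w])
  moreover have "(\<lambda>n. - L2_inner M (g n) (\<lambda>x. cnj (\<phi> x))) \<longlonglongrightarrow> - L2_inner M g' (\<lambda>x. cnj (\<phi> x))"
    by (intro tendsto_minus L2_inner_tendsto g' L2_cnj test_L2 \<phi> is_weak_deriv_L2(2)[OF w])
  moreover have "L2_inner M (u n) (\<lambda>x. cnj (dir_deriv b \<phi> x)) = - L2_inner M (g n) (\<lambda>x. cnj (\<phi> x))" for n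
    unfolding eq using w \<phi> by (simp add: is_weak_deriv_def)
  ultimately have "L2_inner M u' (\<lambda>x. cnj (dir_deriv b \<phi> x)) = - L2_inner M g' (\<lambda>x. cnj (\<phi> x))"
    using LIMSEQ_unique by simp
  then show "(\<integral>x. u' x * dir_deriv b \<phi> x \<partial>M) = - (\<integral>x. g' x * \<phi> x \<partial>M)" unfolding eq .
qed (rule u' g')+

lemma H1_norm_eq:
  "H1_norm \<omega> u = sqrt (L2_sq M u + (\<Sum>b\<in>Basis. L2_sq M (weak_deriv \<omega> b u)))"
  by (simp add: H1_norm_def L2_sq_def)

text \<open>Together with the converse \<open>H10_limit\<close>, this replaces the Sobolev norm by separate \<open>L\<^sup>2\<close>
  convergence of the functions and of their partial derivatives.\<close>

lemma H10_approx:
  assumes u: "u \<in> H10 \<omega>"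
  shows "\<exists>\<phi>. (\<forall>n. \<phi> n \<in> test_functions \<omega>) \<and> (\<lambda>n. L2_sq M (\<lambda>x. \<phi> n x - u x)) \<longlonglongrightarrow> 0 \<and>
    (\<forall>b\<in>Basis. (\<lambda>n. L2_sq M (\<lambda>x. dir_deriv b (\<phi> n) x - weak_deriv \<omega> b u x)) \<longlonglongrightarrow> 0)"
proof -
  have uH1: "u \<in> H1 \<omega>" using u by (simp add: H10_def)
  obtain \<phi> where \<phi>: "\<And>n. \<phi> n \<in> test_functions \<omega>" "(\<lambda>n. H1_norm \<omega> (\<lambda>x. u x - \<phi> n x)) \<longlonglongrightarrow> 0"
    using u unfolding H10_def by blast
  define S where "S n = L2_sq M (\<lambda>x. u x - \<phi> n x) + (\<Sum>b\<in>Basis. L2_sq M (weak_deriv \<omega> b (\<lambda>x. u x - \<phi> n x)))" for n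
  have S0: "0 \<le> S n" for n unfolding S_def by (intro add_nonneg_nonneg sum_nonneg L2_sq_nonneg)
  have "(\<lambda>n. (H1_norm \<omega> (\<lambda>x. u x - \<phi> n x))\<^sup>2) \<longlonglongrightarrow> 0\<^sup>2" by (intro tendsto_power \<phi>)
  then have S: "S \<longlonglongrightarrow> 0" using S0 by (simp add: H1_norm_eq flip: S_def)
  have dom: "f \<longlonglongrightarrow> 0" if "\<And>n. 0 \<le> f n" "\<And>n. f n \<le> S n" for f
    by (rule tendsto_sandwich[OF _ _ tendsto_const S]) (use that in auto)
  show ?thesis
  proof (intro exI[of _ \<phi>] conjI allI ballI \<phi>(1))
    show "(\<lambda>n. L2_sq M (\<lambda>x. \<phi> n x - u x)) \<longlonglongrightarrow> 0"
      unfolding L2_sq_minus_commute[of _ _ u]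
      by (rule dom) (auto simp: S_def L2_sq_nonneg intro!: sum_nonneg)
    fix b :: "real \<times> real" assume b: "b \<in> Basis"
    have w: "is_weak_deriv \<omega> b (\<lambda>x. u x + (-1) * \<phi> n x) (\<lambda>x. weak_deriv \<omega> b u x + (-1) * dir_deriv b (\<phi> n) x)" for n
      by (intro is_weak_deriv_lincomb weak_deriv_is_weak_deriv is_weak_deriv_test uH1 \<phi> b)
    have e: "L2_sq M (\<lambda>x. dir_deriv b (\<phi> n) x - weak_deriv \<omega> b u x) = L2_sq M (weak_deriv \<omega> b (\<lambda>x. u x - \<phi> n x))" for n
      using L2_sq_weak_deriv[OF w b, of n] L2_sq_minus_commute[of M "dir_deriv b (\<phi> n)"] by simp
    show "(\<lambda>n. L2_sq M (\<lambda>x. dir_deriv b (\<phi> n) x - weak_deriv \<omega> b u x)) \<longlonglongrightarrow> 0"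
    proof (rule dom)
      fix n
      have "L2_sq M (weak_deriv \<omega> b (\<lambda>x. u x - \<phi> n x)) \<le> (\<Sum>b\<in>Basis. L2_sq M (weak_deriv \<omega> b (\<lambda>x. u x - \<phi> n x)))"
        by (rule member_le_sum[OF b]) (auto simp: L2_sq_nonneg)
      then show "L2_sq M (\<lambda>x. dir_deriv b (\<phi> n) x - weak_deriv \<omega> b u x) \<le> S n"
        unfolding e S_def using L2_sq_nonneg[of M "\<lambda>x. u x - \<phi> n x"] by linarith
    qed (rule L2_sq_nonneg)
  qed
qed

lemma H10_limit:
  assumes \<phi>: "\<And>n. \<phi> n \<in> test_functions \<omega>"
    and u: "u \<in> L2 M" "(\<lambda>n. L2_sq M (\<lambda>x. \<phi> n x - u x)) \<longlonglongrightarrow> 0"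
    and g: "\<And>b. b \<in> Basis \<Longrightarrow> g b \<in> L2 M"
      "\<And>b. b \<in> Basis \<Longrightarrow> (\<lambda>n. L2_sq M (\<lambda>x. dir_deriv b (\<phi> n) x - g b x)) \<longlonglongrightarrow> 0"
  shows "u \<in> H10 \<omega>" "\<And>b. b \<in> Basis \<Longrightarrow> is_weak_deriv \<omega> b u (g b)"
proof -
  show w: "is_weak_deriv \<omega> b u (g b)" if b: "b \<in> Basis" for b
    by (rule is_weak_deriv_limit[OF is_weak_deriv_test[OF \<phi> b] b u g[OF b]])
  have "(\<lambda>n. H1_norm \<omega> (\<lambda>x. u x - \<phi> n x)) \<longlonglongrightarrow> 0"
  proof -
    have e: "L2_sq M (weak_deriv \<omega> b (\<lambda>x. u x - \<phi> n x)) = L2_sq M (\<lambda>x. dir_deriv b (\<phi> n) x - g b x)" if b: "b \<in> Basis" for b n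
      using L2_sq_weak_deriv[OF is_weak_deriv_lincomb[OF w[OF b] is_weak_deriv_test[OF \<phi> b] b] b, of "-1" n]
        L2_sq_minus_commute[of M "dir_deriv b (\<phi> n)"] by simp
    have "(\<lambda>n. sqrt (L2_sq M (\<lambda>x. \<phi> n x - u x) + (\<Sum>b\<in>Basis. L2_sq M (\<lambda>x. dir_deriv b (\<phi> n) x - g b x))))
       \<longlonglongrightarrow> sqrt (0 + (\<Sum>b\<in>(Basis :: (real \<times> real) set). 0))"
      by (intro tendsto_intros u g)
    then show ?thesis by (simp add: H1_norm_eq e L2_sq_minus_commute[of M u])
  qed
  moreover have "u \<in> H1 \<omega>" unfolding H1_def using u(1) w by blast
  ultimately show "u \<in> H10 \<omega>" unfolding H10_def using \<phi> by blast
qed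

lemma test_H10:
  assumes "\<phi> \<in> test_functions \<omega>"
  shows "\<phi> \<in> H10 \<omega>"
  by (rule H10_limit(1)[where \<phi> = "\<lambda>_. \<phi>" and g = "\<lambda>b. dir_deriv b \<phi>"])
    (simp_all add: assms test_L2 test_dir_deriv_L2 L2_sq_def)

lemma H10_weak_deriv:
  "u \<in> H10 \<omega> \<Longrightarrow> b \<in> Basis \<Longrightarrow> is_weak_deriv \<omega> b u (weak_deriv \<omega> b u)"
  by (rule weak_deriv_is_weak_deriv) (auto simp: H10_def)

lemma H10_L2: "u \<in> H10 \<omega> \<Longrightarrow> u \<in> L2 M"
  by (simp add: H10_def H1_def)

lemma L2_sq_lincomb_tendsto:
  assumes "\<And>n. f n \<in> L2 M" "f' \<in> L2 M" "(\<lambda>n. L2_sq M (\<lambda>x. f n x - f' x)) \<longlonglongrightarrow> 0"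
    and "\<And>n. g n \<in> L2 M" "g' \<in> L2 M" "(\<lambda>n. L2_sq M (\<lambda>x. g n x - g' x)) \<longlonglongrightarrow> 0"
  shows "(\<lambda>n. L2_sq M (\<lambda>x. (f n x + c * g n x) - (f' x + c * g' x))) \<longlonglongrightarrow> 0"
proof (rule tendsto_sandwich[OF _ _ tendsto_const])
  have "L2_sq M (\<lambda>x. (f n x + c * g n x) - (f' x + c * g' x)) \<le>
     2 * L2_sq M (\<lambda>x. f n x - f' x) + 2 * ((norm c)\<^sup>2 * L2_sq M (\<lambda>x. g n x - g' x))" for n
  proof -
    have "L2_sq M (\<lambda>x. (f n x + c * g n x) - (f' x + c * g' x)) = L2_sq M (\<lambda>x. (f n x - f' x) + c * (g n x - g' x))"
      by (simp add: algebra_simps)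
    also have "\<dots> \<le> 2 * L2_sq M (\<lambda>x. f n x - f' x) + 2 * L2_sq M (\<lambda>x. c * (g n x - g' x))"
      by (intro L2_add(2) L2_diff L2_cmult assms)
    also have "L2_sq M (\<lambda>x. c * (g n x - g' x)) = (norm c)\<^sup>2 * L2_sq M (\<lambda>x. g n x - g' x)"
      by (rule L2_sq_cmult)
    finally show ?thesis .
  qed
  then show "\<forall>\<^sub>F n in sequentially. L2_sq M (\<lambda>x. (f n x + c * g n x) - (f' x + c * g' x)) \<le>
     2 * L2_sq M (\<lambda>x. f n x - f' x) + 2 * ((norm c)\<^sup>2 * L2_sq M (\<lambda>x. g n x - g' x))" by simp
  have "(\<lambda>n. 2 * L2_sq M (\<lambda>x. f n x - f' x) + 2 * ((norm c)\<^sup>2 * L2_sq M (\<lambda>x. g n x - g' x))) \<longlonglongrightarrow> 2 * 0 + 2 * ((norm c)\<^sup>2 * 0)"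
    by (intro tendsto_intros assms)
  then show "(\<lambda>n. 2 * L2_sq M (\<lambda>x. f n x - f' x) + 2 * ((norm c)\<^sup>2 * L2_sq M (\<lambda>x. g n x - g' x))) \<longlonglongrightarrow> 0" by simp
qed (simp add: L2_sq_nonneg)

text \<open>Linear combinations of approximating sequences approximate the linear combination.\<close>

lemma H10_lincomb:
  assumes u: "u \<in> H10 \<omega>" and v: "v \<in> H10 \<omega>"
  shows "(\<lambda>x. u x + c * v x) \<in> H10 \<omega>"
proof -
  obtain \<phi> where \<phi>: "\<forall>n. \<phi> n \<in> test_functions \<omega>" "(\<lambda>n. L2_sq M (\<lambda>x. \<phi> n x - u x)) \<longlonglongrightarrow> 0"
    "\<forall>b\<in>Basis. (\<lambda>n. L2_sq M (\<lambda>x. dir_deriv b (\<phi> n) x - weak_deriv \<omega> b u x)) \<longlonglongrightarrow> 0"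
    using H10_approx[OF u] by (elim exE conjE)
  note \<phi> = \<phi>(1)[rule_format] \<phi>(2) \<phi>(3)[rule_format]
  obtain \<psi> where \<psi>: "\<forall>n. \<psi> n \<in> test_functions \<omega>" "(\<lambda>n. L2_sq M (\<lambda>x. \<psi> n x - v x)) \<longlonglongrightarrow> 0"
    "\<forall>b\<in>Basis. (\<lambda>n. L2_sq M (\<lambda>x. dir_deriv b (\<psi> n) x - weak_deriv \<omega> b v x)) \<longlonglongrightarrow> 0"
    using H10_approx[OF v] by (elim exE conjE)
  note \<psi> = \<psi>(1)[rule_format] \<psi>(2) \<psi>(3)[rule_format]
  show ?thesis
  proof (rule H10_limit(1)[where \<phi> = "\<lambda>n x. \<phi> n x + c * \<psi> n x" and g = "\<lambda>b x. weak_deriv \<omega> b u x + c * weak_deriv \<omega> b v x"])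
    show "(\<lambda>x. \<phi> n x + c * \<psi> n x) \<in> test_functions \<omega>" for n by (intro test_functions_lincomb \<phi> \<psi>)
    show "(\<lambda>x. u x + c * v x) \<in> L2 M" by (intro L2_lincomb H10_L2 u v)
    show "(\<lambda>n. L2_sq M (\<lambda>x. \<phi> n x + c * \<psi> n x - (u x + c * v x))) \<longlonglongrightarrow> 0"
      by (intro L2_sq_lincomb_tendsto \<phi> \<psi> test_L2 H10_L2 u v)
    fix b :: "real \<times> real" assume b: "b \<in> Basis"
    note W = is_weak_deriv_L2(2)[OF H10_weak_deriv[OF u b]] is_weak_deriv_L2(2)[OF H10_weak_deriv[OF v b]]
    show "(\<lambda>x. weak_deriv \<omega> b u x + c * weak_deriv \<omega> b v x) \<in> L2 M" by (intro L2_lincomb W)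
    show "(\<lambda>n. L2_sq M (\<lambda>x. dir_deriv b (\<lambda>x. \<phi> n x + c * \<psi> n x) x - (weak_deriv \<omega> b u x + c * weak_deriv \<omega> b v x))) \<longlonglongrightarrow> 0"
      unfolding dir_deriv_lincomb[OF \<phi>(1) \<psi>(1)]
      by (intro L2_sq_lincomb_tendsto \<phi> \<psi> test_dir_deriv_L2 W b)
  qed
qed

end

section \<open>The quadratic form\<close>

text \<open>The term \<open>i \<beta> \<partial>\<^sub>\<phi> u - p u\<close> of the form, with the partial derivatives of \<open>u\<close> as separate arguments: it is
  then linear in all three functions and independent of the choice of representatives.\<close>

definition twisted :: "real \<Rightarrow> real \<Rightarrow> (real \<times> real \<Rightarrow> complex) \<Rightarrow> (real \<times> real \<Rightarrow> complex) \<Rightarrow>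
    (real \<times> real \<Rightarrow> complex) \<Rightarrow> real \<times> real \<Rightarrow> complex" where
  "twisted p \<beta> u g1 g2 x = \<i> * complex_of_real \<beta> *
     (complex_of_real (fst x) * g2 x - complex_of_real (snd x) * g1 x) - complex_of_real p * u x"

lemma twisted_lincomb:
  "twisted p \<beta> (\<lambda>x. u x + c * v x) (\<lambda>x. g1 x + c * h1 x) (\<lambda>x. g2 x + c * h2 x) x =
    twisted p \<beta> u g1 g2 x + c * twisted p \<beta> v h1 h2 x"
  by (simp add: twisted_def algebra_simps)

text \<open>Recovers the sesquilinear form: summed against the fourth roots of unity, only the term that
  is linear in \<open>u\<close> and antilinear in \<open>v\<close> survives.\<close>

lemma polarization_eqI:
  assumes F: "\<And>c. F (\<lambda>x. u x + c * v x) = F u + 2 * Re (cnj c * B) + (norm c)\<^sup>2 * F v"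
  shows "polarization F u v = B"
proof -
  have "polarization F u v = (\<Sum>k<4. \<i> ^ k * complex_of_real (F u + 2 * Re (cnj (\<i> ^ k) * B) + F v)) / 4"
    unfolding polarization_def F by (simp add: norm_power)
  also have "\<dots> = B"
    by (simp add: numeral_eq_Suc complex_eq_iff)
  finally show ?thesis .
qed

context bounded_open_set
begin

lemma coordinates_bounded: "\<exists>R\<ge>0. \<forall>x\<in>\<omega>. \<bar>fst x\<bar> \<le> R \<and> \<bar>snd x\<bar> \<le> R"
proof -
  obtain R where R: "\<And>x. x \<in> \<omega> \<Longrightarrow> norm x \<le> R" "R > 0"
    using bounded_\<omega> unfolding bounded_pos by blast
  have "\<bar>fst x\<bar> \<le> R \<and> \<bar>snd x\<bar> \<le> R" if "x \<in> \<omega>" for x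
    using R(1)[OF that] norm_fst_le[of "fst x" "snd x"] norm_snd_le[of "snd x" "fst x"] by auto
  with R(2) show ?thesis by (intro exI[of _ R]) auto
qed

text \<open>The coordinates are bounded on \<open>\<omega>\<close>. The constant is uniform, which later gives continuity of the form
  under convergence in the form domain.\<close>

lemma twisted_bounded:
  "\<exists>K. \<forall>u\<in>L2 M. \<forall>g1\<in>L2 M. \<forall>g2\<in>L2 M. twisted p \<beta> u g1 g2 \<in> L2 M \<and>
     L2_sq M (twisted p \<beta> u g1 g2) \<le> K * (L2_sq M u + L2_sq M g1 + L2_sq M g2)"
proof -
  obtain R where R: "R \<ge> 0" "\<And>x. x \<in> \<omega> \<Longrightarrow> \<bar>fst x\<bar> \<le> R" "\<And>x. x \<in> \<omega> \<Longrightarrow> \<bar>snd x\<bar> \<le> R"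
    using coordinates_bounded by blast
  define w1 where "w1 x = \<i> * complex_of_real \<beta> * complex_of_real (fst x)" for x :: "real \<times> real"
  define w2 where "w2 x = - (\<i> * complex_of_real \<beta> * complex_of_real (snd x))" for x :: "real \<times> real"
  have w: "w1 \<in> borel_measurable M" "w2 \<in> borel_measurable M"
    unfolding w1_def w2_def using open_\<omega>
    by (auto intro!: continuous_imp_measurable_on_sets_lebesgue continuous_intros)
  have wb: "norm (w1 x) \<le> \<bar>\<beta>\<bar> * R" "norm (w2 x) \<le> \<bar>\<beta>\<bar> * R" if "x \<in> space M" for x
    using R(2,3)[of x] that by (simp_all add: w1_def w2_def norm_mult mult_left_mono)
  define K where "K = 4 * (\<bar>\<beta>\<bar> * R)\<^sup>2 + 2 * p\<^sup>2"
  show ?thesis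
  proof (intro exI[of _ K] ballI)
    fix u g1 g2 assume L: "u \<in> L2 M" "g1 \<in> L2 M" "g2 \<in> L2 M"
    have eq: "twisted p \<beta> u g1 g2 = (\<lambda>x. (w1 x * g2 x + w2 x * g1 x) + complex_of_real (- p) * u x)"
      by (auto simp: twisted_def w1_def w2_def algebra_simps)
    note b1 = L2_bounded_mult[OF L(3) w(1) wb(1)] and b2 = L2_bounded_mult[OF L(2) w(2) wb(2)]
    have "L2_sq M (twisted p \<beta> u g1 g2) \<le> 2 * L2_sq M (\<lambda>x. w1 x * g2 x + w2 x * g1 x) + 2 * L2_sq M (\<lambda>x. complex_of_real (- p) * u x)"
      unfolding eq by (intro L2_add(2) L2_add(1) b1 b2 L2_cmult L)
    also have "L2_sq M (\<lambda>x. w1 x * g2 x + w2 x * g1 x) \<le> 2 * L2_sq M (\<lambda>x. w1 x * g2 x) + 2 * L2_sq M (\<lambda>x. w2 x * g1 x)"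
      by (intro L2_add(2) b1 b2)
    finally have "L2_sq M (twisted p \<beta> u g1 g2) \<le> 4 * L2_sq M (\<lambda>x. w1 x * g2 x) + 4 * L2_sq M (\<lambda>x. w2 x * g1 x) + 2 * (p\<^sup>2 * L2_sq M u)"
      unfolding L2_sq_cmult by simp
    also have "\<dots> \<le> 4 * ((\<bar>\<beta>\<bar> * R)\<^sup>2 * L2_sq M g2) + 4 * ((\<bar>\<beta>\<bar> * R)\<^sup>2 * L2_sq M g1) + 2 * (p\<^sup>2 * L2_sq M u)"
      by (intro add_mono mult_left_mono b1 b2) auto
    also have "\<dots> \<le> K * (L2_sq M u + L2_sq M g1 + L2_sq M g2)"
    proof -
      have "0 \<le> 4 * (\<bar>\<beta>\<bar> * R)\<^sup>2 * L2_sq M u + 2 * p\<^sup>2 * L2_sq M g1 + 2 * p\<^sup>2 * L2_sq M g2"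
        by (intro add_nonneg_nonneg mult_nonneg_nonneg L2_sq_nonneg) auto
      then show ?thesis by (simp add: K_def algebra_simps)
    qed
    finally show "twisted p \<beta> u g1 g2 \<in> L2 M \<and> L2_sq M (twisted p \<beta> u g1 g2) \<le> K * (L2_sq M u + L2_sq M g1 + L2_sq M g2)"
      unfolding eq by (intro conjI L2_add(1) b1 b2 L2_cmult L)
  qed
qed

lemma twisted_L2: "u \<in> L2 M \<Longrightarrow> g1 \<in> L2 M \<Longrightarrow> g2 \<in> L2 M \<Longrightarrow> twisted p \<beta> u g1 g2 \<in> L2 M"
  using twisted_bounded[of p \<beta>] by blast

definition form_val :: "real \<Rightarrow> real \<Rightarrow> (real \<times> real \<Rightarrow> complex) \<Rightarrow> (real \<times> real \<Rightarrow> complex) \<Rightarrow>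
    (real \<times> real \<Rightarrow> complex) \<Rightarrow> real" where
  "form_val p \<beta> u g1 g2 = L2_sq M g1 + L2_sq M g2 + L2_sq M (twisted p \<beta> u g1 g2)"

text \<open>The form may be computed with any weak derivatives, in particular with classical ones for
  test functions.\<close>

lemma q_form_eq:
  assumes g1: "is_weak_deriv \<omega> (1, 0) u g1" and g2: "is_weak_deriv \<omega> (0, 1) u g2"
  shows "q_form \<omega> p \<beta> u = form_val p \<beta> u g1 g2"
proof -
  have w1: "is_weak_deriv \<omega> (1, 0) u (weak_d1 \<omega> u)"
    unfolding weak_deriv_def by (rule someI[of _ g1], rule g1)
  have w2: "is_weak_deriv \<omega> (0, 1) u (weak_d2 \<omega> u)"
    unfolding weak_deriv_def by (rule someI[of _ g2], rule g2)
  note L = is_weak_deriv_L2(1)[OF g1] is_weak_deriv_L2(2)[OF w1] is_weak_deriv_L2(2)[OF w2]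
  note L' = is_weak_deriv_L2(1)[OF g1] is_weak_deriv_L2(2)[OF g1] is_weak_deriv_L2(2)[OF g2]
  have T: "twisted p \<beta> u (weak_d1 \<omega> u) (weak_d2 \<omega> u) \<in> L2 M" by (rule twisted_L2[OF L])
  have "q_form \<omega> p \<beta> u = (\<integral>x. (norm (weak_d1 \<omega> u x))\<^sup>2 + (norm (weak_d2 \<omega> u x))\<^sup>2 +
      (norm (twisted p \<beta> u (weak_d1 \<omega> u) (weak_d2 \<omega> u) x))\<^sup>2 \<partial>M)"
    by (simp add: q_form_def angular_deriv_def twisted_def)
  also have "\<dots> = form_val p \<beta> u (weak_d1 \<omega> u) (weak_d2 \<omega> u)"
    using L2D(2)[OF L(2)] L2D(2)[OF L(3)] L2D(2)[OF T] by (simp add: form_val_def L2_sq_def)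
  also have "\<dots> = form_val p \<beta> u g1 g2"
  proof -
    have "AE x in M. weak_d1 \<omega> u x = g1 x" "AE x in M. weak_d2 \<omega> u x = g2 x"
      by (rule weak_deriv_AE_eq[OF g1], simp add: Basis_plane, rule weak_deriv_AE_eq[OF g2], simp add: Basis_plane)
    then have "AE x in M. twisted p \<beta> u (weak_d1 \<omega> u) (weak_d2 \<omega> u) x = twisted p \<beta> u g1 g2 x"
      by eventually_elim (simp add: twisted_def)
    then have "L2_sq M (twisted p \<beta> u (weak_d1 \<omega> u) (weak_d2 \<omega> u)) = L2_sq M (twisted p \<beta> u g1 g2)"
      by (rule L2_sq_cong_AE[OF T twisted_L2[OF L']])
    then show ?thesis
      unfolding form_val_def using L2_sq_weak_deriv[OF g1] L2_sq_weak_deriv[OF g2] by (simp add: Basis_plane)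
  qed
  finally show ?thesis .
qed

lemma form_val_lincomb:
  assumes "u \<in> L2 M" "g1 \<in> L2 M" "g2 \<in> L2 M" "v \<in> L2 M" "h1 \<in> L2 M" "h2 \<in> L2 M"
  shows "form_val p \<beta> (\<lambda>x. u x + c * v x) (\<lambda>x. g1 x + c * h1 x) (\<lambda>x. g2 x + c * h2 x) =
    form_val p \<beta> u g1 g2 +
    2 * Re (cnj c * (L2_inner M g1 h1 + L2_inner M g2 h2 + L2_inner M (twisted p \<beta> u g1 g2) (twisted p \<beta> v h1 h2))) +
    (norm c)\<^sup>2 * form_val p \<beta> v h1 h2"
  unfolding form_val_def twisted_lincomb
  by (subst L2_sq_lincomb, (intro assms twisted_L2)+)+ (simp add: algebra_simps)

definition q_inner :: "real \<Rightarrow> real \<Rightarrow> (real \<times> real \<Rightarrow> complex) \<Rightarrow> (real \<times> real \<Rightarrow> complex) \<Rightarrow> complex" where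
  "q_inner p \<beta> u v = L2_inner M (weak_d1 \<omega> u) (weak_d1 \<omega> v) + L2_inner M (weak_d2 \<omega> u) (weak_d2 \<omega> v) +
    L2_inner M (twisted p \<beta> u (weak_d1 \<omega> u) (weak_d2 \<omega> u)) (twisted p \<beta> v (weak_d1 \<omega> v) (weak_d2 \<omega> v))"

lemma H10_weak_partials:
  assumes "u \<in> H10 \<omega>"
  shows "is_weak_deriv \<omega> (1, 0) u (weak_d1 \<omega> u)" "is_weak_deriv \<omega> (0, 1) u (weak_d2 \<omega> u)"
  by (rule H10_weak_deriv[OF assms], simp add: Basis_plane)+

lemma q_form_lincomb:
  assumes u: "u \<in> H10 \<omega>" and v: "v \<in> H10 \<omega>"
  shows "q_form \<omega> p \<beta> (\<lambda>x. u x + c * v x) =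
    q_form \<omega> p \<beta> u + 2 * Re (cnj c * q_inner p \<beta> u v) + (norm c)\<^sup>2 * q_form \<omega> p \<beta> v"
proof -
  note U = H10_weak_partials[OF u] and V = H10_weak_partials[OF v]
  have B: "(1, 0) \<in> (Basis :: (real \<times> real) set)" "(0, 1) \<in> (Basis :: (real \<times> real) set)" by (auto simp: Basis_plane)
  show ?thesis
    unfolding q_form_eq[OF U] q_form_eq[OF V] q_inner_def
      q_form_eq[OF is_weak_deriv_lincomb[OF U(1) V(1) B(1), of c] is_weak_deriv_lincomb[OF U(2) V(2) B(2), of c]]
    by (rule form_val_lincomb) (intro is_weak_deriv_L2[OF U(1)] is_weak_deriv_L2[OF U(2)] is_weak_deriv_L2[OF V(1)] is_weak_deriv_L2[OF V(2)])+
qed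

lemma q_form_nonneg: "u \<in> H10 \<omega> \<Longrightarrow> 0 \<le> q_form \<omega> p \<beta> u"
  using q_form_eq[OF H10_weak_partials] by (simp add: form_val_def L2_sq_nonneg)

lemma q_form_test:
  assumes "\<phi> \<in> test_functions \<omega>"
  shows "q_form \<omega> p \<beta> \<phi> = form_val p \<beta> \<phi> (dir_deriv (1, 0) \<phi>) (dir_deriv (0, 1) \<phi>)"
  by (rule q_form_eq[OF is_weak_deriv_test[OF assms] is_weak_deriv_test[OF assms]]) (auto simp: Basis_plane)

lemma q_form_cmult_test:
  assumes \<phi>: "\<phi> \<in> test_functions \<omega>"
  shows "(\<lambda>x. c * \<phi> x) \<in> test_functions \<omega>" "q_form \<omega> p \<beta> (\<lambda>x. c * \<phi> x) = (norm c)\<^sup>2 * q_form \<omega> p \<beta> \<phi>"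
proof -
  show t: "(\<lambda>x. c * \<phi> x) \<in> test_functions \<omega>"
    using test_functions_lincomb[OF \<phi> \<phi>, of "c - 1"] by (simp add: algebra_simps)
  have d: "dir_deriv b (\<lambda>x. c * \<phi> x) = (\<lambda>x. c * dir_deriv b \<phi> x)" for b
    using dir_deriv_lincomb[OF \<phi> \<phi>, of b "c - 1"] by (auto simp: algebra_simps)
  have tw: "twisted p \<beta> (\<lambda>x. c * \<phi> x) (\<lambda>x. c * g1 x) (\<lambda>x. c * g2 x) = (\<lambda>x. c * twisted p \<beta> \<phi> g1 g2 x)" for g1 g2
    by (auto simp: twisted_def algebra_simps)
  show "q_form \<omega> p \<beta> (\<lambda>x. c * \<phi> x) = (norm c)\<^sup>2 * q_form \<omega> p \<beta> \<phi>"
    unfolding q_form_test[OF t] q_form_test[OF \<phi>] form_val_def d tw L2_sq_cmult by (simp add: algebra_simps)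
qed

text \<open>Continuity of the form in the Sobolev norm, along sequences of test functions.\<close>

lemma q_form_tendsto:
  assumes \<phi>: "\<And>n. \<phi> n \<in> test_functions \<omega>"
    and u: "u \<in> L2 M" "(\<lambda>n. L2_sq M (\<lambda>x. \<phi> n x - u x)) \<longlonglongrightarrow> 0"
    and g: "\<And>b. b \<in> Basis \<Longrightarrow> is_weak_deriv \<omega> b u (g b)"
      "\<And>b. b \<in> Basis \<Longrightarrow> (\<lambda>n. L2_sq M (\<lambda>x. dir_deriv b (\<phi> n) x - g b x)) \<longlonglongrightarrow> 0"
  shows "(\<lambda>n. q_form \<omega> p \<beta> (\<phi> n)) \<longlonglongrightarrow> q_form \<omega> p \<beta> u"
proof -
  have B: "(1, 0) \<in> (Basis :: (real \<times> real) set)" "(0, 1) \<in> (Basis :: (real \<times> real) set)" by (auto simp: Basis_plane)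
  note gL = is_weak_deriv_L2(2)[OF g(1)]
  have D: "dir_deriv b (\<phi> n) \<in> L2 M" if "b \<in> Basis" for b n by (rule test_dir_deriv_L2[OF \<phi> that])
  obtain K where K: "\<And>u g1 g2. u \<in> L2 M \<Longrightarrow> g1 \<in> L2 M \<Longrightarrow> g2 \<in> L2 M \<Longrightarrow>
     L2_sq M (twisted p \<beta> u g1 g2) \<le> K * (L2_sq M u + L2_sq M g1 + L2_sq M g2)"
    using twisted_bounded[of p \<beta>] by blast
  let ?T = "\<lambda>n. twisted p \<beta> (\<phi> n) (dir_deriv (1, 0) (\<phi> n)) (dir_deriv (0, 1) (\<phi> n))"
  let ?T' = "twisted p \<beta> u (g (1, 0)) (g (0, 1))"
  have "(\<lambda>n. L2_sq M (\<lambda>x. ?T n x - ?T' x)) \<longlonglongrightarrow> 0"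
  proof (rule tendsto_sandwich[OF _ _ tendsto_const])
    have "?T n x - ?T' x = twisted p \<beta> (\<lambda>x. \<phi> n x - u x) (\<lambda>x. dir_deriv (1, 0) (\<phi> n) x - g (1, 0) x) (\<lambda>x. dir_deriv (0, 1) (\<phi> n) x - g (0, 1) x) x" for n x
      by (simp add: twisted_def algebra_simps)
    then show "\<forall>\<^sub>F n in sequentially. L2_sq M (\<lambda>x. ?T n x - ?T' x) \<le> K * (L2_sq M (\<lambda>x. \<phi> n x - u x) +
        L2_sq M (\<lambda>x. dir_deriv (1, 0) (\<phi> n) x - g (1, 0) x) + L2_sq M (\<lambda>x. dir_deriv (0, 1) (\<phi> n) x - g (0, 1) x))"
      by (intro always_eventually allI) (simp only:, intro K L2_diff test_L2 \<phi> u(1) D gL B)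
    have "(\<lambda>n. K * (L2_sq M (\<lambda>x. \<phi> n x - u x) +
        L2_sq M (\<lambda>x. dir_deriv (1, 0) (\<phi> n) x - g (1, 0) x) + L2_sq M (\<lambda>x. dir_deriv (0, 1) (\<phi> n) x - g (0, 1) x))) \<longlonglongrightarrow> K * (0 + 0 + 0)"
      by (intro tendsto_intros u g B)
    then show "(\<lambda>n. K * (L2_sq M (\<lambda>x. \<phi> n x - u x) +
        L2_sq M (\<lambda>x. dir_deriv (1, 0) (\<phi> n) x - g (1, 0) x) + L2_sq M (\<lambda>x. dir_deriv (0, 1) (\<phi> n) x - g (0, 1) x))) \<longlonglongrightarrow> 0" by simp
  qed (simp add: L2_sq_nonneg)
  then have T: "(\<lambda>n. L2_sq M (?T n)) \<longlonglongrightarrow> L2_sq M ?T'"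
    by (rule L2_sq_tendsto[rotated 2]) (intro twisted_L2 test_L2 \<phi> u D gL B)+
  have G: "(\<lambda>n. L2_sq M (dir_deriv b (\<phi> n))) \<longlonglongrightarrow> L2_sq M (g b)" if "b \<in> Basis" for b
    by (rule L2_sq_tendsto[OF D[OF that] gL[OF that] g(2)[OF that]])
  show ?thesis
    unfolding q_form_test[OF \<phi>] q_form_eq[OF g(1)[OF B(1)] g(1)[OF B(2)]] form_val_def
    by (rule tendsto_add[OF tendsto_add[OF G[OF B(1)] G[OF B(2)]] T])
qed

end

section \<open>Existence of the ground state\<close>

context bounded_open_set
begin

text \<open>A bump is positive on an open box, and nonempty open sets are not negligible.\<close>

lemma exists_normalized_test_function:
  assumes "\<omega> \<noteq> {}"
  shows "\<exists>\<phi>\<in>test_functions \<omega>. L2_sq M \<phi> = 1"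
proof -
  obtain z where "z \<in> \<omega>" using assms by blast
  then obtain a b where ab: "cbox a b \<subseteq> \<omega>" "z \<in> box a b" using open_contains_cbox[OF open_\<omega>, of z] by metis
  define \<phi> where "\<phi> x = complex_of_real (box_bump 0 a b x)" for x
  have \<phi>: "\<phi> \<in> test_functions \<omega>" unfolding \<phi>_def by (rule box_bump_test_function[OF ab(1)])
  have pos: "\<phi> x \<noteq> 0" if "x \<in> box a b" for x
    using that by (cases x; cases a; cases b) (simp add: \<phi>_def box_bump_def flat_exp_def mem_box_plane)
  have nz: "L2_sq M \<phi> \<noteq> 0"
  proof
    assume "L2_sq M \<phi> = 0"
    then have "AE x in M. (norm (\<phi> x))\<^sup>2 = 0"
      unfolding L2_sq_def by (subst (asm) integral_nonneg_eq_0_iff_AE[OF L2D(2)[OF test_L2[OF \<phi>]]]) auto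
    then have "AE x in lebesgue. x \<in> \<omega> \<longrightarrow> \<phi> x = 0" using open_\<omega> by (subst (asm) AE_restrict_space_iff) auto
    then have "AE x in lebesgue. x \<notin> box a b"
    proof eventually_elim
      case (elim x)
      then show ?case using pos[of x] ab(1) box_subset_cbox[of a b] by (meson subsetD)
    qed
    then have "box a b \<in> null_sets lebesgue" by (subst AE_iff_null_sets) auto
    then have "negligible (box a b)" by (simp add: negligible_iff_null_sets)
    then show False using open_not_negligible[of "box a b"] ab(2) by auto
  qed
  then have p: "L2_sq M \<phi> > 0" using L2_sq_nonneg[of M \<phi>] by linarith
  show ?thesis
  proof (rule bexI[OF _ q_form_cmult_test(1)[OF \<phi>]])
    show "L2_sq M (\<lambda>x. complex_of_real (1 / sqrt (L2_sq M \<phi>)) * \<phi> x) = 1"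
      unfolding L2_sq_cmult using p by (simp add: norm_divide power_divide)
  qed
qed

definition ground_energy :: "real \<Rightarrow> real \<Rightarrow> real" where
  "ground_energy p \<beta> = (INF \<phi>\<in>{\<phi> \<in> test_functions \<omega>. L2_sq M \<phi> = 1}. q_form \<omega> p \<beta> \<phi>)"

lemma bdd_below_q_form: "bdd_below (q_form \<omega> p \<beta> ` {\<phi> \<in> test_functions \<omega>. L2_sq M \<phi> = 1})"
  by (rule bdd_belowI2[of _ 0]) (auto intro: q_form_nonneg test_H10)

lemma ground_energy_le_normalized:
  "\<phi> \<in> test_functions \<omega> \<Longrightarrow> L2_sq M \<phi> = 1 \<Longrightarrow> ground_energy p \<beta> \<le> q_form \<omega> p \<beta> \<phi>"
  unfolding ground_energy_def by (intro cINF_lower bdd_below_q_form) auto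

lemma ground_energy_nonneg: "\<omega> \<noteq> {} \<Longrightarrow> 0 \<le> ground_energy p \<beta>"
  unfolding ground_energy_def using exists_normalized_test_function
  by (intro cINF_greatest) (auto intro: q_form_nonneg test_H10)

text \<open>Scaling to norm one.\<close>

lemma ground_energy_le_test:
  assumes \<phi>: "\<phi> \<in> test_functions \<omega>"
  shows "ground_energy p \<beta> * L2_sq M \<phi> \<le> q_form \<omega> p \<beta> \<phi>"
proof (cases "L2_sq M \<phi> = 0")
  case True
  then show ?thesis using q_form_nonneg[OF test_H10[OF \<phi>]] by simp
next
  case False
  then have p: "L2_sq M \<phi> > 0" using L2_sq_nonneg[of M \<phi>] by linarith
  let ?c = "complex_of_real (1 / sqrt (L2_sq M \<phi>))"
  have c: "(norm ?c)\<^sup>2 = 1 / L2_sq M \<phi>" using p by (simp add: norm_divide power_divide)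
  have "ground_energy p \<beta> \<le> q_form \<omega> p \<beta> (\<lambda>x. ?c * \<phi> x)"
    by (rule ground_energy_le_normalized[OF q_form_cmult_test(1)[OF \<phi>]]) (simp only: L2_sq_cmult c, use p in simp)
  also have "\<dots> = 1 / L2_sq M \<phi> * q_form \<omega> p \<beta> \<phi>" unfolding q_form_cmult_test(2)[OF \<phi>] c ..
  finally show ?thesis using p by (simp add: field_simps)
qed

text \<open>Both sides are continuous and test functions are dense in the form domain.\<close>

lemma ground_energy_le_H10:
  assumes u: "u \<in> H10 \<omega>"
  shows "ground_energy p \<beta> * L2_sq M u \<le> q_form \<omega> p \<beta> u"
proof -
  obtain \<phi> where \<phi>: "\<forall>n. \<phi> n \<in> test_functions \<omega>" "(\<lambda>n. L2_sq M (\<lambda>x. \<phi> n x - u x)) \<longlonglongrightarrow> 0"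
    "\<forall>b\<in>Basis. (\<lambda>n. L2_sq M (\<lambda>x. dir_deriv b (\<phi> n) x - weak_deriv \<omega> b u x)) \<longlonglongrightarrow> 0"
    using H10_approx[OF u] by (elim exE conjE)
  note \<phi> = \<phi>(1)[rule_format] \<phi>(2) \<phi>(3)[rule_format]
  have "(\<lambda>n. ground_energy p \<beta> * L2_sq M (\<phi> n)) \<longlonglongrightarrow> ground_energy p \<beta> * L2_sq M u"
    by (intro tendsto_mult_left L2_sq_tendsto test_L2 \<phi> H10_L2 u)
  moreover have "(\<lambda>n. q_form \<omega> p \<beta> (\<phi> n)) \<longlonglongrightarrow> q_form \<omega> p \<beta> u"
    by (rule q_form_tendsto[where g = "\<lambda>b. weak_deriv \<omega> b u"]) (intro \<phi> H10_L2 u H10_weak_deriv; assumption)+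
  ultimately show ?thesis
    by (rule LIMSEQ_le) (use ground_energy_le_test \<phi>(1) in blast)
qed

text \<open>The direct method. For a minimizing sequence of normalized test functions, the parallelogram
  laws of the form and of the norm give
  \<open>q(\<phi>\<^sub>m - \<phi>\<^sub>n) \<le> 2 (q(\<phi>\<^sub>m) - E) + 2 (q(\<phi>\<^sub>n) - E) + E \<parallel>\<phi>\<^sub>m - \<phi>\<^sub>n\<parallel>\<^sup>2\<close>,
  because \<open>q(\<phi>\<^sub>m + \<phi>\<^sub>n)\<close> is at least \<open>E \<parallel>\<phi>\<^sub>m + \<phi>\<^sub>n\<parallel>\<^sup>2 = E (4 - \<parallel>\<phi>\<^sub>m - \<phi>\<^sub>n\<parallel>\<^sup>2)\<close>. Once the sequence is Cauchy
  in \<open>L\<^sup>2\<close>, so are its gradients, and the minimum is attained without any weak convergence.\<close>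

lemma ground_state_exists:
  assumes "\<omega> \<noteq> {}"
  shows "\<exists>u\<in>H10 \<omega>. L2_sq M u = 1 \<and> q_form \<omega> p \<beta> u = ground_energy p \<beta>"
proof -
  define E where "E = ground_energy p \<beta>"
  let ?S = "{\<phi> \<in> test_functions \<omega>. L2_sq M \<phi> = 1}"
  have ne: "?S \<noteq> {}" using exists_normalized_test_function[OF assms] by blast
  have "\<exists>\<phi>. \<phi> \<in> test_functions \<omega> \<and> L2_sq M \<phi> = 1 \<and> q_form \<omega> p \<beta> \<phi> < E + inverse (real (Suc n))" for n
    using cINF_less_iff[OF ne bdd_below_q_form, of p \<beta> "E + inverse (real (Suc n))"] by (auto simp: E_def ground_energy_def)
  then obtain \<phi>0 where \<phi>0: "\<And>n. \<phi>0 n \<in> test_functions \<omega>" "\<And>n. L2_sq M (\<phi>0 n) = 1"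
    "\<And>n. q_form \<omega> p \<beta> (\<phi>0 n) < E + inverse (real (Suc n))"
    by metis
  have "E \<ge> 0" unfolding E_def by (rule ground_energy_nonneg[OF assms])
  \<comment> \<open>The form dominates the gradient, which provides both the bound for Rellich and the Cauchy property of the derivatives.\<close>
  have grad: "L2_sq M (dir_deriv b \<phi>) \<le> q_form \<omega> p \<beta> \<phi>" if "\<phi> \<in> test_functions \<omega>" "b \<in> Basis" for \<phi> b
    using that(2) L2_sq_nonneg[of M] unfolding q_form_test[OF that(1)] form_val_def by (auto simp: Basis_plane add_nonneg_nonneg)
  obtain r where r: "strict_mono r" "L2_Cauchy M (\<lambda>n. \<phi>0 (r n))"
  proof (rule Rellich_test_functions[OF open_\<omega> bounded_\<omega>, of \<phi>0 "E + 1"])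
    fix n and b :: "real \<times> real" assume b: "b \<in> Basis"
    have "inverse (real (Suc n)) \<le> 1" by (simp add: field_simps)
    then show "L2_sq M (dir_deriv b (\<phi>0 n)) \<le> E + 1" using grad[OF \<phi>0(1) b, of n] \<phi>0(3)[of n] by linarith
  next
    fix r assume "strict_mono r" "L2_Cauchy M (\<lambda>n. \<phi>0 (r n))"
    then show thesis by (rule that)
  qed (use \<phi>0 \<open>E \<ge> 0\<close> in auto)
  define \<phi> where "\<phi> n = \<phi>0 (r n)" for n
  have \<phi>: "\<phi> n \<in> test_functions \<omega>" "L2_sq M (\<phi> n) = 1" for n by (auto simp: \<phi>_def \<phi>0)
  have q_lim: "(\<lambda>n. q_form \<omega> p \<beta> (\<phi> n)) \<longlonglongrightarrow> E"
  proof (rule tendsto_sandwich[OF _ _ tendsto_const])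
    show "\<forall>\<^sub>F n in sequentially. E \<le> q_form \<omega> p \<beta> (\<phi> n)"
      unfolding E_def by (intro always_eventually allI ground_energy_le_normalized \<phi>)
    show "\<forall>\<^sub>F n in sequentially. q_form \<omega> p \<beta> (\<phi> n) \<le> E + inverse (real (Suc n))"
    proof (intro always_eventually allI)
      fix n
      have "inverse (real (Suc (r n))) \<le> inverse (real (Suc n))"
        using seq_suble[OF r(1), of n] by (intro le_imp_inverse_le) auto
      then show "q_form \<omega> p \<beta> (\<phi> n) \<le> E + inverse (real (Suc n))" using \<phi>0(3)[of "r n"] unfolding \<phi>_def by linarith
    qed
    show "(\<lambda>n. E + inverse (real (Suc n))) \<longlonglongrightarrow> E"
      using tendsto_add[OF tendsto_const[of E] LIMSEQ_inverse_real_of_nat] by simp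
  qed
  have cau: "L2_Cauchy M \<phi>" using r(2) by (simp add: \<phi>_def[abs_def])
  let ?P = "sequentially \<times>\<^sub>F sequentially"
  have diff: "(\<lambda>x. \<phi> m x + (-1) * \<phi> n x) \<in> test_functions \<omega>" for m n by (intro test_functions_lincomb \<phi>)
  have par: "q_form \<omega> p \<beta> (\<lambda>x. \<phi> m x + (-1) * \<phi> n x) \<le>
      2 * (q_form \<omega> p \<beta> (\<phi> m) - E) + 2 * (q_form \<omega> p \<beta> (\<phi> n) - E) + E * L2_sq M (\<lambda>x. \<phi> m x - \<phi> n x)" for m n
  proof -
    note H = test_H10[OF \<phi>(1), of m] test_H10[OF \<phi>(1), of n] and L = test_L2[OF \<phi>(1), of m] test_L2[OF \<phi>(1), of n]
    have "q_form \<omega> p \<beta> (\<lambda>x. \<phi> m x + (-1) * \<phi> n x) + q_form \<omega> p \<beta> (\<lambda>x. \<phi> m x + 1 * \<phi> n x) =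
      2 * q_form \<omega> p \<beta> (\<phi> m) + 2 * q_form \<omega> p \<beta> (\<phi> n)"
      unfolding q_form_lincomb[OF H] by simp
    moreover have "L2_sq M (\<lambda>x. \<phi> m x + (-1) * \<phi> n x) + L2_sq M (\<lambda>x. \<phi> m x + 1 * \<phi> n x) = 4"
      unfolding L2_sq_lincomb[OF L] by (simp add: \<phi>(2))
    then have "E * L2_sq M (\<lambda>x. \<phi> m x + 1 * \<phi> n x) = 4 * E - E * L2_sq M (\<lambda>x. \<phi> m x - \<phi> n x)"
      by (simp add: algebra_simps flip: distrib_left)
    moreover have "E * L2_sq M (\<lambda>x. \<phi> m x + 1 * \<phi> n x) \<le> q_form \<omega> p \<beta> (\<lambda>x. \<phi> m x + 1 * \<phi> n x)"
      unfolding E_def by (intro ground_energy_le_test test_functions_lincomb \<phi>)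
    ultimately show ?thesis by (simp add: algebra_simps)
  qed
  have "((\<lambda>z. 2 * (q_form \<omega> p \<beta> (\<phi> (fst z)) - E) + 2 * (q_form \<omega> p \<beta> (\<phi> (snd z)) - E) +
      E * (\<lambda>(m, n). L2_sq M (\<lambda>x. \<phi> m x - \<phi> n x)) z) \<longlongrightarrow> 2 * (E - E) + 2 * (E - E) + E * 0) ?P"
    by (intro tendsto_intros filterlim_compose[OF q_lim] filterlim_fst filterlim_snd cau[unfolded L2_Cauchy_def])
  then have bd0: "((\<lambda>z. 2 * (q_form \<omega> p \<beta> (\<phi> (fst z)) - E) + 2 * (q_form \<omega> p \<beta> (\<phi> (snd z)) - E) +
      E * (\<lambda>(m, n). L2_sq M (\<lambda>x. \<phi> m x - \<phi> n x)) z) \<longlongrightarrow> 0) ?P" by simp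
  have cauD: "L2_Cauchy M (\<lambda>n. dir_deriv b (\<phi> n))" if b: "b \<in> Basis" for b
    unfolding L2_Cauchy_def
  proof (rule tendsto_sandwich[OF _ _ tendsto_const bd0])
    have "L2_sq M (\<lambda>x. dir_deriv b (\<phi> m) x - dir_deriv b (\<phi> n) x) \<le>
      2 * (q_form \<omega> p \<beta> (\<phi> m) - E) + 2 * (q_form \<omega> p \<beta> (\<phi> n) - E) + E * L2_sq M (\<lambda>x. \<phi> m x - \<phi> n x)" for m n
    proof -
      have "dir_deriv b (\<lambda>x. \<phi> m x + (-1) * \<phi> n x) = (\<lambda>x. dir_deriv b (\<phi> m) x - dir_deriv b (\<phi> n) x)"
        by (rule ext) (subst dir_deriv_lincomb[OF \<phi>(1) \<phi>(1)], simp)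
      then show ?thesis using order_trans[OF grad[OF diff b] par, of m n] by (simp only:)
    qed
    then show "\<forall>\<^sub>F z in ?P. (\<lambda>(m, n). L2_sq M (\<lambda>x. dir_deriv b (\<phi> m) x - dir_deriv b (\<phi> n) x)) z \<le>
      2 * (q_form \<omega> p \<beta> (\<phi> (fst z)) - E) + 2 * (q_form \<omega> p \<beta> (\<phi> (snd z)) - E) +
      E * (\<lambda>(m, n). L2_sq M (\<lambda>x. \<phi> m x - \<phi> n x)) z"
      by (intro always_eventually) (simp add: split_def)
  qed (simp add: split_def L2_sq_nonneg)
  obtain u where u: "u \<in> L2 M" "(\<lambda>n. L2_sq M (\<lambda>x. \<phi> n x - u x)) \<longlonglongrightarrow> 0"
    using L2_complete[OF test_L2[OF \<phi>(1)] cau] by blast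
  have "\<forall>b\<in>Basis. \<exists>g. g \<in> L2 M \<and> (\<lambda>n. L2_sq M (\<lambda>x. dir_deriv b (\<phi> n) x - g x)) \<longlonglongrightarrow> 0"
    using L2_complete[OF test_dir_deriv_L2[OF \<phi>(1)] cauD] by blast
  from bchoice[OF this] obtain g where g: "\<And>b. b \<in> Basis \<Longrightarrow> g b \<in> L2 M"
    "\<And>b. b \<in> Basis \<Longrightarrow> (\<lambda>n. L2_sq M (\<lambda>x. dir_deriv b (\<phi> n) x - g b x)) \<longlonglongrightarrow> 0"
    by blast
  note lim = H10_limit[OF \<phi>(1) u g]
  show ?thesis
  proof (intro bexI[of _ u] conjI)
    show "u \<in> H10 \<omega>" by (rule lim(1))
    have "(\<lambda>n. L2_sq M (\<phi> n)) \<longlonglongrightarrow> L2_sq M u" by (intro L2_sq_tendsto test_L2 \<phi> u)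
    then show "L2_sq M u = 1" by (simp add: \<phi>(2) LIMSEQ_const_iff)
    have "(\<lambda>n. q_form \<omega> p \<beta> (\<phi> n)) \<longlonglongrightarrow> q_form \<omega> p \<beta> u"
      by (rule q_form_tendsto[OF \<phi>(1) u lim(2) g(2)])
    then show "q_form \<omega> p \<beta> u = ground_energy p \<beta>" using q_lim LIMSEQ_unique unfolding E_def by blast
  qed
qed

text \<open>A minimizer \<open>u\<close> is an eigenfunction: \<open>q - E \<parallel>\<cdot>\<parallel>\<^sup>2\<close> is a nonnegative quadratic form that vanishes at
  \<open>u\<close>, so its sesquilinear form vanishes at \<open>(u, v)\<close> for every \<open>v\<close>. Conversely, testing an eigenvalue equation
  with the eigenfunction itself shows that the eigenvalue is a Rayleigh quotient.\<close>

lemma E1_eq_ground_energy: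
  assumes "\<omega> \<noteq> {}"
  shows "E1 \<omega> p \<beta> = ground_energy p \<beta>"
proof -
  define E where "E = ground_energy p \<beta>"
  have pol: "polarization (q_form \<omega> p \<beta>) u v = q_inner p \<beta> u v" if "u \<in> H10 \<omega>" "v \<in> H10 \<omega>" for u v
    by (rule polarization_eqI) (rule q_form_lincomb[OF that])
  have scal: "L2_inner M (\<lambda>x. complex_of_real \<mu> * u x) v = complex_of_real \<mu> * L2_inner M u v" for \<mu> u v
    by (simp add: L2_inner_def mult.assoc)
  have "is_eigenvalue M (h_op \<omega> p \<beta>) E"
  proof -
    obtain u where u: "u \<in> H10 \<omega>" "L2_sq M u = 1" "q_form \<omega> p \<beta> u = E"
      using ground_state_exists[OF assms] unfolding E_def by blast
    have "q_inner p \<beta> u v = complex_of_real E * L2_inner M u v" if v: "v \<in> H10 \<omega>" for v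
    proof -
      have "0 \<le> 0 + 2 * Re (cnj c * (q_inner p \<beta> u v - complex_of_real E * L2_inner M u v)) +
        (norm c)\<^sup>2 * (q_form \<omega> p \<beta> v - E * L2_sq M v)" for c
      proof -
        have "E * L2_sq M (\<lambda>x. u x + c * v x) \<le> q_form \<omega> p \<beta> (\<lambda>x. u x + c * v x)"
          unfolding E_def by (rule ground_energy_le_H10[OF H10_lincomb[OF u(1) v]])
        then show ?thesis
          unfolding q_form_lincomb[OF u(1) v] L2_sq_lincomb[OF H10_L2[OF u(1)] H10_L2[OF v]] u(2,3)
          by (simp add: algebra_simps)
      qed
      from nonneg_quadratic_bound[OF this] show ?thesis by simp
    qed
    then have "(u, \<lambda>x. complex_of_real E * u x) \<in> h_op \<omega> p \<beta>"
      unfolding h_op_def form_operator_def using u(1) by (simp add: pol scal L2_cmult H10_L2)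
    moreover have "\<not> (AE x in M. u x = 0)"
    proof
      assume "AE x in M. u x = 0"
      then have "L2_sq M u = L2_sq M (\<lambda>_. 0)"
        by (intro L2_sq_cong_AE H10_L2[OF u(1)]) (auto simp: L2_def)
      then show False using u(2) by (simp add: L2_sq_def)
    qed
    ultimately show ?thesis unfolding is_eigenvalue_def by blast
  qed
  moreover have "E \<le> \<mu>" if \<mu>: "is_eigenvalue M (h_op \<omega> p \<beta>) \<mu>" for \<mu>
  proof -
    obtain u where u: "(u, \<lambda>x. complex_of_real \<mu> * u x) \<in> h_op \<omega> p \<beta>" "\<not> (AE x in M. u x = 0)"
      using \<mu> unfolding is_eigenvalue_def by blast
    then have H: "u \<in> H10 \<omega>" and eq: "q_inner p \<beta> u u = complex_of_real \<mu> * complex_of_real (L2_sq M u)"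
      unfolding h_op_def form_operator_def by (auto simp: pol scal L2_inner_self)
    have "q_inner p \<beta> u u = complex_of_real (q_form \<omega> p \<beta> u)"
      unfolding q_inner_def q_form_eq[OF H10_weak_partials[OF H]] form_val_def by (simp add: L2_inner_self)
    with eq have "q_form \<omega> p \<beta> u = \<mu> * L2_sq M u" by (simp flip: of_real_mult)
    then have le: "E * L2_sq M u \<le> \<mu> * L2_sq M u" using ground_energy_le_H10[OF H, of p \<beta>] by (simp add: E_def)
    have "L2_sq M u \<noteq> 0"
    proof
      assume "L2_sq M u = 0"
      then have "AE x in M. (norm (u x))\<^sup>2 = 0"
        unfolding L2_sq_def by (subst (asm) integral_nonneg_eq_0_iff_AE[OF L2D(2)[OF H10_L2[OF H]]]) auto
      then show False using u(2) by simp
    qed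
    then have "L2_sq M u > 0" using L2_sq_nonneg[of M u] by linarith
    with le show ?thesis by simp
  qed
  ultimately show ?thesis
    unfolding E1_def lowest_eigenvalue_def E_def by (intro Least_equality)
qed

end

section \<open>The two bounds\<close>

text \<open>Cauchy--Schwarz in the plane in disguise: for \<open>k > 0\<close>, \<open>Y - Z\<close> is the product of \<open>(1, sqrt k)\<close> with
  \<open>(Y, - Z / sqrt k)\<close>.\<close>

lemma completing_square_bound:
  fixes Y Z G k :: real
  assumes "k \<ge> 0" "G \<ge> 0" "Z\<^sup>2 \<le> k * G"
  shows "(Y - Z)\<^sup>2 \<le> (1 + k) * (Y\<^sup>2 + G)"
proof (cases "k = 0")
  case True
  with assms show ?thesis by simp
next
  case False
  then have k: "k > 0" using assms by simp
  have "0 \<le> (k * Y + Z)\<^sup>2" by simp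
  then have "0 \<le> k * (k * Y\<^sup>2) + k * (2 * Y * Z) + k * G"
    using assms(3) by (simp add: power2_sum power2_eq_square algebra_simps)
  then have "0 \<le> k * (k * Y\<^sup>2 + 2 * Y * Z + G)" by (simp add: algebra_simps)
  then have "0 \<le> k * Y\<^sup>2 + 2 * Y * Z + G" using k by (simp add: zero_le_mult_iff)
  then show ?thesis using assms(3) by (simp add: power2_diff algebra_simps)
qed

text \<open>The diamagnetic inequality at a single point \<open>(x1, x2)\<close>, where a function has the value \<open>z\<close> and
  the partial derivatives \<open>a\<close> and \<open>b\<close>; then \<open>A\<close> and \<open>B\<close> are those of its regularized modulus. After
  multiplication by the phase \<open>e\<close> of the conjugate of \<open>z\<close>, real parts of \<open>a\<close> and \<open>b\<close> describe
  the change of the modulus and imaginary parts the current. The regularization multiplies the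
  former by \<open>\<bar>z\<bar> / m \<le> 1\<close>, and the latter are estimated by completing the square.\<close>

lemma soft_abs_form_density:
  fixes z a b :: complex and x1 x2 p \<beta> \<delta> C :: real
  assumes C: "x1\<^sup>2 + x2\<^sup>2 \<le> C" and \<delta>: "\<delta> > 0"
  defines "m \<equiv> sqrt ((norm z)\<^sup>2 + \<delta>\<^sup>2)"
  defines "A \<equiv> Re (cnj z * a) / m" and "B \<equiv> Re (cnj z * b) / m"
  shows "A\<^sup>2 + B\<^sup>2 + \<beta>\<^sup>2 * (x1 * B - x2 * A)\<^sup>2 + (1 - \<beta>\<^sup>2 * C / (1 + \<beta>\<^sup>2 * C)) * p\<^sup>2 * (norm z)\<^sup>2 \<le>
    (norm a)\<^sup>2 + (norm b)\<^sup>2 +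
    (norm (\<i> * complex_of_real \<beta> * (complex_of_real x1 * b - complex_of_real x2 * a) - complex_of_real p * z))\<^sup>2"
proof (cases "z = 0")
  case True
  then show ?thesis by (simp add: A_def B_def)
next
  case False
  define r where "r = norm z"
  have r: "r > 0" using False by (simp add: r_def)
  have m: "m > 0" "r \<le> m"
    using r \<delta> by (auto simp: m_def r_def intro!: real_sqrt_gt_zero add_pos_pos real_le_rsqrt)
  define e where "e = cnj z / of_real r"
  have e: "norm e = 1" using r by (simp add: e_def norm_divide r_def)
  have ez: "e * z = of_real r"
    using complex_norm_square[of z] r by (simp add: e_def r_def[symmetric] power2_eq_square mult.commute[of "cnj z"] field_simps)
  define \<alpha> \<alpha>' b1 b2 where "\<alpha> = Re (e * a)" and "\<alpha>' = Im (e * a)" and "b1 = Re (e * b)" and "b2 = Im (e * b)"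
  have na: "(norm a)\<^sup>2 = \<alpha>\<^sup>2 + \<alpha>'\<^sup>2" and nb: "(norm b)\<^sup>2 = b1\<^sup>2 + b2\<^sup>2"
    unfolding \<alpha>_def \<alpha>'_def b1_def b2_def cmod_power2[symmetric] norm_mult e by simp_all
  define t where "t = r / m"
  have t: "0 \<le> t" "t \<le> 1" using r m by (auto simp: t_def)
  have AB: "A = t * \<alpha>" "B = t * b1"
    using r by (auto simp: A_def B_def t_def \<alpha>_def b1_def e_def)
  let ?w = "\<i> * complex_of_real \<beta> * (complex_of_real x1 * b - complex_of_real x2 * a) - complex_of_real p * z"
  have ew: "e * ?w = \<i> * complex_of_real \<beta> * (complex_of_real x1 * (e * b) - complex_of_real x2 * (e * a)) - complex_of_real (p * r)"
    using ez by (simp add: algebra_simps)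
  have "Re (e * ?w) = - (p * r + \<beta> * (x1 * b2 - x2 * \<alpha>'))" "Im (e * ?w) = \<beta> * (x1 * b1 - x2 * \<alpha>)"
    unfolding ew by (simp_all add: \<alpha>_def \<alpha>'_def b1_def b2_def algebra_simps)
  note parts = this
  have "(norm ?w)\<^sup>2 = (norm (e * ?w))\<^sup>2" by (simp only: norm_mult e mult_1_left)
  also have "\<dots> = (Re (e * ?w))\<^sup>2 + (Im (e * ?w))\<^sup>2" by (rule cmod_power2)
  finally have nw: "(norm ?w)\<^sup>2 = (p * r + \<beta> * (x1 * b2 - x2 * \<alpha>'))\<^sup>2 + (\<beta> * (x1 * b1 - x2 * \<alpha>))\<^sup>2"
    by (simp only: parts power2_minus)
  have t2: "t\<^sup>2 \<le> 1" using t by (simp add: power_le_one)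
  have "A\<^sup>2 + B\<^sup>2 + \<beta>\<^sup>2 * (x1 * B - x2 * A)\<^sup>2 = t\<^sup>2 * (\<alpha>\<^sup>2 + b1\<^sup>2 + (\<beta> * (x1 * b1 - x2 * \<alpha>))\<^sup>2)"
    by (simp add: AB power2_eq_square algebra_simps)
  also have "\<dots> \<le> \<alpha>\<^sup>2 + b1\<^sup>2 + (\<beta> * (x1 * b1 - x2 * \<alpha>))\<^sup>2"
    using t2 by (intro mult_left_le_one_le) auto
  finally have re: "A\<^sup>2 + B\<^sup>2 + \<beta>\<^sup>2 * (x1 * B - x2 * A)\<^sup>2 \<le> \<alpha>\<^sup>2 + b1\<^sup>2 + (\<beta> * (x1 * b1 - x2 * \<alpha>))\<^sup>2" .
  define G where "G = \<alpha>'\<^sup>2 + b2\<^sup>2"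
  define Z where "Z = \<beta> * (x1 * b2 - x2 * \<alpha>')"
  have C0: "C \<ge> 0" using C sum_power2_ge_zero[of x1 x2] by linarith
  have "(x1 * b2 - x2 * \<alpha>')\<^sup>2 \<le> (x1\<^sup>2 + x2\<^sup>2) * G"
    using zero_le_power2[of "x1 * \<alpha>' + x2 * b2"] by (simp add: G_def power2_eq_square algebra_simps)
  also have "\<dots> \<le> C * G" using C by (intro mult_right_mono) (auto simp: G_def)
  finally have "Z\<^sup>2 \<le> \<beta>\<^sup>2 * C * G"
    unfolding Z_def power_mult_distrib by (simp add: mult_left_mono mult.assoc)
  from completing_square_bound[OF _ _ this, of "p * r + Z"] C0
  have "(p * r)\<^sup>2 \<le> (1 + \<beta>\<^sup>2 * C) * ((p * r + Z)\<^sup>2 + G)" by (simp add: G_def)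
  moreover have pos: "1 + \<beta>\<^sup>2 * C > 0" using C0 by (simp add: add_pos_nonneg)
  ultimately have "(p * r)\<^sup>2 / (1 + \<beta>\<^sup>2 * C) \<le> (p * r + Z)\<^sup>2 + G" by (simp add: divide_le_eq mult.commute)
  moreover have "1 - \<beta>\<^sup>2 * C / (1 + \<beta>\<^sup>2 * C) = 1 / (1 + \<beta>\<^sup>2 * C)" using pos by (simp add: field_simps)
  ultimately have "(1 - \<beta>\<^sup>2 * C / (1 + \<beta>\<^sup>2 * C)) * p\<^sup>2 * (norm z)\<^sup>2 \<le> (p * r + Z)\<^sup>2 + G"
    by (simp add: r_def power_mult_distrib)
  with re show ?thesis unfolding na nb nw G_def Z_def by linarith
qed

context bounded_open_set
begin

text \<open>The infimum bounds the form at \<open>\<phi>\<close> and at its conjugate \<open>\<psi>\<close>, hence also the mean of the two values,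
  in which the terms linear in \<open>p\<close> cancel.\<close>

lemma ground_energy_upper:
  assumes ne: "\<omega> \<noteq> {}"
  shows "ground_energy p \<beta> \<le> ground_energy 0 \<beta> + p\<^sup>2"
proof -
  have "ground_energy p \<beta> - p\<^sup>2 \<le> q_form \<omega> 0 \<beta> \<phi>" if \<phi>: "\<phi> \<in> test_functions \<omega>" and n: "L2_sq M \<phi> = 1" for \<phi>
  proof -
    define \<psi> where "\<psi> x = cnj (\<phi> x)" for x
    have \<psi>: "\<psi> \<in> test_functions \<omega>" unfolding \<psi>_def by (rule test_functions_cnj[OF \<phi>])
    have d: "dir_deriv b \<psi> x = cnj (dir_deriv b \<phi> x)" for b x unfolding \<psi>_def by (rule dir_deriv_cnj[OF \<phi>])
    have n': "L2_sq M \<psi> = 1" using n by (simp add: L2_sq_def \<psi>_def)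
    let ?d1 = "dir_deriv (1, 0)" and ?d2 = "dir_deriv (0, 1)"
    have L: "f \<in> L2 M \<and> ?d1 f \<in> L2 M \<and> ?d2 f \<in> L2 M" if "f \<in> test_functions \<omega>" for f
      using that by (auto intro!: test_L2 test_functions_dir_deriv simp: Basis_plane)
    have i: "integrable M (\<lambda>x. (norm (twisted r \<beta> f (?d1 f) (?d2 f) x))\<^sup>2)" if "f \<in> test_functions \<omega>" for r f
      using L[OF that] by (intro L2D(2) twisted_L2) auto
    have pt: "(norm (twisted p \<beta> \<phi> (?d1 \<phi>) (?d2 \<phi>) x))\<^sup>2 + (norm (twisted p \<beta> \<psi> (?d1 \<psi>) (?d2 \<psi>) x))\<^sup>2 =
        2 * (norm (twisted 0 \<beta> \<phi> (?d1 \<phi>) (?d2 \<phi>) x))\<^sup>2 + 2 * p\<^sup>2 * (norm (\<phi> x))\<^sup>2" for x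
      unfolding twisted_def d \<psi>_def cmod_power2 by (simp add: power2_eq_square algebra_simps)
    have "L2_sq M (twisted p \<beta> \<phi> (?d1 \<phi>) (?d2 \<phi>)) + L2_sq M (twisted p \<beta> \<psi> (?d1 \<psi>) (?d2 \<psi>)) =
        (\<integral>x. (norm (twisted p \<beta> \<phi> (?d1 \<phi>) (?d2 \<phi>) x))\<^sup>2 + (norm (twisted p \<beta> \<psi> (?d1 \<psi>) (?d2 \<psi>) x))\<^sup>2 \<partial>M)"
      using i[OF \<phi>] i[OF \<psi>] by (simp add: L2_sq_def)
    also have "\<dots> = 2 * L2_sq M (twisted 0 \<beta> \<phi> (?d1 \<phi>) (?d2 \<phi>)) + 2 * p\<^sup>2 * L2_sq M \<phi>"
      unfolding pt using i[OF \<phi>] L2D(2)[OF test_L2[OF \<phi>]] by (simp add: L2_sq_def)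
    finally have "L2_sq M (twisted p \<beta> \<phi> (?d1 \<phi>) (?d2 \<phi>)) + L2_sq M (twisted p \<beta> \<psi> (?d1 \<psi>) (?d2 \<psi>)) =
       2 * L2_sq M (twisted 0 \<beta> \<phi> (?d1 \<phi>) (?d2 \<phi>)) + 2 * p\<^sup>2" by (simp add: n)
    moreover have "L2_sq M (dir_deriv b \<psi>) = L2_sq M (dir_deriv b \<phi>)" for b by (simp add: L2_sq_def d)
    ultimately have "q_form \<omega> p \<beta> \<phi> + q_form \<omega> p \<beta> \<psi> = 2 * q_form \<omega> 0 \<beta> \<phi> + 2 * p\<^sup>2"
      unfolding q_form_test[OF \<phi>] q_form_test[OF \<psi>] form_val_def by simp
    with ground_energy_le_normalized[OF \<phi> n, of p \<beta>] ground_energy_le_normalized[OF \<psi> n', of p \<beta>]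
    show ?thesis by linarith
  qed
  then have "ground_energy p \<beta> - p\<^sup>2 \<le> ground_energy 0 \<beta>"
    unfolding ground_energy_def[of 0] using exists_normalized_test_function[OF ne] by (intro cINF_greatest) auto
  then show ?thesis by simp
qed

text \<open>Integrates the pointwise inequality. The regularized modulus \<open>\<psi>\<close> loses at most \<open>2 \<delta> \<integral>\<bar>\<phi>\<bar>\<close> of the
  squared norm of \<open>\<phi>\<close>, which is made smaller than any given \<open>\<eta>\<close>.\<close>

lemma ground_energy_lower:
  assumes ne: "\<omega> \<noteq> {}"
  shows "ground_energy 0 \<beta> + (1 - eps_const \<omega> \<beta>) * p\<^sup>2 \<le> ground_energy p \<beta>"
proof -
  define E where "E = ground_energy 0 \<beta>"
  have E0: "E \<ge> 0" unfolding E_def by (rule ground_energy_nonneg[OF ne])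
  have Cb: "(fst x)\<^sup>2 + (snd x)\<^sup>2 \<le> C_const \<omega>" if "x \<in> \<omega>" for x
  proof -
    obtain R where R: "\<And>y. y \<in> \<omega> \<Longrightarrow> \<bar>fst y\<bar> \<le> R \<and> \<bar>snd y\<bar> \<le> R" using coordinates_bounded by blast
    have "bdd_above ((\<lambda>x. (fst x)\<^sup>2 + (snd x)\<^sup>2) ` \<omega>)"
    proof (rule bdd_aboveI2)
      fix y assume "y \<in> \<omega>"
      then show "(fst y)\<^sup>2 + (snd y)\<^sup>2 \<le> R\<^sup>2 + R\<^sup>2"
        using R[of y] by (intro add_mono) (auto simp: abs_le_square_iff[symmetric])
    qed
    then show ?thesis unfolding C_const_def using that by (rule cSUP_upper2) simp
  qed
  have "E + (1 - eps_const \<omega> \<beta>) * p\<^sup>2 \<le> q_form \<omega> p \<beta> \<phi>" if \<phi>: "\<phi> \<in> test_functions \<omega>" and n: "L2_sq M \<phi> = 1" for \<phi>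
  proof (rule field_le_epsilon)
    fix \<eta> :: real assume \<eta>: "\<eta> > 0"
    define I where "I = (\<integral>x. norm (\<phi> x) \<partial>M)"
    have I: "I \<ge> 0" by (simp add: I_def)
    \<comment> \<open>The summand \<open>1\<close> only keeps the denominator positive.\<close>
    define \<delta> where "\<delta> = \<eta> / (2 * E * I + 1)"
    have D: "2 * E * I + 1 > 0" using E0 I by (simp add: add_nonneg_pos)
    have \<delta>: "\<delta> > 0" using \<eta> D by (simp add: \<delta>_def)
    have small: "2 * E * I * \<delta> \<le> \<eta>"
      using D \<eta> by (simp add: \<delta>_def divide_le_eq)
    define \<psi> where "\<psi> x = complex_of_real (soft_abs \<delta> (\<phi> x))" for x
    have \<psi>: "\<psi> \<in> test_functions \<omega>" unfolding \<psi>_def by (rule soft_abs_test_function(1)[OF \<phi> \<delta>])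
    have d: "dir_deriv b \<psi> x = complex_of_real (Re (cnj (\<phi> x) * dir_deriv b \<phi> x) / sqrt ((norm (\<phi> x))\<^sup>2 + \<delta>\<^sup>2))" for b x
      unfolding \<psi>_def by (rule soft_abs_test_function(2)[OF \<phi> \<delta>])
    let ?d1 = "dir_deriv (1, 0)" and ?d2 = "dir_deriv (0, 1)"
    let ?q = "\<lambda>p f x. (norm (?d1 f x))\<^sup>2 + (norm (?d2 f x))\<^sup>2 + (norm (twisted p \<beta> f (?d1 f) (?d2 f) x))\<^sup>2"
    have L: "f \<in> L2 M" "?d1 f \<in> L2 M" "?d2 f \<in> L2 M" if "f \<in> test_functions \<omega>" for f
      using that by (auto intro!: test_L2 test_functions_dir_deriv simp: Basis_plane)
    have i: "integrable M (?q r f)" if "f \<in> test_functions \<omega>" for r f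
      using L[OF that] by (intro Bochner_Integration.integrable_add L2D(2) twisted_L2)
    have q: "q_form \<omega> r \<beta> f = (\<integral>x. ?q r f x \<partial>M)" if "f \<in> test_functions \<omega>" for r f
      unfolding q_form_test[OF that] form_val_def L2_sq_def
      using L2D(2)[OF L(2)[OF that]] L2D(2)[OF L(3)[OF that]] L2D(2)[OF twisted_L2[OF L[OF that]]] by simp
    have pt: "?q 0 \<psi> x + (1 - eps_const \<omega> \<beta>) * p\<^sup>2 * (norm (\<phi> x))\<^sup>2 \<le> ?q p \<phi> x" if x: "x \<in> \<omega>" for x
    proof -
      have tw: "(norm (twisted 0 \<beta> \<psi> (?d1 \<psi>) (?d2 \<psi>) x))\<^sup>2 =
        \<beta>\<^sup>2 * (fst x * (Re (cnj (\<phi> x) * ?d2 \<phi> x) / sqrt ((norm (\<phi> x))\<^sup>2 + \<delta>\<^sup>2)) -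
               snd x * (Re (cnj (\<phi> x) * ?d1 \<phi> x) / sqrt ((norm (\<phi> x))\<^sup>2 + \<delta>\<^sup>2)))\<^sup>2"
      proof -
        have "(norm (\<i> * complex_of_real \<beta> * (complex_of_real s * complex_of_real t - complex_of_real s' * complex_of_real t') - complex_of_real 0 * y))\<^sup>2 =
          \<beta>\<^sup>2 * (s * t - s' * t')\<^sup>2" for s t s' t' y
          by (simp add: norm_mult power_mult_distrib flip: of_real_mult of_real_diff)
        then show ?thesis unfolding twisted_def d .
      qed
      have nd: "(norm (dir_deriv b \<psi> x))\<^sup>2 = (Re (cnj (\<phi> x) * dir_deriv b \<phi> x) / sqrt ((norm (\<phi> x))\<^sup>2 + \<delta>\<^sup>2))\<^sup>2" for b
        unfolding d norm_of_real power2_abs ..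
      show ?thesis
        unfolding tw nd eps_const_def unfolding twisted_def by (rule soft_abs_form_density[OF Cb[OF x] \<delta>])
    qed
    have soft: "(norm (\<phi> x))\<^sup>2 - 2 * \<delta> * norm (\<phi> x) \<le> (norm (\<psi> x))\<^sup>2" for x
    proof -
      have "norm (\<phi> x) \<le> sqrt ((norm (\<phi> x))\<^sup>2 + \<delta>\<^sup>2)" by (rule real_le_rsqrt) simp
      then have s: "norm (\<phi> x) - \<delta> \<le> soft_abs \<delta> (\<phi> x)" by (simp add: soft_abs_def)
      have nn: "norm (\<psi> x) = \<bar>soft_abs \<delta> (\<phi> x)\<bar>" by (simp add: \<psi>_def)
      show ?thesis
      proof (cases "norm (\<phi> x) \<ge> \<delta>")
        case True
        then have "(norm (\<phi> x) - \<delta>)\<^sup>2 \<le> (soft_abs \<delta> (\<phi> x))\<^sup>2" using s by (intro power_mono) auto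
        then have "(norm (\<phi> x))\<^sup>2 - 2 * \<delta> * norm (\<phi> x) + \<delta>\<^sup>2 \<le> (soft_abs \<delta> (\<phi> x))\<^sup>2"
          by (simp add: power2_diff mult_ac)
        then show ?thesis using zero_le_power2[of \<delta>] unfolding nn power2_abs by linarith
      next
        case False
        then have "norm (\<phi> x) * norm (\<phi> x) \<le> norm (\<phi> x) * (2 * \<delta>)" using \<delta> by (intro mult_left_mono) auto
        then have "(norm (\<phi> x))\<^sup>2 - 2 * \<delta> * norm (\<phi> x) \<le> 0" by (simp add: power2_eq_square mult_ac)
        then show ?thesis using zero_le_power2[of "norm (\<psi> x)"] by linarith
      qed
    qed
    have "1 - 2 * \<delta> * I \<le> L2_sq M \<psi>"
    proof -
      have "1 - 2 * \<delta> * I = (\<integral>x. (norm (\<phi> x))\<^sup>2 - 2 * \<delta> * norm (\<phi> x) \<partial>M)"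
        using n L2D(2)[OF L(1)[OF \<phi>]] test_function_integrable[OF \<phi> open_\<omega> bounded_\<omega>] by (simp add: I_def L2_sq_def)
      also have "\<dots> \<le> L2_sq M \<psi>"
        unfolding L2_sq_def
        by (intro integral_mono soft Bochner_Integration.integrable_diff integrable_mult_right integrable_norm
            L2D(2) L(1) \<phi> \<psi> test_function_integrable open_\<omega> bounded_\<omega>)
      finally show ?thesis .
    qed
    then have "E * (1 - 2 * \<delta> * I) \<le> E * L2_sq M \<psi>" using E0 by (rule mult_left_mono)
    also have "\<dots> \<le> q_form \<omega> 0 \<beta> \<psi>" unfolding E_def by (rule ground_energy_le_test[OF \<psi>])
    finally have 1: "E * (1 - 2 * \<delta> * I) \<le> q_form \<omega> 0 \<beta> \<psi>" .
    have "q_form \<omega> 0 \<beta> \<psi> + (1 - eps_const \<omega> \<beta>) * p\<^sup>2 * L2_sq M \<phi> =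
      (\<integral>x. ?q 0 \<psi> x + (1 - eps_const \<omega> \<beta>) * p\<^sup>2 * (norm (\<phi> x))\<^sup>2 \<partial>M)"
      unfolding q[OF \<psi>] L2_sq_def
      by (subst Bochner_Integration.integral_add[OF i[OF \<psi>]]) (use L2D(2)[OF L(1)[OF \<phi>]] in simp_all)
    also have "\<dots> \<le> (\<integral>x. ?q p \<phi> x \<partial>M)"
      by (rule integral_mono[OF Bochner_Integration.integrable_add[OF i[OF \<psi>] integrable_mult_right[OF L2D(2)[OF L(1)[OF \<phi>]]]] i[OF \<phi>]])
        (rule pt, simp)
    finally have "q_form \<omega> 0 \<beta> \<psi> + (1 - eps_const \<omega> \<beta>) * p\<^sup>2 \<le> q_form \<omega> p \<beta> \<phi>"
      unfolding q[OF \<phi>] n by simp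
    with 1 small show "E + (1 - eps_const \<omega> \<beta>) * p\<^sup>2 \<le> q_form \<omega> p \<beta> \<phi> + \<eta>"
      by (simp add: algebra_simps)
  qed
  then show ?thesis
    unfolding E_def ground_energy_def[of p] using exists_normalized_test_function[OF ne] by (intro cINF_greatest) auto
qed

end

theorem theorem3p1:
  fixes \<omega> :: "(real \<times> real) set" and \<beta> p :: real
  assumes "open \<omega>" and "connected \<omega>" and "bounded \<omega>"
    and "Ck_boundary 2 \<omega>"
    and "(0, 0) \<in> \<omega>"
  shows "E1 \<omega> 0 \<beta> + (1 - eps_const \<omega> \<beta>) * p\<^sup>2 \<le> E1 \<omega> p \<beta> \<and>
         E1 \<omega> p \<beta> \<le> E1 \<omega> 0 \<beta> + p\<^sup>2"
proof -
  interpret bounded_open_set \<omega> using assms by unfold_locales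
  have ne: "\<omega> \<noteq> {}" using assms(5) by auto
  show ?thesis
    unfolding E1_eq_ground_energy[OF ne]
    using ground_energy_lower[OF ne] ground_energy_upper[OF ne] by (rule conjI)
qed

end
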